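(* Assume $n_-(T_{\min})\le n_+(T_{\min})$. For every boundary parameter $\tau\in\widetilde R(\widetilde{\mathcal H}_b,\mathcal H_b)$ the $m$-function $m_\tau(\cdot):\mathbb C\setminus\mathbb R\to[H_0]$ is a Nevanlinna operator function (i.e. holomorphic on $\mathbb C\setminus\mathbb R$ with $\operatorname{Im}\lambda\cdot\operatorname{Im}m_\tau(\lambda)\ge0$ and $m_\tau^*(\lambda)=m_\tau(\bar\lambda)$) such that the relation $$(\operatorname{Im}\lambda)^{-1}\cdot\operatorname{Im}m_\tau(\lambda)\ \ge\ \int_{\mathcal I}v_\tau^*(t,\lambda)\Delta(t)v_\tau(t,\lambda)\,dt$$ holds for all $\lambda\in\mathbb C_+$. If in addition $n_+(T_{\min})=n_-(T_{\min})$, then this inequality holds for all $\lambda\in\mathbb C\setminus\mathbb R$.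
   Context: Setting. $[X,Y]$ is the set of bounded linear operators $X\to Y$, $[X]=[X,X]$, $\operatorname{Im}A=(A-A^* )/(2i)$; $0\in\rho(A)$ means $A$ is boundedly invertible. $H,\hat H$ are finite-dimensional complex Hilbert spaces, $H_0=H\oplus\hat H$, $\mathbb H=H\oplus\hat H\oplus H=H_0\oplus H$; $P_H,P_{\hat H}$ are the orthoprojections of $H_0$ onto $H,\hat H$. $\mathcal I=[a,b\rangle$ is an interval, $-\infty<a<b\le\infty$ (if finite, $b$ may or may not belong to $\mathcal I$). $B,\Delta:\mathcal I\to[\mathbb H]$ are Borel, norm-integrable over every $[a,\beta]\subset\mathcal I$, with $B(t)=B(t)^*$, $\Delta(t)\ge0$ a.e., and $J=\begin{pmatrix}0&0&-I_H\\ 0&iI_{\hat H}&0\\ I_H&0&0\end{pmatrix}$. The system is $Jy'-By=\Delta f$, with homogeneous equation $(E_\lambda)$: $Jy'-By=\lambda\Delta y$; solutions lie in $AC(\mathcal I;\mathbb H)$ (functions absolutely continuous on each $[a,\beta]\subset\mathcal I$). It is assumed definite: for every $\lambda\in\mathbb C$, a solution $y$ of $(E_\lambda)$ with $\Delta y=0$ a.e. is identically zero. $\mathcal L^2_\Delta(\mathcal I)$ is the space of Borel $f:\mathcal I\to\mathbb H$ with $\|f\|^2_\Delta=\int_{\mathcal I}(\Delta f,f)\,dt<\infty$; $L^2_\Delta(\mathcal I)$ is the quotient Hilbert space by $\{\|f\|_\Delta=0\}$, $\pi$ the quotient map. For finite-dimensional $K$, $\mathcal L^2_\Delta[K,\mathbb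 H]$ is the set of Borel $F:\mathcal I\to[K,\mathbb H]$ with $F(\cdot)h\in\mathcal L^2_\Delta(\mathcal I)$ for all $h\in K$. An operator solution of $(E_\lambda)$ is $Y(\cdot,\lambda):\mathcal I\to[K,\mathbb H]$ such that $Y(\cdot,\lambda)h$ solves $(E_\lambda)$ for all $h\in K$; if it lies in $\mathcal L^2_\Delta[K,\mathbb H]$, $Y(\lambda)$ denotes the map $h\mapsto Y(\cdot,\lambda)h\in\operatorname{dom}\mathcal T_{\max}$. Relations. $\mathcal T_{\max}=\{\{y,f\}\in\mathcal L^2_\Delta(\mathcal I)^2: y\in AC(\mathcal I;\mathbb H),\ Jy'-By=\Delta f\text{ a.e.}\}$, $T_{\max}=\{\{\pi y,\pi f\}:\{y,f\}\in\mathcal T_{\max}\}$; $[y,z]_b=\lim_{t\uparrow b}(Jy(t),z(t))$ for $y,z\in\operatorname{dom}\mathcal T_{\max}$; $T_{\min}=\{\{\pi y,\pi f\}:\{y,f\}\in\mathcal T_{\max},\ y(a)=0,\ [y,z]_b=0\ \forall z\in\operatorname{dom}\mathcal T_{\max}\}$ is closed symmetric with $T_{\min}^*=T_{\max}$; $n_\pm(T_{\min})=\dim\ker(T_{\max}-\lambda)$, $\lambda\in\mathbb C_\pm$. Boundary maps at $a$. $U=\begin{pmatrix}u_1&u_2&u_3\\ u_4&u_5&u_6\end{pmatrix}:H\oplus\hat H\oplus H\to\hat H\oplus H$ is surjective with $iu_2u_2^*-u_1u_3^*+u_3u_1^*=iI_{\hat H}$, $iu_5u_2^*-u_4u_3^*+u_6u_1^*=0$,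 $iu_5u_5^*+u_6u_4^*-u_4u_6^*=0$; $\widetilde U=\begin{pmatrix}u_7&u_8&u_9\\ u_1&u_2&u_3\\ u_4&u_5&u_6\end{pmatrix}$ is an extension of $U$ with $\widetilde U^*J\widetilde U=J$. For $y\in AC(\mathcal I;\mathbb H)$, $(\Gamma_{0a}y,\hat\Gamma_ay,\Gamma_{1a}y)^\top=\widetilde Uy(a)\in H\oplus\hat H\oplus H$; $\Gamma_{0a}+\hat\Gamma_a$ maps into $H\oplus\hat H=H_0$. Boundary maps at $b$. $\widetilde{\mathcal H}_b$ is a finite-dimensional Hilbert space, $\mathcal H_b\subset\widetilde{\mathcal H}_b$ a subspace, $\mathcal H_b^\perp=\widetilde{\mathcal H}_b\ominus\mathcal H_b$, and $\Gamma_b=(\Gamma_{0b},\hat\Gamma_b,\Gamma_{1b})^\top:\operatorname{dom}\mathcal T_{\max}\to\widetilde{\mathcal H}_b\oplus\hat H\oplus\mathcal H_b$ is a fixed surjective linear map with $[y,z]_b=(\Gamma_{0b}y,\Gamma_{1b}z)-(\Gamma_{1b}y,\Gamma_{0b}z)+i(P_{\mathcal H_b^\perp}\Gamma_{0b}y,P_{\mathcal H_b^\perp}\Gamma_{0b}z)+i(\hat\Gamma_by,\hat\Gamma_bz)$ (it exists when $n_-(T_{\min})\le n_+(T_{\min})$; $\widetilde{\mathcal H}_b=\mathcal H_b$ iff $n_+(T_{\min})=n_-(T_{\min})$). Boundary parameters. $\widetilde R(\widetilde{\mathcal H}_b,\mathcal H_b)$ consists of collections $\tau=\{\tau_+,\tau_-\}$,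 $\tau_+(\lambda)=\{(C_0(\lambda),C_1(\lambda));\widetilde{\mathcal H}_b\}$ ($\lambda\in\mathbb C_+$), $\tau_-(\lambda)=\{(D_0(\lambda),D_1(\lambda));\mathcal H_b\}$ ($\lambda\in\mathbb C_-$), of holomorphic $C_0:\mathbb C_+\to[\widetilde{\mathcal H}_b]$, $C_1:\mathbb C_+\to[\mathcal H_b,\widetilde{\mathcal H}_b]$, $D_0:\mathbb C_-\to[\widetilde{\mathcal H}_b,\mathcal H_b]$, $D_1:\mathbb C_-\to[\mathcal H_b]$ such that, with $C_0=(C_{01},C_{02})$, $D_0=(D_{01},D_{02})$ on $\widetilde{\mathcal H}_b=\mathcal H_b\oplus\mathcal H_b^\perp$: $2\operatorname{Im}(C_1C_{01}^* )+C_{02}C_{02}^*\ge0$ on $\mathbb C_+$; $2\operatorname{Im}(D_1D_{01}^* )+D_{02}D_{02}^*\le0$ on $\mathbb C_-$; $C_1(\lambda)D_{01}^*(\bar\lambda)-C_{01}(\lambda)D_1^*(\bar\lambda)+iC_{02}(\lambda)D_{02}^*(\bar\lambda)=0$, $\lambda\in\mathbb C_+$; $0\in\rho(C_0-iC_1P_{\mathcal H_b})$ on $\mathbb C_+$; $0\in\rho(D_{01}+iD_1)$ on $\mathbb C_-$ (pairs differing by left multiplication by a holomorphic invertible-operator-valued function are identified). $m$-function. $v_\tau(\cdot,\lambda)\in\mathcal L^2_\Delta[H_0,\mathbb H]$ ($\lambda\in\mathbb C\setminus\mathbb R$) is the unique operator solution of $(E_\lambda)$ with $\Gamma_{1a}v_\tau(\lambda)=-P_H$,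 $i(\hat\Gamma_a-\hat\Gamma_b)v_\tau(\lambda)=P_{\hat H}$, $C_0(\lambda)\Gamma_{0b}v_\tau(\lambda)+C_1(\lambda)\Gamma_{1b}v_\tau(\lambda)=0$ for $\lambda\in\mathbb C_+$ and $D_0(\lambda)\Gamma_{0b}v_\tau(\lambda)+D_1(\lambda)\Gamma_{1b}v_\tau(\lambda)=0$ for $\lambda\in\mathbb C_-$. The $m$-function is $m_\tau(\lambda)=(\Gamma_{0a}+\hat\Gamma_a)v_\tau(\lambda)+\frac i2P_{\hat H}\in[H_0]$. *)

theory Defs
  imports "HOL-Complex_Analysis.Complex_Analysis" "Jordan_Normal_Form.Schur_Decomposition"
begin

no_notation inner (infix "\<bullet>" 70)
no_notation vec_nth (infixl "$" 90)
no_notation fps_nth (infixl "$" 75)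

text \<open>
  A finite-dimensional complex Hilbert space is rendered as \<open>carrier_vec n\<close> of complex vectors,
  with inner product \<open>x \<bullet>c y\<close> (linear in \<open>x\<close>); every dimension \<open>n\<close>, including \<open>0\<close>, is allowed.
  \<open>[X,Y]\<close> is \<open>carrier_mat (dim Y) (dim X)\<close>. An orthogonal sum is concatenation of coordinates.
\<close>

definition blk :: "complex mat \<Rightarrow> nat \<Rightarrow> nat \<Rightarrow> nat \<Rightarrow> nat \<Rightarrow> complex mat" where
  \<comment> \<open>the \<open>m \<times> n\<close> block with upper left corner at row \<open>i\<close>, column \<open>j\<close>\<close>
  "blk A i m j n = mat m n (\<lambda>(k, l). A $$ (i + k, j + l))"

definition mat_of_op :: "nat \<Rightarrow> nat \<Rightarrow> (complex vec \<Rightarrow> complex vec) \<Rightarrow> complex mat" where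
  \<comment> \<open>the matrix of a linear map from dimension \<open>n\<close> to dimension \<open>m\<close>\<close>
  "mat_of_op m n F = mat_of_cols m (map (\<lambda>j. F (unit_vec n j)) [0..<n])"

definition op_norm :: "complex mat \<Rightarrow> real" where
  "op_norm A = (SUP x \<in> {x \<in> carrier_vec (dim_col A). Re (x \<bullet>c x) \<le> 1}.
                  sqrt (Re ((A *\<^sub>v x) \<bullet>c (A *\<^sub>v x))))"

definition Im_op :: "complex mat \<Rightarrow> complex mat" where
  "Im_op A = (1 / (2 * \<i>)) \<cdot>\<^sub>m (A - mat_adjoint A)"

definition op_nonneg :: "nat \<Rightarrow> complex mat \<Rightarrow> bool" where
  "op_nonneg n A \<longleftrightarrow> A \<in> carrier_mat n n \<and>
     (\<forall>x \<in> carrier_vec n. Im ((A *\<^sub>v x) \<bullet>c x) = 0 \<and> 0 \<le> Re ((A *\<^sub>v x) \<bullet>c x))"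

definition op_ge :: "nat \<Rightarrow> complex mat \<Rightarrow> complex mat \<Rightarrow> bool" where
  "op_ge n A B \<longleftrightarrow> A \<in> carrier_mat n n \<and> B \<in> carrier_mat n n \<and> op_nonneg n (A - B)"

definition holomorphic_op :: "nat \<Rightarrow> nat \<Rightarrow> (complex \<Rightarrow> complex mat) \<Rightarrow> complex set \<Rightarrow> bool" where
  "holomorphic_op m n F S \<longleftrightarrow> (\<forall>z \<in> S. F z \<in> carrier_mat m n) \<and>
     (\<forall>i < m. \<forall>j < n. (\<lambda>z. F z $$ (i, j)) holomorphic_on S)"

definition nevanlinna_op :: "nat \<Rightarrow> (complex \<Rightarrow> complex mat) \<Rightarrow> bool" where
  "nevanlinna_op n M \<longleftrightarrow> holomorphic_op n n M {z. Im z \<noteq> 0} \<and>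
     (\<forall>z. Im z \<noteq> 0 \<longrightarrow> op_nonneg n (complex_of_real (Im z) \<cdot>\<^sub>m Im_op (M z)) \<and>
                          mat_adjoint (M z) = M (cnj z))"

text \<open>
  \<open>dimH\<close>, \<open>dimHh\<close> are the dimensions of \<open>H\<close> and H-hat (the outer and the middle summand of the
  phase space of dimension \<open>dimHH\<close>), \<open>ival\<close> is the interval with endpoints \<open>lend\<close>, \<open>rend\<close>, and \<open>coefB\<close>, \<open>weight\<close> are the
  coefficients \<open>B\<close>, \<open>\<Delta>\<close> of \<open>J y' - B y = \<Delta> f\<close>.
\<close>

record symsys =
  dimH :: nat
  dimHh :: nat
  lend :: real
  rend :: ereal
  ival :: "real set"
  coefB :: "real \<Rightarrow> complex mat"
  weight :: "real \<Rightarrow> complex mat"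

definition dim0 :: "symsys \<Rightarrow> nat" where
  "dim0 S = dimH S + dimHh S"

definition dimHH :: "symsys \<Rightarrow> nat" where
  "dimHH S = dimH S + dimHh S + dimH S"

definition Jmat :: "symsys \<Rightarrow> complex mat" where
  "Jmat S = mat (dimHH S) (dimHH S) (\<lambda>(i, j).
     if i < dimH S then (if j = i + dim0 S then - 1 else 0)
     else if i < dim0 S then (if j = i then \<i> else 0)
     else (if j + dim0 S = i then 1 else 0))"

definition borel_vec_on :: "nat \<Rightarrow> real set \<Rightarrow> (real \<Rightarrow> complex vec) \<Rightarrow> bool" where
  "borel_vec_on n I f \<longleftrightarrow> (\<forall>i < n. (\<lambda>t. f t $ i) \<in> borel_measurable (restrict_space borel I))"

definition borel_mat_on :: "nat \<Rightarrow> nat \<Rightarrow> real set \<Rightarrow> (real \<Rightarrow> complex mat) \<Rightarrow> bool" where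
  "borel_mat_on m n I F \<longleftrightarrow>
     (\<forall>i < m. \<forall>j < n. (\<lambda>t. F t $$ (i, j)) \<in> borel_measurable (restrict_space borel I))"

definition symmetric_system :: "symsys \<Rightarrow> bool" where
  "symmetric_system S \<longleftrightarrow>
     ereal (lend S) < rend S \<and>
     (ival S = {t. lend S \<le> t \<and> ereal t < rend S} \<or> ival S = {t. lend S \<le> t \<and> ereal t \<le> rend S}) \<and>
     (\<forall>t \<in> ival S. coefB S t \<in> carrier_mat (dimHH S) (dimHH S) \<and>
                    weight S t \<in> carrier_mat (dimHH S) (dimHH S)) \<and>
     borel_mat_on (dimHH S) (dimHH S) (ival S) (coefB S) \<and>
     borel_mat_on (dimHH S) (dimHH S) (ival S) (weight S) \<and>
     (\<forall>\<beta> \<in> ival S. set_integrable lborel {lend S..\<beta>} (\<lambda>t. op_norm (coefB S t)) \<and>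
                    set_integrable lborel {lend S..\<beta>} (\<lambda>t. op_norm (weight S t))) \<and>
     (AE t \<in> ival S in lborel. mat_adjoint (coefB S t) = coefB S t) \<and>
     (AE t \<in> ival S in lborel. op_nonneg (dimHH S) (weight S t))"

text \<open>
  Functions on \<open>ival S\<close> are represented by total functions on the reals with values in
  \<open>carrier_vec (dimHH S)\<close>. All conditions concern points of \<open>ival S\<close> only, so the values elsewhere
  are irrelevant.
\<close>

definition ac_on :: "(real \<Rightarrow> complex) \<Rightarrow> real \<Rightarrow> real \<Rightarrow> bool" where
  "ac_on f \<alpha> \<beta> \<longleftrightarrow> (\<forall>\<epsilon> > 0. \<exists>\<delta> > 0. \<forall>P :: (real \<times> real) set.
     finite P \<and> (\<forall>(c, d) \<in> P. \<alpha> \<le> c \<and> c \<le> d \<and> d \<le> \<beta>) \<and>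
     pairwise (\<lambda>(c, d) (c', d'). {c<..<d} \<inter> {c'<..<d'} = {}) P \<and>
     (\<Sum>(c, d) \<in> P. d - c) < \<delta> \<longrightarrow> (\<Sum>(c, d) \<in> P. norm (f d - f c)) < \<epsilon>)"

definition AC :: "symsys \<Rightarrow> (real \<Rightarrow> complex vec) set" where
  "AC S = {y. (\<forall>t. y t \<in> carrier_vec (dimHH S)) \<and>
              (\<forall>\<beta> \<in> ival S. \<forall>i < dimHH S. ac_on (\<lambda>t. y t $ i) (lend S) \<beta>)}"

definition has_vec_deriv :: "nat \<Rightarrow> (real \<Rightarrow> complex vec) \<Rightarrow> complex vec \<Rightarrow> real \<Rightarrow> bool" where
  "has_vec_deriv n y d t \<longleftrightarrow> d \<in> carrier_vec n \<and>
     (\<forall>i < n. ((\<lambda>s. y s $ i) has_vector_derivative d $ i) (at t))"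

text \<open>\<open>J y' - B y = \<Delta> f\<close> almost everywhere on the interval; \<open>y'\<close> exists almost everywhere for
  \<open>y \<in> AC S\<close>.\<close>

definition sys_eq :: "symsys \<Rightarrow> (real \<Rightarrow> complex vec) \<Rightarrow> (real \<Rightarrow> complex vec) \<Rightarrow> bool" where
  "sys_eq S y f \<longleftrightarrow> (AE t \<in> ival S in lborel. \<exists>d. has_vec_deriv (dimHH S) y d t \<and>
     Jmat S *\<^sub>v d - coefB S t *\<^sub>v y t = weight S t *\<^sub>v f t)"

definition solution :: "symsys \<Rightarrow> complex \<Rightarrow> (real \<Rightarrow> complex vec) \<Rightarrow> bool" where
  "solution S \<zeta> y \<longleftrightarrow> y \<in> AC S \<and> sys_eq S y (\<lambda>t. \<zeta> \<cdot>\<^sub>v y t)"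

definition definite_system :: "symsys \<Rightarrow> bool" where
  "definite_system S \<longleftrightarrow> (\<forall>\<zeta> y. solution S \<zeta> y \<and>
     (AE t \<in> ival S in lborel. weight S t *\<^sub>v y t = 0\<^sub>v (dimHH S)) \<longrightarrow>
     (\<forall>t \<in> ival S. y t = 0\<^sub>v (dimHH S)))"

definition normsq :: "symsys \<Rightarrow> (real \<Rightarrow> complex vec) \<Rightarrow> ennreal" where
  "normsq S f = (\<integral>\<^sup>+ t \<in> ival S. ennreal (Re ((weight S t *\<^sub>v f t) \<bullet>c f t)) \<partial>lborel)"

definition L2fun :: "symsys \<Rightarrow> (real \<Rightarrow> complex vec) set" where
  "L2fun S = {f. (\<forall>t. f t \<in> carrier_vec (dimHH S)) \<and> borel_vec_on (dimHH S) (ival S) f \<and>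
                 normsq S f < \<infinity>}"

text \<open>The elements of the quotient space are the classes \<open>L2class S f\<close> for \<open>f \<in> L2fun S\<close>.\<close>

definition L2class :: "symsys \<Rightarrow> (real \<Rightarrow> complex vec) \<Rightarrow> (real \<Rightarrow> complex vec) set" where
  "L2class S f = {g \<in> L2fun S. normsq S (\<lambda>t. g t - f t) = 0}"

definition Tmax_fun :: "symsys \<Rightarrow> ((real \<Rightarrow> complex vec) \<times> (real \<Rightarrow> complex vec)) set" where
  "Tmax_fun S = {(y, f). y \<in> L2fun S \<and> f \<in> L2fun S \<and> y \<in> AC S \<and> sys_eq S y f}"

definition Tmax :: "symsys \<Rightarrow> ((real \<Rightarrow> complex vec) set \<times> (real \<Rightarrow> complex vec) set) set" where
  "Tmax S = (\<lambda>(y, f). (L2class S y, L2class S f)) ` Tmax_fun S"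

definition Tmax_ker :: "symsys \<Rightarrow> complex \<Rightarrow> (real \<Rightarrow> complex vec) set set" where
  "Tmax_ker S \<zeta> = {L2class S y | y. y \<in> L2fun S \<and>
                      (L2class S y, L2class S (\<lambda>t. \<zeta> \<cdot>\<^sub>v y t)) \<in> Tmax S}"

text \<open>The dimension of a finite-dimensional subspace of the quotient space, as the least size of a
  spanning family of classes.\<close>

definition L2dim :: "symsys \<Rightarrow> (real \<Rightarrow> complex vec) set set \<Rightarrow> nat" where
  "L2dim S K = (LEAST n. \<exists>ys :: nat \<Rightarrow> real \<Rightarrow> complex vec. (\<forall>k < n. ys k \<in> L2fun S) \<and>
     K = {L2class S (\<lambda>t. vec (dimHH S) (\<lambda>i. \<Sum>k<n. c k * ys k t $ i)) | c :: nat \<Rightarrow> complex. True})"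

text \<open>The deficiency indices of the minimal relation. The dimension of the kernel is constant on
  each open half-plane, and \<open>\<plusminus>\<i>\<close> are taken as representatives.\<close>

definition n_plus :: "symsys \<Rightarrow> nat" where
  "n_plus S = L2dim S (Tmax_ker S \<i>)"

definition n_minus :: "symsys \<Rightarrow> nat" where
  "n_minus S = L2dim S (Tmax_ker S (- \<i>))"

definition bracket_b :: "symsys \<Rightarrow> (real \<Rightarrow> complex vec) \<Rightarrow> (real \<Rightarrow> complex vec) \<Rightarrow> complex" where
  "bracket_b S y z = Lim (if rend S = \<infinity> then at_top else at_left (real_of_ereal (rend S)))
                         (\<lambda>t. (Jmat S *\<^sub>v y t) \<bullet>c z t)"

text \<open>\<open>U\<close> has the rows \<open>(u\<^sub>1 u\<^sub>2 u\<^sub>3)\<close>, \<open>(u\<^sub>4 u\<^sub>5 u\<^sub>6)\<close>, and \<open>Ut\<close> has the additional first row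
  \<open>(u\<^sub>7 u\<^sub>8 u\<^sub>9)\<close>.\<close>

definition boundary_op_a :: "symsys \<Rightarrow> complex mat \<Rightarrow> complex mat \<Rightarrow> bool" where
  "boundary_op_a S U Ut \<longleftrightarrow>
    (let p = dimH S; q = dimHh S; N = dimHH S;
         u1 = blk U 0 q 0 p; u2 = blk U 0 q p q; u3 = blk U 0 q (p + q) p;
         u4 = blk U q p 0 p; u5 = blk U q p p q; u6 = blk U q p (p + q) p
     in U \<in> carrier_mat (q + p) N \<and>
        (\<forall>x \<in> carrier_vec (q + p). \<exists>h \<in> carrier_vec N. U *\<^sub>v h = x) \<and>
        \<i> \<cdot>\<^sub>m (u2 * mat_adjoint u2) - u1 * mat_adjoint u3 + u3 * mat_adjoint u1 = \<i> \<cdot>\<^sub>m 1\<^sub>m q \<and>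
        \<i> \<cdot>\<^sub>m (u5 * mat_adjoint u2) - u4 * mat_adjoint u3 + u6 * mat_adjoint u1 = 0\<^sub>m p q \<and>
        \<i> \<cdot>\<^sub>m (u5 * mat_adjoint u5) + u6 * mat_adjoint u4 - u4 * mat_adjoint u6 = 0\<^sub>m p p \<and>
        Ut \<in> carrier_mat N N \<and> blk Ut p (q + p) 0 N = U \<and>
        mat_adjoint Ut * Jmat S * Ut = Jmat S)"

definition G0a :: "symsys \<Rightarrow> complex mat \<Rightarrow> (real \<Rightarrow> complex vec) \<Rightarrow> complex vec" where
  "G0a S Ut y = vec_first (Ut *\<^sub>v y (lend S)) (dimH S)"

definition Gha :: "symsys \<Rightarrow> complex mat \<Rightarrow> (real \<Rightarrow> complex vec) \<Rightarrow> complex vec" where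
  "Gha S Ut y = vec_last (vec_first (Ut *\<^sub>v y (lend S)) (dim0 S)) (dimHh S)"

definition G1a :: "symsys \<Rightarrow> complex mat \<Rightarrow> (real \<Rightarrow> complex vec) \<Rightarrow> complex vec" where
  "G1a S Ut y = vec_last (Ut *\<^sub>v y (lend S)) (dimH S)"

text \<open>
  At \<open>b\<close> the larger boundary space has dimension \<open>r + s\<close>; its subspace \<open>\<H>\<^sub>b\<close> consists of the first
  \<open>r\<close> coordinates and the orthogonal complement of \<open>\<H>\<^sub>b\<close> of the last \<open>s\<close>. Thus
  \<open>vec_first x r\<close> and \<open>vec_last x s\<close> are the two orthogonal projections of \<open>x\<close>; an inner product
  of \<open>x\<close> with an element of \<open>\<H>\<^sub>b\<close> involves \<open>vec_first x r\<close> only.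
\<close>

definition boundary_map_b :: "symsys \<Rightarrow> nat \<Rightarrow> nat \<Rightarrow> ((real \<Rightarrow> complex vec) \<Rightarrow> complex vec) \<Rightarrow>
    ((real \<Rightarrow> complex vec) \<Rightarrow> complex vec) \<Rightarrow> ((real \<Rightarrow> complex vec) \<Rightarrow> complex vec) \<Rightarrow> bool" where
  "boundary_map_b S r s G0b Ghb G1b \<longleftrightarrow>
    (let D = Domain (Tmax_fun S) in
       (\<forall>y \<in> D. G0b y \<in> carrier_vec (r + s) \<and> Ghb y \<in> carrier_vec (dimHh S) \<and>
                  G1b y \<in> carrier_vec r) \<and>
       (\<forall>G \<in> {G0b, Ghb, G1b}. (\<forall>y \<in> D. \<forall>z \<in> D. G (\<lambda>t. y t + z t) = G y + G z) \<and>
                                (\<forall>y \<in> D. \<forall>c. G (\<lambda>t. c \<cdot>\<^sub>v y t) = c \<cdot>\<^sub>v G y)) \<and>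
       (\<forall>x0 \<in> carrier_vec (r + s). \<forall>xh \<in> carrier_vec (dimHh S). \<forall>x1 \<in> carrier_vec r.
          \<exists>y \<in> D. G0b y = x0 \<and> Ghb y = xh \<and> G1b y = x1) \<and>
       (\<forall>y \<in> D. \<forall>z \<in> D. bracket_b S y z =
          vec_first (G0b y) r \<bullet>c G1b z - G1b y \<bullet>c vec_first (G0b z) r +
          \<i> * (vec_last (G0b y) s \<bullet>c vec_last (G0b z) s) + \<i> * (Ghb y \<bullet>c Ghb z)))"

text \<open>A boundary parameter is given by representing pairs of operator functions. Equivalent pairs
  (which differ by an invertible left factor) impose the same boundary condition on solutions.\<close>

definition boundary_parameter :: "nat \<Rightarrow> nat \<Rightarrow> (complex \<Rightarrow> complex mat) \<Rightarrow> (complex \<Rightarrow> complex mat) \<Rightarrow>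
    (complex \<Rightarrow> complex mat) \<Rightarrow> (complex \<Rightarrow> complex mat) \<Rightarrow> bool" where
  "boundary_parameter r s C0 C1 D0 D1 \<longleftrightarrow>
    (let C01 = (\<lambda>z. blk (C0 z) 0 (r + s) 0 r); C02 = (\<lambda>z. blk (C0 z) 0 (r + s) r s);
         D01 = (\<lambda>z. blk (D0 z) 0 r 0 r); D02 = (\<lambda>z. blk (D0 z) 0 r r s);
         PHb = mat_of_op r (r + s) (\<lambda>x. vec_first x r)
     in holomorphic_op (r + s) (r + s) C0 {z. Im z > 0} \<and>
        holomorphic_op (r + s) r C1 {z. Im z > 0} \<and>
        holomorphic_op r (r + s) D0 {z. Im z < 0} \<and>
        holomorphic_op r r D1 {z. Im z < 0} \<and>
        (\<forall>z. Im z > 0 \<longrightarrow>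
           op_nonneg (r + s) (2 \<cdot>\<^sub>m Im_op (C1 z * mat_adjoint (C01 z)) + C02 z * mat_adjoint (C02 z))) \<and>
        (\<forall>z. Im z < 0 \<longrightarrow>
           op_nonneg r (- (2 \<cdot>\<^sub>m Im_op (D1 z * mat_adjoint (D01 z)) + D02 z * mat_adjoint (D02 z)))) \<and>
        (\<forall>z. Im z > 0 \<longrightarrow>
           C1 z * mat_adjoint (D01 (cnj z)) - C01 z * mat_adjoint (D1 (cnj z)) +
           \<i> \<cdot>\<^sub>m (C02 z * mat_adjoint (D02 (cnj z))) = 0\<^sub>m (r + s) r) \<and>
        (\<forall>z. Im z > 0 \<longrightarrow> invertible_mat (C0 z - \<i> \<cdot>\<^sub>m (C1 z * PHb))) \<and>
        (\<forall>z. Im z < 0 \<longrightarrow> invertible_mat (D01 z + \<i> \<cdot>\<^sub>m D1 z)))"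

definition L2op :: "symsys \<Rightarrow> nat \<Rightarrow> (real \<Rightarrow> complex mat) \<Rightarrow> bool" where
  "L2op S k F \<longleftrightarrow> (\<forall>t. F t \<in> carrier_mat (dimHH S) k) \<and> borel_mat_on (dimHH S) k (ival S) F \<and>
     (\<forall>h \<in> carrier_vec k. (\<lambda>t. F t *\<^sub>v h) \<in> L2fun S)"

definition operator_solution :: "symsys \<Rightarrow> nat \<Rightarrow> complex \<Rightarrow> (real \<Rightarrow> complex mat) \<Rightarrow> bool" where
  "operator_solution S k \<zeta> Y \<longleftrightarrow> (\<forall>h \<in> carrier_vec k. solution S \<zeta> (\<lambda>t. Y t *\<^sub>v h))"

text \<open>The defining property of \<open>V = v\<^sub>\<tau>(\<cdot>,\<zeta>)\<close>. For \<open>h\<close> in the space \<open>H\<^sub>0\<close>, \<open>vec_first h (dimH S)\<close> and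
  \<open>vec_last h (dimHh S)\<close> are the components of \<open>h\<close>. These conditions determine \<open>V\<close> on \<open>ival S\<close>.\<close>

definition is_v_tau :: "symsys \<Rightarrow> complex mat \<Rightarrow> nat \<Rightarrow> nat \<Rightarrow> ((real \<Rightarrow> complex vec) \<Rightarrow> complex vec) \<Rightarrow>
    ((real \<Rightarrow> complex vec) \<Rightarrow> complex vec) \<Rightarrow> ((real \<Rightarrow> complex vec) \<Rightarrow> complex vec) \<Rightarrow>
    (complex \<Rightarrow> complex mat) \<Rightarrow> (complex \<Rightarrow> complex mat) \<Rightarrow>
    (complex \<Rightarrow> complex mat) \<Rightarrow> (complex \<Rightarrow> complex mat) \<Rightarrow>
    complex \<Rightarrow> (real \<Rightarrow> complex mat) \<Rightarrow> bool" where
  "is_v_tau S Ut r s G0b Ghb G1b C0 C1 D0 D1 \<zeta> V \<longleftrightarrow>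
     L2op S (dim0 S) V \<and> operator_solution S (dim0 S) \<zeta> V \<and>
     (\<forall>h \<in> carrier_vec (dim0 S).
        let y = (\<lambda>t. V t *\<^sub>v h) in
          G1a S Ut y = - vec_first h (dimH S) \<and>
          \<i> \<cdot>\<^sub>v (Gha S Ut y - Ghb y) = vec_last h (dimHh S) \<and>
          (Im \<zeta> > 0 \<longrightarrow> C0 \<zeta> *\<^sub>v G0b y + C1 \<zeta> *\<^sub>v G1b y = 0\<^sub>v (r + s)) \<and>
          (Im \<zeta> < 0 \<longrightarrow> D0 \<zeta> *\<^sub>v G0b y + D1 \<zeta> *\<^sub>v G1b y = 0\<^sub>v r))"

definition m_function :: "symsys \<Rightarrow> complex mat \<Rightarrow> (complex \<Rightarrow> real \<Rightarrow> complex mat) \<Rightarrow>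
    complex \<Rightarrow> complex mat" where
  "m_function S Ut v \<zeta> =
     mat_of_op (dim0 S) (dim0 S)
       (\<lambda>h. G0a S Ut (\<lambda>t. v \<zeta> t *\<^sub>v h) @\<^sub>v Gha S Ut (\<lambda>t. v \<zeta> t *\<^sub>v h)) +
     (\<i> / 2) \<cdot>\<^sub>m mat_of_op (dim0 S) (dim0 S) (\<lambda>h. 0\<^sub>v (dimH S) @\<^sub>v vec_last h (dimHh S))"

definition op_integral :: "nat \<Rightarrow> real set \<Rightarrow> (real \<Rightarrow> complex mat) \<Rightarrow> complex mat" where
  "op_integral n I F = mat n n (\<lambda>(i, j). LINT t : I | lborel. F t $$ (i, j))"

definition weyl_integral :: "symsys \<Rightarrow> (real \<Rightarrow> complex mat) \<Rightarrow> complex mat" where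
  "weyl_integral S V = op_integral (dim0 S) (ival S) (\<lambda>t. mat_adjoint (V t) * weight S t * V t)"

end

theory Submission
  imports Defs
begin

text \<open>
  Everything rests on Green's identity: for \<open>{y, f}\<close>, \<open>{z, g}\<close> in the maximal relation,
  \<open>[y, z]\<^sub>b - (J y(a), z(a)) = (f, z)\<^sub>\<Delta> - (y, g)\<^sub>\<Delta>\<close> (\<open>Green_identity\<close>), an instance of the fundamental
  theorem of calculus for absolutely continuous functions. For two solutions \<open>v(\<zeta>) h\<close> and
  \<open>v(\<omega>) k\<close>, the boundary conditions at \<open>a\<close> turn it into

  \<open>(\<zeta> - cnj \<omega>) (v(\<zeta>) h, v(\<omega>) k)\<^sub>\<Delta> = \<beta>(\<Gamma>\<^sub>b v(\<zeta>) h, \<Gamma>\<^sub>b v(\<omega>) k) + (m(\<zeta>) h, k) - (h, m(\<omega>) k)\<close>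

  (\<open>sol_identity\<close>), where \<open>\<beta>\<close> (\<open>bform\<close>) is the part of the boundary form at \<open>b\<close> that involves
  \<open>\<Gamma>\<^sub>0\<^sub>b\<close> and \<open>\<Gamma>\<^sub>1\<^sub>b\<close>. Each assertion is this identity for a particular choice of \<open>\<omega>\<close>.

  For \<open>\<omega> = \<zeta>\<close> and \<open>k = h\<close> its imaginary part expresses \<open>Im (m(\<zeta>) h, h)\<close> by the norm of \<open>v(\<zeta>) h\<close> and
  by \<open>\<beta>\<close> on the boundary condition \<open>C\<^sub>0 x\<^sub>0 + C\<^sub>1 x\<^sub>1 = 0\<close> or \<open>D\<^sub>0 x\<^sub>0 + D\<^sub>1 x\<^sub>1 = 0\<close>. There \<open>Im \<beta>\<close> is
  nonpositive in the upper and nonnegative in the lower half-plane (\<open>bform_upper_bound\<close>,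
  \<open>bform_lower_nonneg\<close>), which is the Weyl inequality (\<open>Weyl_inequality\<close>).

  For \<open>\<omega> = cnj \<zeta>\<close> the left-hand side vanishes, and so does \<open>\<beta>\<close>: the relation that couples \<open>C\<close> with
  \<open>D\<close> says that the two boundary conditions are adjoint to each other with respect to \<open>\<beta>\<close>
  (\<open>bform_compat\<close>). Hence \<open>m(\<zeta>)\<^sup>* = m(cnj \<zeta>)\<close> (\<open>M_adjoint\<close>).

  For \<open>\<omega> = cnj w\<close> with \<open>w\<close> near \<open>\<zeta>\<close>, the identity is a formula for \<open>m(\<zeta>) - m(w)\<close> in which the
  factors \<open>\<zeta> - w\<close> and \<open>C(\<zeta>) - C(w)\<close> are explicit (\<open>M_difference_identity\<close>). Dividing by \<open>\<zeta> - w\<close>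
  gives the derivative, once \<open>v(\<zeta>) h\<close> and its boundary values are known to be continuous at \<open>w\<close>.
  That continuity is again a consequence of Green's identity, applied to the difference
  \<open>v(\<zeta>) h - v(w) h\<close>: paired with itself, the difference satisfies an energy estimate; paired with
  fixed elements of the domain, it controls its own boundary values; and the formula for
  \<open>m(\<zeta>) - m(w)\<close> bounds its values at \<open>a\<close>. The three estimates bound each other and close for \<open>\<zeta>\<close>
  near \<open>w\<close> (\<open>coupled_smallness\<close>). This gives holomorphy in the upper half-plane, and the
  symmetry of \<open>m\<close> transfers it to the lower one.
\<close>

section \<open>Absolutely continuous functions\<close>

lemma disjoint_intervals_length_le:
  fixes P :: "(real \<times> real) set"
  assumes "finite P" and le: "\<And>c d. (c, d) \<in> P \<Longrightarrow> c \<le> d"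
    and disj: "pairwise (\<lambda>(c, d) (c', d'). {c<..<d} \<inter> {c'<..<d'} = {}) P"
    and sub: "\<And>c d. (c, d) \<in> P \<Longrightarrow> {c<..<d} \<subseteq> O'" and "O' \<in> sets lborel"
  shows "ennreal (\<Sum>(c, d) \<in> P. d - c) \<le> emeasure lborel O'"
proof -
  let ?F = "\<lambda>(c, d). {c<..<d :: real}"
  have "ennreal (\<Sum>(c, d) \<in> P. d - c) = (\<Sum>x \<in> P. ennreal (snd x - fst x))"
    using le by (subst sum_ennreal) (auto simp: case_prod_beta)
  also have "\<dots> = (\<Sum>x \<in> P. emeasure lborel (?F x))"
    using le by (intro sum.cong) (auto simp: case_prod_beta)
  also have "\<dots> = emeasure lborel (\<Union>x \<in> P. ?F x)"
    using disj by (intro sum_emeasure)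
      (auto simp: disjoint_family_on_def pairwise_def case_prod_beta \<open>finite P\<close>)
  also have "\<dots> \<le> emeasure lborel O'"
    using sub assms(5) by (intro emeasure_mono) auto
  finally show ?thesis .
qed

definition short_family :: "real \<Rightarrow> real \<Rightarrow> real \<Rightarrow> (real \<times> real) set \<Rightarrow> bool" where
  "short_family \<alpha> \<beta> \<delta> P \<longleftrightarrow> finite P \<and> (\<forall>(c, d) \<in> P. \<alpha> \<le> c \<and> c \<le> d \<and> d \<le> \<beta>) \<and>
     pairwise (\<lambda>(c, d) (c', d'). {c<..<d} \<inter> {c'<..<d'} = {}) P \<and> (\<Sum>(c, d) \<in> P. d - c) < \<delta>"

lemma ac_on_iff:
  "ac_on f \<alpha> \<beta> \<longleftrightarrow> (\<forall>\<epsilon> > 0. \<exists>\<delta> > 0. \<forall>P. short_family \<alpha> \<beta> \<delta> P \<longrightarrow>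
     (\<Sum>(c, d) \<in> P. norm (f d - f c)) < \<epsilon>)"
  by (simp add: ac_on_def short_family_def)

lemma ac_onE:
  assumes "ac_on f \<alpha> \<beta>" "0 < \<epsilon>"
  obtains \<delta> where "0 < \<delta>" "\<And>P. short_family \<alpha> \<beta> \<delta> P \<Longrightarrow> (\<Sum>(c, d) \<in> P. norm (f d - f c)) < \<epsilon>"
  using assms unfolding ac_on_iff by blast

text \<open>
  The fundamental theorem of calculus for absolutely continuous functions, by a direct choice of gauge.
  At a point where \<open>f' = g\<close> the gauge is that of the straddle lemma. The remaining points form a null
  set; there the gauge forces the intervals of the division into an open set of small measure, and
  absolute continuity bounds the sum of the increments of \<open>f\<close> over them.
\<close>

theorem ac_on_has_integral:
  fixes f g :: "real \<Rightarrow> complex"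
  assumes ac: "ac_on f a b" and "a \<le> b"
    and deriv: "AE t in lborel. t \<in> {a..b} \<longrightarrow> (f has_vector_derivative g t) (at t)"
  shows "(g has_integral (f b - f a)) {a..b}"
proof -
  obtain N where N: "N \<in> null_sets lborel"
    and dN: "\<And>t. t \<in> {a..b} \<Longrightarrow> t \<notin> N \<Longrightarrow> (f has_vector_derivative g t) (at t)"
    by (rule AE_E3[OF deriv]) auto
  (* On the null set the integrand may be changed; with the value 0 a tag in N contributes
     only an increment of f. *)
  define g0 where "g0 t = (if t \<in> N then 0 else g t)" for t
  have "(g0 has_integral (f b - f a)) {a..b}"
    unfolding has_integral_real
  proof (intro allI impI)
    fix e :: real assume "e > 0"
    define e' where "e' = e / (2 * (b - a + 1))"
    have "e' > 0" using \<open>e > 0\<close> \<open>a \<le> b\<close> by (simp add: e'_def)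
    obtain \<delta> where "\<delta> > 0" and \<delta>: "\<And>P. short_family a b \<delta> P \<Longrightarrow> (\<Sum>(c, d) \<in> P. norm (f d - f c)) < e / 2"
      using ac_onE[OF ac half_gt_zero[OF \<open>e > 0\<close>]] by blast
    obtain T where T: "open T" "N \<subseteq> T" "emeasure lborel T < ennreal \<delta>"
    proof -
      have Nl: "N \<in> null_sets lebesgue" using N by (simp add: null_sets_completionI)
      then obtain T where T: "open T" "N \<subseteq> T" "emeasure lebesgue (T - N) < ennreal \<delta>"
        using sets_lebesgue_outer_open[OF null_setsD2[OF Nl] \<open>\<delta> > 0\<close>] by metis
      have "emeasure lebesgue (T - N) = emeasure lebesgue T"
        using T(1) Nl by (intro emeasure_Diff_null_set) auto
      then show ?thesis using that[of T] T by simp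
    qed
    have "\<exists>d>0. x \<in> {a..b} - N \<longrightarrow> (\<forall>y\<in>{a..b}. norm (y - x) < d \<longrightarrow>
        norm (f y - f x - (y - x) *\<^sub>R g x) \<le> e' * norm (y - x))" for x
    proof (cases "x \<in> {a..b} - N")
      case True
      then have "(f has_vector_derivative g x) (at x within {a..b})"
        using dN by (auto intro: has_vector_derivative_at_within)
      then show ?thesis
        using \<open>e' > 0\<close> unfolding has_vector_derivative_def has_derivative_within_alt by blast
    next
      case False
      then show ?thesis by (auto intro: exI[of _ 1])
    qed
    then obtain d where d: "\<And>x. 0 < d x" "\<And>x y. x \<in> {a..b} - N \<Longrightarrow> y \<in> {a..b} \<Longrightarrow>
        norm (y - x) < d x \<Longrightarrow> norm (f y - f x - (y - x) *\<^sub>R g x) \<le> e' * norm (y - x)"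
      by metis
    have "\<exists>r>0. x \<in> N \<longrightarrow> ball x r \<subseteq> T" for x
    proof (cases "x \<in> N")
      case True
      then have "x \<in> T" using T(2) by auto
      then show ?thesis using T(1) open_contains_ball by blast
    qed (auto intro: exI[of _ 1])
    then obtain r where r: "\<And>x. 0 < r x" "\<And>x. x \<in> N \<Longrightarrow> ball x (r x) \<subseteq> T" by metis
    (* Tags in N keep their interval inside the open set T of measure less than delta. *)
    define \<gamma> where "\<gamma> x = ball x (if x \<in> N then r x else d x)" for x
    show "\<exists>\<gamma>. gauge \<gamma> \<and> (\<forall>p. p tagged_division_of {a..b} \<and> \<gamma> fine p \<longrightarrow>
        norm ((\<Sum>(x, k)\<in>p. measure lborel k *\<^sub>R g0 x) - (f b - f a)) < e)"
    proof (rule exI[of _ \<gamma>], intro conjI allI impI)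
      show "gauge \<gamma>" unfolding \<gamma>_def using d(1) r(1) by (intro gauge_ball_dependent) auto
    next
      fix p assume "p tagged_division_of {a..b} \<and> \<gamma> fine p"
      then have p: "p tagged_division_of {a..b}" and fine: "\<gamma> fine p" by auto
      note pD = tagged_division_ofD[OF p]
      have box: "Inf K \<le> Sup K \<and> K = {Inf K..Sup K} \<and> Inf K \<le> x \<and> x \<le> Sup K \<and>
          a \<le> Inf K \<and> Sup K \<le> b" if xK: "(x, K) \<in> p" for x K
      proof -
        obtain u v where K: "K = {u..v}" using pD(4)[OF xK] by auto
        with pD(2,3)[OF xK] show ?thesis by auto
      qed
      define D where "D = (\<lambda>(x :: real, K). measure lborel K *\<^sub>R g0 x - (f (Sup K) - f (Inf K)))"
      have sum_D: "(\<Sum>(x, k)\<in>p. measure lborel k *\<^sub>R g0 x) - (f b - f a) = sum D p"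
        using additive_tagged_division_1[OF \<open>a \<le> b\<close> p, of f]
        by (simp add: D_def sum_subtractf case_prod_beta)
      (* Degenerate intervals contribute nothing. Without them an interval determines its tag. *)
      define q where "q = {xk \<in> p. fst xk \<in> N \<and> Inf (snd xk) < Sup (snd xk)}"
      have qp: "q \<subseteq> p" "finite q" using pD(1) by (auto simp: q_def)
      have bound_q: "norm (sum D q) \<le> e / 2"
      proof -
        define \<pi> where "\<pi> = (\<lambda>(x :: real, K). (Inf K :: real, Sup K :: real))"
        have disj: "{Inf K<..<Sup K} \<inter> {Inf K'<..<Sup K'} = {}"
          if "(x, K) \<in> p" "(x', K') \<in> p" "(x, K) \<noteq> (x', K')" for x K x' K'
          using pD(5)[OF that] box[OF that(1)] box[OF that(2)]
          by (metis interior_atLeastAtMost_real)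
        have inj: "inj_on \<pi> q"
        proof (rule inj_onI, clarsimp simp: \<pi>_def)
          fix x K x' K' assume *: "(x, K) \<in> q" "(x', K') \<in> q" "Inf K = Inf K'" "Sup K = Sup K'"
          then have "{Inf K<..<Sup K} \<noteq> {}" by (auto simp: q_def)
          then show "x = x' \<and> K = K'"
            using disj[of x K x' K'] * qp by auto
        qed
        have pw: "pairwise (\<lambda>(c, d) (c', d'). {c<..<d} \<inter> {c'<..<d'} = {}) (\<pi> ` q)"
          using disj qp unfolding pairwise_def \<pi>_def by fastforce
        have "ennreal (\<Sum>(c, d) \<in> \<pi> ` q. d - c) \<le> emeasure lborel T"
        proof (rule disjoint_intervals_length_le[OF _ _ pw])
          fix c d assume "(c, d) \<in> \<pi> ` q"
          then obtain x K where xK: "(x, K) \<in> q" "c = Inf K" "d = Sup K" by (auto simp: \<pi>_def)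
          then have "(x, K) \<in> p" "x \<in> N" by (auto simp: q_def)
          then have "K \<subseteq> ball x (r x)" using fine by (fastforce simp: \<gamma>_def fine_def)
          moreover have "{c<..<d} \<subseteq> K"  using box[of x K] xK qp by (metis subsetD greaterThanLessThan_subseteq_atLeastAtMost_iff order_refl)
          ultimately show "{c<..<d} \<subseteq> T" using r(2) \<open>x \<in> N\<close> by blast
        qed (use qp T(1) in \<open>auto simp: \<pi>_def q_def\<close>)
        then have "ennreal (\<Sum>(c, d) \<in> \<pi> ` q. d - c) < ennreal \<delta>" using T(3) by simp
        then have "(\<Sum>(c, d) \<in> \<pi> ` q. d - c) < \<delta>"
          using \<open>\<delta> > 0\<close> ennreal_less_iff linorder_not_less ennreal_leI by metis
        moreover have "\<forall>(c, d) \<in> \<pi> ` q. a \<le> c \<and> c \<le> d \<and> d \<le> b"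
          using box qp by (fastforce simp: \<pi>_def)
        ultimately have "(\<Sum>(c, d) \<in> \<pi> ` q. norm (f d - f c)) < e / 2"
          using \<delta>[of "\<pi> ` q"] pw qp by (simp add: short_family_def)
        also have "(\<Sum>(c, d) \<in> \<pi> ` q. norm (f d - f c)) = (\<Sum>xk \<in> q. norm (D xk))"
          by (subst sum.reindex[OF inj], rule sum.cong)
            (auto simp: \<pi>_def D_def g0_def q_def norm_minus_commute)
        finally show ?thesis using norm_sum[of D q] by linarith
      qed
      have "norm (sum D (p - q)) \<le> (\<Sum>xk\<in>p - q. e' * (Sup (snd xk) - Inf (snd xk)))"
      proof (rule sum_norm_le, clarify)
        fix x K assume xK: "(x, K) \<in> p" "(x, K) \<notin> q"
        note b = box[OF xK(1)]
        show "norm (D (x, K)) \<le> e' * (Sup (snd (x, K)) - Inf (snd (x, K)))"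
        proof (cases "x \<in> N")
          case True
          then have "Inf K = Sup K" using xK b by (auto simp: q_def)
          then show ?thesis using b True by (simp add: D_def g0_def)
        next
          case False
          then have xN: "x \<in> {a..b} - N" using b by auto
          let ?u = "Inf K" and ?v = "Sup K"
          have "K \<subseteq> ball x (d x)" using fine xK False by (fastforce simp: \<gamma>_def fine_def)
          moreover have "?u \<in> K" "?v \<in> K" using b by (metis atLeastAtMost_iff order_refl)+
          ultimately have n: "norm (?u - x) < d x" "norm (?v - x) < d x"
            by (auto simp: dist_norm norm_minus_commute)
          have "measure lborel K = ?v - ?u" using b by (metis content_real)
          then have "D (x, K) = (f ?u - f x - (?u - x) *\<^sub>R g x) - (f ?v - f x - (?v - x) *\<^sub>R g x)"
            using False by (simp add: D_def g0_def scaleR_left_diff_distrib)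
          then have "norm (D (x, K)) \<le> norm (f ?u - f x - (?u - x) *\<^sub>R g x) +
              norm (f ?v - f x - (?v - x) *\<^sub>R g x)"
            by (metis norm_triangle_ineq4)
          also have "\<dots> \<le> e' * norm (?u - x) + e' * norm (?v - x)"
            using d(2)[OF xN _ n(1)] d(2)[OF xN _ n(2)] b by (intro add_mono) auto
          also have "\<dots> = e' * (?v - ?u)"
            using b by (simp add: algebra_simps)
          finally show ?thesis by simp
        qed
      qed
      also have "\<dots> \<le> (\<Sum>xk\<in>p. e' * (Sup (snd xk) - Inf (snd xk)))"
        proof (intro sum_mono2)
        fix xk assume "xk \<in> p - (p - q)"
        then have "(fst xk, snd xk) \<in> p" by auto
        from box[OF this] show "0 \<le> e' * (Sup (snd xk) - Inf (snd xk))"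
          using \<open>e' > 0\<close> by simp
      qed (use pD(1) in auto)
      also have "\<dots> = e' * (b - a)"
        using additive_tagged_division_1[OF \<open>a \<le> b\<close> p, of "\<lambda>x. x"]
        by (simp add: sum_distrib_left[symmetric] case_prod_beta)
      also have "\<dots> < e / 2"
      proof -
        have "e' * (b - a) < e' * (b - a + 1)" using \<open>e' > 0\<close> by (intro mult_strict_left_mono) auto
        also have "\<dots> = e / 2" using \<open>a \<le> b\<close> by (simp add: e'_def field_simps)
          finally show ?thesis .
      qed
      finally have "norm (sum D q + sum D (p - q)) < e"
        using bound_q norm_triangle_ineq[of "sum D q" "sum D (p - q)"] by linarith
      moreover have "sum D p = sum D q + sum D (p - q)"
        using sum.subset_diff[OF qp(1) pD(1), of D] by (simp add: add.commute)
      ultimately show "norm ((\<Sum>(x, k)\<in>p. measure lborel k *\<^sub>R g0 x) - (f b - f a)) < e"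
        using sum_D by simp
    qed
  qed
  moreover have "negligible N"
    using N negligible_iff_null_sets null_sets_completionI by blast
  ultimately show ?thesis
    by (rule has_integral_spike[rotated -1]) (auto simp: g0_def)
qed

text \<open>
  Closure under the algebraic operations needs only that the increments of the result are
  controlled by the increments of the arguments.
\<close>

lemma ac_on_dominated:
  fixes f g h :: "real \<Rightarrow> complex"
  assumes f: "ac_on f \<alpha> \<beta>" and g: "ac_on g \<alpha> \<beta>"
    and le: "\<And>c d. \<alpha> \<le> c \<Longrightarrow> c \<le> d \<Longrightarrow> d \<le> \<beta> \<Longrightarrow>
      norm (h d - h c) \<le> K * (norm (f d - f c) + norm (g d - g c))"
  shows "ac_on h \<alpha> \<beta>"
  unfolding ac_on_iff
proof (intro allI impI)
  fix e :: real assume "e > 0"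
  define e' where "e' = e / (2 * (\<bar>K\<bar> + 1))"
  have "e' > 0" using \<open>e > 0\<close> by (simp add: e'_def)
  obtain \<delta>1 where 1: "\<delta>1 > 0" "\<And>P. short_family \<alpha> \<beta> \<delta>1 P \<Longrightarrow> (\<Sum>(c, d) \<in> P. norm (f d - f c)) < e'"
    using ac_onE[OF f \<open>e' > 0\<close>] by blast
  obtain \<delta>2 where 2: "\<delta>2 > 0" "\<And>P. short_family \<alpha> \<beta> \<delta>2 P \<Longrightarrow> (\<Sum>(c, d) \<in> P. norm (g d - g c)) < e'"
    using ac_onE[OF g \<open>e' > 0\<close>] by blast
  show "\<exists>\<delta> > 0. \<forall>P. short_family \<alpha> \<beta> \<delta> P \<longrightarrow> (\<Sum>(c, d) \<in> P. norm (h d - h c)) < e"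
  proof (rule exI[of _ "min \<delta>1 \<delta>2"], intro conjI allI impI)
    show "min \<delta>1 \<delta>2 > 0" using 1 2 by simp
    fix P assume "short_family \<alpha> \<beta> (min \<delta>1 \<delta>2) P"
    then have P: "short_family \<alpha> \<beta> \<delta>1 P" "short_family \<alpha> \<beta> \<delta>2 P" by (auto simp: short_family_def)
    have "(\<Sum>(c, d) \<in> P. norm (f d - f c)) < e'" by (rule 1(2)[OF P(1)])
    moreover have "(\<Sum>(c, d) \<in> P. norm (g d - g c)) < e'" by (rule 2(2)[OF P(2)])
    ultimately have s: "(\<Sum>(c, d) \<in> P. norm (f d - f c)) + (\<Sum>(c, d) \<in> P. norm (g d - g c)) < 2 * e'"
      by simp
    have s0: "0 \<le> (\<Sum>(c, d) \<in> P. norm (f d - f c)) + (\<Sum>(c, d) \<in> P. norm (g d - g c))"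
      by (intro add_nonneg_nonneg sum_nonneg) auto
    have "(\<Sum>(c, d) \<in> P. norm (h d - h c)) \<le>
        (\<Sum>(c, d) \<in> P. K * (norm (f d - f c) + norm (g d - g c)))"
      using P(1) le unfolding short_family_def by (intro sum_mono) fastforce
    also have "\<dots> = K * ((\<Sum>(c, d) \<in> P. norm (f d - f c)) + (\<Sum>(c, d) \<in> P. norm (g d - g c)))"
      by (simp add: sum_distrib_left sum.distrib case_prod_beta algebra_simps)
    also have "\<dots> \<le> (\<bar>K\<bar> + 1) * ((\<Sum>(c, d) \<in> P. norm (f d - f c)) + (\<Sum>(c, d) \<in> P. norm (g d - g c)))"
      by (rule mult_right_mono[OF _ s0]) simp
    also have "\<dots> < (\<bar>K\<bar> + 1) * (2 * e')"
      using s by (intro mult_strict_left_mono) auto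
    also have "\<dots> = e" unfolding e'_def
    proof -
      have "\<bar>K\<bar> + 1 \<noteq> 0" by linarith
      then show "(\<bar>K\<bar> + 1) * (2 * (e / (2 * (\<bar>K\<bar> + 1)))) = e" by (simp add: field_simps)
    qed
    finally show "(\<Sum>(c, d) \<in> P. norm (h d - h c)) < e" .
  qed
qed

lemma ac_on_continuous:
  assumes "ac_on f \<alpha> \<beta>"
  shows "continuous_on {\<alpha>..\<beta>} f"
  unfolding continuous_on_iff
proof (intro ballI allI impI)
  fix x e :: real assume x: "x \<in> {\<alpha>..\<beta>}" and "e > 0"
  obtain \<delta> where \<delta>: "\<delta> > 0" "\<And>P. short_family \<alpha> \<beta> \<delta> P \<Longrightarrow> (\<Sum>(c, d) \<in> P. norm (f d - f c)) < e"
    using ac_onE[OF assms \<open>e > 0\<close>] by blast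
  have small: "norm (f d - f c) < e" if "\<alpha> \<le> c" "c \<le> d" "d \<le> \<beta>" "d - c < \<delta>" for c d
    using \<delta>(2)[of "{(c, d)}"] that by (simp add: short_family_def)
  have "dist (f x') (f x) < e" if "x' \<in> {\<alpha>..\<beta>}" "dist x' x < \<delta>" for x'
    using small[of x x'] small[of x' x] x that
    by (cases "x \<le> x'") (auto simp: dist_norm norm_minus_commute)
  then show "\<exists>d>0. \<forall>x'\<in>{\<alpha>..\<beta>}. dist x' x < d \<longrightarrow> dist (f x') (f x) < e"
    using \<delta>(1) by blast
qed

lemma ac_on_const: "ac_on (\<lambda>_. c) \<alpha> \<beta>"
  unfolding ac_on_def by (auto intro: exI[of _ 1])

lemma ac_on_add:
  assumes "ac_on f \<alpha> \<beta>" "ac_on g \<alpha> \<beta>"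
  shows "ac_on (\<lambda>t. f t + g t) \<alpha> \<beta>"
  by (rule ac_on_dominated[OF assms, of _ 1]) (simp add: add_diff_add norm_triangle_ineq)

lemma ac_on_cnj: "ac_on f \<alpha> \<beta> \<Longrightarrow> ac_on (\<lambda>t. cnj (f t)) \<alpha> \<beta>"
  by (rule ac_on_dominated[of f _ _ f _ 1])
    (simp_all add: complex_cnj_diff[symmetric] del: complex_cnj_diff)

lemma ac_on_mult:
  assumes f: "ac_on f \<alpha> \<beta>" and g: "ac_on g \<alpha> \<beta>"
  shows "ac_on (\<lambda>t. f t * g t) \<alpha> \<beta>"
proof -
  have "bounded (f ` {\<alpha>..\<beta>})" "bounded (g ` {\<alpha>..\<beta>})"
    using ac_on_continuous[OF f] ac_on_continuous[OF g]
    by (auto intro!: compact_imp_bounded compact_continuous_image)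
  then obtain M1 M2 where M: "\<And>t. t \<in> {\<alpha>..\<beta>} \<Longrightarrow> norm (f t) \<le> M1"
      "\<And>t. t \<in> {\<alpha>..\<beta>} \<Longrightarrow> norm (g t) \<le> M2"
    unfolding bounded_iff by (metis imageI)
  show ?thesis
  proof (rule ac_on_dominated[OF f g, of _ "max M1 M2"])
    fix c d assume cd: "\<alpha> \<le> c" "c \<le> d" "d \<le> \<beta>"
    have "f d * g d - f c * g c = (f d - f c) * g d + f c * (g d - g c)" by (simp add: algebra_simps)
    then have "norm (f d * g d - f c * g c) \<le> norm (f d - f c) * norm (g d) + norm (f c) * norm (g d - g c)"
      by (metis norm_triangle_ineq norm_mult)
    also have "\<dots> \<le> norm (f d - f c) * max M1 M2 + max M1 M2 * norm (g d - g c)"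
      using M(1)[of c] M(2)[of d] cd by (intro add_mono mult_left_mono mult_right_mono) auto
    finally show "norm (f d * g d - f c * g c) \<le> max M1 M2 * (norm (f d - f c) + norm (g d - g c))"
      by (simp add: algebra_simps)
  qed
qed

lemma ac_on_sum:
  assumes "finite A" "\<And>i. i \<in> A \<Longrightarrow> ac_on (f i) \<alpha> \<beta>"
  shows "ac_on (\<lambda>t. \<Sum>i\<in>A. f i t) \<alpha> \<beta>"
  using assms by (induction A rule: finite_induct) (auto intro: ac_on_const ac_on_add)

section \<open>Coordinates and adjoints\<close>

lemma cdot_eq_sum:
  fixes x y :: "complex vec"
  assumes "y \<in> carrier_vec n"
  shows "x \<bullet>c y = (\<Sum>i<n. x $ i * cnj (y $ i))"
  using assms by (auto simp: scalar_prod_def atLeast0LessThan intro!: sum.cong)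

lemma mult_mat_vec_index_sum:
  assumes "A \<in> carrier_mat m n" "x \<in> carrier_vec n" "i < m"
  shows "(A *\<^sub>v x) $ i = (\<Sum>j<n. A $$ (i, j) * x $ j)"
  using assms by (auto simp: scalar_prod_def atLeast0LessThan intro!: sum.cong)

lemma cdot_add_left:
  fixes x y z :: "complex vec"
  assumes "x \<in> carrier_vec n" "y \<in> carrier_vec n" "z \<in> carrier_vec n"
  shows "(x + y) \<bullet>c z = x \<bullet>c z + y \<bullet>c z"
  using assms by (simp add: cdot_eq_sum[of _ n] sum.distrib algebra_simps)

lemma cdot_add_right:
  fixes x y z :: "complex vec"
  assumes "x \<in> carrier_vec n" "y \<in> carrier_vec n" "z \<in> carrier_vec n"
  shows "z \<bullet>c (x + y) = z \<bullet>c x + z \<bullet>c y"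
  using assms by (simp add: cdot_eq_sum[of _ n] sum.distrib algebra_simps)

lemma cdot_diff_left:
  fixes x y z :: "complex vec"
  assumes "x \<in> carrier_vec n" "y \<in> carrier_vec n" "z \<in> carrier_vec n"
  shows "(x - y) \<bullet>c z = x \<bullet>c z - y \<bullet>c z"
  using assms by (simp add: cdot_eq_sum[of _ n] sum_subtractf algebra_simps)

lemma cdot_smult_left:
  fixes x y :: "complex vec"
  assumes "x \<in> carrier_vec n" "y \<in> carrier_vec n"
  shows "(c \<cdot>\<^sub>v x) \<bullet>c y = c * (x \<bullet>c y)"
  using assms by (simp add: cdot_eq_sum[of _ n] sum_distrib_left algebra_simps)

lemma cdot_smult_right:
  fixes x y :: "complex vec"
  assumes "x \<in> carrier_vec n" "y \<in> carrier_vec n"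
  shows "x \<bullet>c (c \<cdot>\<^sub>v y) = cnj c * (x \<bullet>c y)"
  using assms by (simp add: cdot_eq_sum[of _ n] sum_distrib_left algebra_simps)

lemma cdot_cnj:
  fixes x y :: "complex vec"
  assumes "x \<in> carrier_vec n" "y \<in> carrier_vec n"
  shows "cnj (x \<bullet>c y) = y \<bullet>c x"
  using assms by (simp add: cdot_eq_sum[of _ n] algebra_simps)

lemma mat_adjoint_index [simp]:
  fixes A :: "complex mat"
  assumes "A \<in> carrier_mat m n" "i < n" "j < m"
  shows "mat_adjoint A $$ (i, j) = cnj (A $$ (j, i))"
  using assms unfolding mat_adjoint_def by (auto simp: mat_of_rows_def)

lemma mat_adjoint_carrier [simp]:
  "A \<in> carrier_mat m n \<Longrightarrow> mat_adjoint A \<in> carrier_mat n m"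
  unfolding mat_adjoint_def by (auto simp: mat_of_rows_def)

lemma index_add_fun:
  assumes "\<And>t. z t \<in> carrier_vec n" "i < n"
  shows "(\<lambda>t. (y t + z t) $ i) = (\<lambda>t. y t $ i + z t $ i)"
  using assms by (intro ext index_add_vec(1)) (metis carrier_vecD)

lemma index_smult_fun:
  assumes "\<And>t. y t \<in> carrier_vec n" "i < n"
  shows "(\<lambda>t. (c \<cdot>\<^sub>v y t) $ i) = (\<lambda>t. c * y t $ i)"
  using assms by (intro ext index_smult_vec(1)) (metis carrier_vecD)

lemma dim_mat_adjoint [simp]:
  fixes A :: "complex mat"
  shows "dim_row (mat_adjoint A) = dim_col A" "dim_col (mat_adjoint A) = dim_row A"
  by (simp_all add: mat_adjoint_def)

lemma smult_mat_vec:
  fixes A :: "complex mat"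
  assumes A: "A \<in> carrier_mat m n" and x: "x \<in> carrier_vec n"
  shows "(c \<cdot>\<^sub>m A) *\<^sub>v x = c \<cdot>\<^sub>v (A *\<^sub>v x)"
proof (rule eq_vecI)
  fix i assume "i < dim_vec (c \<cdot>\<^sub>v (A *\<^sub>v x))"
  then have i: "i < m" using A by simp
  have cA: "c \<cdot>\<^sub>m A \<in> carrier_mat m n" using A by simp
  show "((c \<cdot>\<^sub>m A) *\<^sub>v x) $ i = (c \<cdot>\<^sub>v (A *\<^sub>v x)) $ i"
    using i A by (subst mult_mat_vec_index_sum[OF cA x i], subst index_smult_vec)
      (auto simp: mult_mat_vec_index_sum[OF A x i] sum_distrib_left mult.assoc simp del: index_mult_mat_vec intro!: sum.cong)
qed (use A in simp)

lemma cdot_adjoint: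
  fixes A :: "complex mat"
  assumes A: "A \<in> carrier_mat m n" and x: "x \<in> carrier_vec n" and y: "y \<in> carrier_vec m"
  shows "(A *\<^sub>v x) \<bullet>c y = x \<bullet>c (mat_adjoint A *\<^sub>v y)"
proof -
  have "(A *\<^sub>v x) \<bullet>c y = (\<Sum>i<m. \<Sum>j<n. A $$ (i, j) * x $ j * cnj (y $ i))"
    using assms by (simp add: cdot_eq_sum[of _ m] mult_mat_vec_index_sum[OF A] sum_distrib_right del: index_mult_mat_vec)
  also have "\<dots> = (\<Sum>j<n. \<Sum>i<m. A $$ (i, j) * x $ j * cnj (y $ i))" by (rule sum.swap)
  also have "\<dots> = x \<bullet>c (mat_adjoint A *\<^sub>v y)"
    using assms mult_mat_vec_carrier[OF mat_adjoint_carrier[OF A] y] by (subst cdot_eq_sum[of _ n])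
      (auto simp: mult_mat_vec_index_sum[OF mat_adjoint_carrier[OF A]] mat_adjoint_index[OF A] sum_distrib_left mult_ac
        simp del: index_mult_mat_vec intro!: sum.cong)
  finally show ?thesis .
qed

lemma adjoint_mult_carrier:
  fixes A :: "complex mat"
  shows "A \<in> carrier_mat m n \<Longrightarrow> x \<in> carrier_vec m \<Longrightarrow> mat_adjoint A *\<^sub>v x \<in> carrier_vec n"
  by (rule mult_mat_vec_carrier[OF mat_adjoint_carrier])

lemma mat_adjoint_adjoint [simp]:
  fixes A :: "complex mat"
  shows "mat_adjoint (mat_adjoint A) = A"
  by (rule eq_matI) (auto simp: mat_adjoint_def mat_of_rows_def)

lemma mat_index_eq_cdot:
  fixes C :: "complex mat"
  assumes C: "C \<in> carrier_mat m n" and i: "i < m" and j: "j < n"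
  shows "C $$ (i, j) = (C *\<^sub>v unit_vec n j) \<bullet>c unit_vec m i"
proof -
  have "(C *\<^sub>v unit_vec n j) $ i = C $$ (i, j)" using C i j by auto
  moreover have "(C *\<^sub>v unit_vec n j) \<bullet>c unit_vec m i = (C *\<^sub>v unit_vec n j) $ i"
    using C i by (subst cdot_eq_sum[of _ m]) (auto simp: unit_vec_def if_distrib sum.delta cong: if_cong)
  ultimately show ?thesis by simp
qed

lemma mat_sandwich:
  fixes V W :: "complex mat"
  assumes V: "V \<in> carrier_mat m n" and W: "W \<in> carrier_mat m m"
  shows "mat_adjoint V * W * V \<in> carrier_mat n n"
    and "x \<in> carrier_vec n \<Longrightarrow> y \<in> carrier_vec n \<Longrightarrow>
      (mat_adjoint V * W * V *\<^sub>v x) \<bullet>c y = (W *\<^sub>v (V *\<^sub>v x)) \<bullet>c (V *\<^sub>v y)"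
proof -
  note V' = mat_adjoint_carrier[OF V]
  note P = mult_carrier_mat[OF V' W]
  show "mat_adjoint V * W * V \<in> carrier_mat n n" by (rule mult_carrier_mat[OF P V])
  assume x: "x \<in> carrier_vec n" and y: "y \<in> carrier_vec n"
  note Vx = mult_mat_vec_carrier[OF V x]
  show "(mat_adjoint V * W * V *\<^sub>v x) \<bullet>c y = (W *\<^sub>v (V *\<^sub>v x)) \<bullet>c (V *\<^sub>v y)"
    unfolding assoc_mult_mat_vec[OF P V x] assoc_mult_mat_vec[OF V' W Vx]
    using cdot_adjoint[OF V' mult_mat_vec_carrier[OF W Vx] y] by simp
qed

lemma mat_eqI_cdot:
  fixes A B :: "complex mat"
  assumes A: "A \<in> carrier_mat m n" and B: "B \<in> carrier_mat m n"
    and eq: "\<And>x y. x \<in> carrier_vec n \<Longrightarrow> y \<in> carrier_vec m \<Longrightarrow> (A *\<^sub>v x) \<bullet>c y = (B *\<^sub>v x) \<bullet>c y"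
  shows "A = B"
proof (rule eq_matI)
  fix i j assume "i < dim_row B" "j < dim_col B"
  then show "A $$ (i, j) = B $$ (i, j)"
    using mat_index_eq_cdot[OF A] mat_index_eq_cdot[OF B] eq B by simp
qed (use A B in auto)

section \<open>The weighted inner product\<close>

lemma op_nonneg_expand:
  assumes A: "A \<in> carrier_mat n n" and x: "x \<in> carrier_vec n" and y: "y \<in> carrier_vec n"
  shows "(A *\<^sub>v (x + c \<cdot>\<^sub>v y)) \<bullet>c (x + c \<cdot>\<^sub>v y) = (A *\<^sub>v x) \<bullet>c x + cnj c * ((A *\<^sub>v x) \<bullet>c y)
    + c * ((A *\<^sub>v y) \<bullet>c x) + c * cnj c * ((A *\<^sub>v y) \<bullet>c y)"
proof -
  have c: "A *\<^sub>v x \<in> carrier_vec n" "A *\<^sub>v y \<in> carrier_vec n" using assms by auto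
  have "A *\<^sub>v (x + c \<cdot>\<^sub>v y) = A *\<^sub>v x + c \<cdot>\<^sub>v (A *\<^sub>v y)"
    using assms by (simp add: mult_add_distrib_mat_vec[OF A] mult_mat_vec[OF A])
  then show ?thesis
    using assms c by (simp add: cdot_add_left[of _ n] cdot_add_right[of _ n]
        cdot_smult_left[of _ n] cdot_smult_right[of _ n] algebra_simps)
qed

text \<open>
  Polarization: the quadratic form is real on \<open>x + y\<close> and on \<open>x + \<i> y\<close>.
\<close>

lemma op_nonneg_hermitian:
  assumes A: "op_nonneg n A" and x: "x \<in> carrier_vec n" and y: "y \<in> carrier_vec n"
  shows "(A *\<^sub>v y) \<bullet>c x = cnj ((A *\<^sub>v x) \<bullet>c y)"
proof -
  have Ac: "A \<in> carrier_mat n n" and im: "\<And>v. v \<in> carrier_vec n \<Longrightarrow> Im ((A *\<^sub>v v) \<bullet>c v) = 0"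
    using A by (auto simp: op_nonneg_def)
  have "Im ((A *\<^sub>v (x + c \<cdot>\<^sub>v y)) \<bullet>c (x + c \<cdot>\<^sub>v y)) = 0" for c using im x y by auto
  from this[of 1] this[of \<i>] show ?thesis
    using im[OF x] im[OF y] unfolding op_nonneg_expand[OF Ac x y] by (simp add: complex_eq_iff)
qed

lemma op_nonneg_bound:
  assumes A: "op_nonneg n A" and x: "x \<in> carrier_vec n" and y: "y \<in> carrier_vec n"
  shows "2 * cmod ((A *\<^sub>v x) \<bullet>c y) \<le> Re ((A *\<^sub>v x) \<bullet>c x) + Re ((A *\<^sub>v y) \<bullet>c y)"
proof -
  have Ac: "A \<in> carrier_mat n n" and re: "\<And>v. v \<in> carrier_vec n \<Longrightarrow> 0 \<le> Re ((A *\<^sub>v v) \<bullet>c v)"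
    using A by (auto simp: op_nonneg_def)
  define b where "b = (A *\<^sub>v x) \<bullet>c y"
  show ?thesis
  proof (cases "b = 0")
    case True
    then show ?thesis using re x y by (simp add: b_def)
  next
    case False
    (* The unimodular c that turns the mixed terms into - |b|. *)
    define c where "c = - b / cmod b"
    have c: "c * cnj c = 1" "cnj c * b = - cmod b" "c * cnj b = - cmod b"
      using False unfolding c_def
      by (simp_all add: complex_norm_square[symmetric] mult.commute[of "cnj b"] power2_eq_square)
    have "0 \<le> Re ((A *\<^sub>v (x + c \<cdot>\<^sub>v y)) \<bullet>c (x + c \<cdot>\<^sub>v y))" using re x y by auto
    then show ?thesis
      unfolding op_nonneg_expand[OF Ac x y] op_nonneg_hermitian[OF A x y] b_def[symmetric] c by simp
  qed
qed

text \<open>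
  The Cauchy-Schwarz inequality of a semidefinite form, stated for its three values.
\<close>

lemma quadratic_nonneg_imp_discriminant:
  fixes A B :: real and b :: complex
  assumes "0 \<le> B" and nn: "\<And>c. 0 \<le> A + 2 * Re (cnj c * b) + (cmod c)\<^sup>2 * B"
  shows "(cmod b)\<^sup>2 \<le> A * B"
proof (cases "B = 0")
  case True
  have "b = 0"
  proof (rule ccontr)
    assume "b \<noteq> 0"
    then have p: "(cmod b)\<^sup>2 > 0" by simp
    (* For B = 0 the expression is affine in the direction of - b, so a nonzero b makes it negative. *)
    define s where "s = (\<bar>A\<bar> + 1) / (cmod b)\<^sup>2"
    have "Re (cnj (- of_real s * b) * b) = - s * (cmod b)\<^sup>2"
      by (simp add: cmod_power2) (simp add: power2_eq_square algebra_simps)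
    also have "\<dots> = - (\<bar>A\<bar> + 1)" using p by (simp add: s_def)
    finally show False using nn[of "- of_real s * b"] True by simp
  qed
  then show ?thesis using True by simp
next
  case False
  then have "B > 0" using assms by simp
  have "Re (cnj (- b / of_real B) * b) = - (cmod b)\<^sup>2 / B"
    by (simp add: cmod_power2) (simp add: power2_eq_square add_divide_distrib diff_divide_distrib)
  moreover have "(cmod (- b / of_real B))\<^sup>2 * B = (cmod b)\<^sup>2 / B"
    using \<open>B > 0\<close> by (simp add: norm_divide power_divide power2_eq_square)
  ultimately have "(cmod b)\<^sup>2 / B \<le> A" using nn[of "- b / of_real B"] by argo
  then show ?thesis using \<open>B > 0\<close> by (simp add: field_simps)
qed

lemma borel_measurable_cnj:
  "f \<in> borel_measurable M \<Longrightarrow> (\<lambda>x. cnj (f x)) \<in> borel_measurable M"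
  by (rule measurable_compose[OF _ borel_measurable_continuous_onI]) (auto intro: continuous_intros)

definition wprod :: "symsys \<Rightarrow> (real \<Rightarrow> complex vec) \<Rightarrow> (real \<Rightarrow> complex vec) \<Rightarrow> real \<Rightarrow> complex" where
  "wprod S f g t = (weight S t *\<^sub>v f t) \<bullet>c g t"

definition ip :: "symsys \<Rightarrow> (real \<Rightarrow> complex vec) \<Rightarrow> (real \<Rightarrow> complex vec) \<Rightarrow> complex" where
  "ip S f g = (LINT t : ival S | lborel. wprod S f g t)"

definition wnorm :: "symsys \<Rightarrow> (real \<Rightarrow> complex vec) \<Rightarrow> real" where
  "wnorm S f = sqrt (Re (ip S f f))"

locale symmetric_sys =
  fixes S :: symsys
  assumes sys: "symmetric_system S"
begin

abbreviation "N \<equiv> dimHH S"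

lemma ival_borel [measurable]: "ival S \<in> sets borel"
proof -
  have "ival S = {t. lend S \<le> t \<and> ereal t < rend S} \<or> ival S = {t. lend S \<le> t \<and> ereal t \<le> rend S}"
    using sys by (simp add: symmetric_system_def)
  moreover have "{t. lend S \<le> t \<and> ereal t < rend S} \<in> sets borel"
    "{t. lend S \<le> t \<and> ereal t \<le> rend S} \<in> sets borel" by measurable
  ultimately show ?thesis by auto
qed

lemma ival_interval: "\<beta> \<in> ival S \<Longrightarrow> lend S \<le> \<beta> \<and> {lend S..\<beta>} \<subseteq> ival S"
proof -
  have "ival S = {t. lend S \<le> t \<and> ereal t < rend S} \<or> ival S = {t. lend S \<le> t \<and> ereal t \<le> rend S}"
    using sys by (simp add: symmetric_system_def)
  moreover have "ereal t < rend S" if "t \<le> \<beta>" "ereal \<beta> < rend S" for t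
    using that ereal_less_eq(3) le_less_trans by blast
  moreover have "ereal t \<le> rend S" if "t \<le> \<beta>" "ereal \<beta> \<le> rend S" for t
    using that ereal_less_eq(3) order_trans by blast
  ultimately show "\<beta> \<in> ival S \<Longrightarrow> lend S \<le> \<beta> \<and> {lend S..\<beta>} \<subseteq> ival S"
    by auto
qed

lemma ival_less: "lend S \<le> t \<Longrightarrow> ereal t < rend S \<Longrightarrow> t \<in> ival S"
  using sys by (auto simp: symmetric_system_def)

lemma ival_le: "t \<in> ival S \<Longrightarrow> ereal t \<le> rend S"
  using sys by (auto simp: symmetric_system_def)

lemma weight_carrier: "t \<in> ival S \<Longrightarrow> weight S t \<in> carrier_mat N N"
  using sys by (auto simp: symmetric_system_def)

lemma weight_nonneg: "AE t in lborel. t \<in> ival S \<longrightarrow> op_nonneg N (weight S t)"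
  using sys by (auto simp: symmetric_system_def)

lemma wprod_measurable:
  assumes f: "\<And>t. f t \<in> carrier_vec N" "borel_vec_on N (ival S) f"
    and g: "\<And>t. g t \<in> carrier_vec N" "borel_vec_on N (ival S) g"
  shows "(\<lambda>t. indicator (ival S) t *\<^sub>R wprod S f g t) \<in> borel_measurable lborel"
proof -
  have "(\<lambda>t. \<Sum>i<N. (\<Sum>j<N. weight S t $$ (i, j) * f t $ j) * cnj (g t $ i))
      \<in> borel_measurable (restrict_space borel (ival S))"
    using f g sys by (intro borel_measurable_sum borel_measurable_times
       borel_measurable_cnj)
      (auto simp: borel_vec_on_def borel_mat_on_def symmetric_system_def)
  also have "?this \<longleftrightarrow> wprod S f g \<in> borel_measurable (restrict_space borel (ival S))"
    by (intro measurable_cong)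
      (auto simp: space_restrict_space wprod_def cdot_eq_sum[OF g(1)]
        mult_mat_vec_index_sum[OF weight_carrier f(1)] simp del: index_mult_mat_vec intro!: sum.cong)
  finally show ?thesis
    by (subst (asm) borel_measurable_restrict_space_iff) auto
qed

text \<open>
  Membership in \<open>\<L>\<^sup>2\<^sub>\<Delta>\<close> as Bochner integrability, which makes the inner product a genuine integral.
\<close>

lemma L2fun_iff:
  "f \<in> L2fun S \<longleftrightarrow> (\<forall>t. f t \<in> carrier_vec N) \<and> borel_vec_on N (ival S) f \<and>
     set_integrable lborel (ival S) (wprod S f f)"
proof -
  have "normsq S f < \<infinity> \<longleftrightarrow> set_integrable lborel (ival S) (wprod S f f)"
    if f: "\<And>t. f t \<in> carrier_vec N" "borel_vec_on N (ival S) f"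
  proof -
    have "normsq S f = (\<integral>\<^sup>+ t. ennreal (norm (indicator (ival S) t *\<^sub>R wprod S f f t)) \<partial>lborel)"
      unfolding normsq_def
    proof (rule nn_integral_cong_AE, use weight_nonneg in eventually_elim)
      case (elim t)
      then show ?case using f(1)[of t]
        by (cases "t \<in> ival S") (auto simp: op_nonneg_def wprod_def cmod_eq_Re)
    qed
    then show ?thesis
      using wprod_measurable[OF f f] by (simp add: set_integrable_def integrable_iff_bounded)
  qed
  then show ?thesis by (auto simp: L2fun_def)
qed

text \<open>
  \<open>\<Delta>(t) \<ge> 0\<close> bounds \<open>\<bar>(\<Delta> f, g)\<bar>\<close> by \<open>((\<Delta> f, f) + (\<Delta> g, g)) / 2\<close> pointwise.
\<close>

lemma wprod_integrable:
  assumes f: "f \<in> L2fun S" and g: "g \<in> L2fun S"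
  shows "set_integrable lborel (ival S) (wprod S f g)"
proof -
  have "integrable lborel (\<lambda>t. indicator (ival S) t *\<^sub>R wprod S f f t + indicator (ival S) t *\<^sub>R wprod S g g t)"
    using f g unfolding L2fun_iff set_integrable_def by (intro Bochner_Integration.integrable_add) auto
  then show ?thesis unfolding set_integrable_def
  proof (rule Bochner_Integration.integrable_bound)
    show "(\<lambda>t. indicator (ival S) t *\<^sub>R wprod S f g t) \<in> borel_measurable lborel"
      using f g by (intro wprod_measurable) (auto simp: L2fun_def)
    show "AE t in lborel. norm (indicator (ival S) t *\<^sub>R wprod S f g t) \<le>
        norm (indicator (ival S) t *\<^sub>R wprod S f f t + indicator (ival S) t *\<^sub>R wprod S g g t)"
      using weight_nonneg
    proof eventually_elim
      case (elim t)
      have c: "f t \<in> carrier_vec N" "g t \<in> carrier_vec N" using f g by (auto simp: L2fun_def)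
      show ?case
      proof (cases "t \<in> ival S")
        case True
        with elim have p: "op_nonneg N (weight S t)" by simp
        have "cmod (wprod S f g t) \<le> 2 * cmod (wprod S f g t)" by simp
        also have "\<dots> \<le> Re (wprod S f f t + wprod S g g t)"
          using op_nonneg_bound[OF p c] by (simp add: wprod_def)
        also have "\<dots> \<le> cmod (wprod S f f t + wprod S g g t)" by (rule complex_Re_le_cmod)
        finally show ?thesis using True by simp
      qed auto
    qed
  qed
qed

lemma wprod_add_left:
  assumes "t \<in> ival S" "f t \<in> carrier_vec N" "g t \<in> carrier_vec N" "h t \<in> carrier_vec N"
  shows "wprod S (\<lambda>t. f t + g t) h t = wprod S f h t + wprod S g h t"
  using assms weight_carrier[OF assms(1)]
  by (simp add: wprod_def mult_add_distrib_mat_vec[of _ N N] cdot_add_left[of _ N])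

lemma wprod_add_right:
  assumes "t \<in> ival S" "f t \<in> carrier_vec N" "g t \<in> carrier_vec N" "h t \<in> carrier_vec N"
  shows "wprod S h (\<lambda>t. f t + g t) t = wprod S h f t + wprod S h g t"
  using assms weight_carrier[OF assms(1)]
  by (simp add: wprod_def cdot_add_right[of _ N])

lemma wprod_smult_left:
  assumes "t \<in> ival S" "f t \<in> carrier_vec N" "g t \<in> carrier_vec N"
  shows "wprod S (\<lambda>t. c \<cdot>\<^sub>v f t) g t = c * wprod S f g t"
  using assms weight_carrier[OF assms(1)]
  by (simp add: wprod_def mult_mat_vec[of _ N N] cdot_smult_left[of _ N])

lemma wprod_smult_right:
  assumes "t \<in> ival S" "f t \<in> carrier_vec N" "g t \<in> carrier_vec N"
  shows "wprod S f (\<lambda>t. c \<cdot>\<^sub>v g t) t = cnj c * wprod S f g t"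
  using assms weight_carrier[OF assms(1)]
  by (simp add: wprod_def cdot_smult_right[of _ N])

lemma L2fun_carrier: "f \<in> L2fun S \<Longrightarrow> f t \<in> carrier_vec N"
  by (simp add: L2fun_def)

lemma borel_vec_on_add:
  assumes "f \<in> L2fun S" "g \<in> L2fun S"
  shows "borel_vec_on N (ival S) (\<lambda>t. f t + g t)"
  using assms index_add_fun[where z = g, OF L2fun_carrier[OF assms(2)]]
  by (auto simp: borel_vec_on_def L2fun_def simp del: index_add_vec intro!: borel_measurable_add)

lemma borel_vec_on_smult:
  assumes "f \<in> L2fun S"
  shows "borel_vec_on N (ival S) (\<lambda>t. c \<cdot>\<^sub>v f t)"
  using assms index_smult_fun[where y = f, OF L2fun_carrier[OF assms]]
  by (auto simp: borel_vec_on_def L2fun_def simp del: index_smult_vec)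

lemma L2fun_add:
  assumes f: "f \<in> L2fun S" and g: "g \<in> L2fun S"
  shows "(\<lambda>t. f t + g t) \<in> L2fun S"
proof -
  note c = L2fun_carrier[OF f] L2fun_carrier[OF g]
  have "set_integrable lborel (ival S)
      (\<lambda>t. (wprod S f f t + wprod S f g t) + (wprod S g f t + wprod S g g t))"
    using f g by (intro set_integral_add wprod_integrable)
  also have "?this \<longleftrightarrow> set_integrable lborel (ival S) (wprod S (\<lambda>t. f t + g t) (\<lambda>t. f t + g t))"
    using c by (intro set_integrable_cong)
      (auto simp: wprod_add_left wprod_add_right)
  finally show ?thesis using c borel_vec_on_add[OF f g] by (simp add: L2fun_iff)
qed

lemma L2fun_smult:
  assumes f: "f \<in> L2fun S"
  shows "(\<lambda>t. c \<cdot>\<^sub>v f t) \<in> L2fun S"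
proof -
  note c = L2fun_carrier[OF f]
  have "set_integrable lborel (ival S) (\<lambda>t. (c * cnj c) * wprod S f f t)"
    using f by (intro set_integrable_mult_right wprod_integrable)
  also have "?this \<longleftrightarrow> set_integrable lborel (ival S) (wprod S (\<lambda>t. c \<cdot>\<^sub>v f t) (\<lambda>t. c \<cdot>\<^sub>v f t))"
    using c by (intro set_integrable_cong)
      (auto simp: wprod_smult_left wprod_smult_right)
  finally show ?thesis using c borel_vec_on_smult[OF f] by (simp add: L2fun_iff)
qed

lemma ip_add_left:
  assumes f: "f \<in> L2fun S" and g: "g \<in> L2fun S" and h: "h \<in> L2fun S"
  shows "ip S (\<lambda>t. f t + g t) h = ip S f h + ip S g h"
proof -
  have "ip S (\<lambda>t. f t + g t) h = (LINT t : ival S | lborel. wprod S f h t + wprod S g h t)"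
    unfolding ip_def using L2fun_carrier[OF f] L2fun_carrier[OF g] L2fun_carrier[OF h]
    by (intro set_lebesgue_integral_cong) (auto simp: wprod_add_left)
  then show ?thesis using wprod_integrable[OF f h] wprod_integrable[OF g h] by (simp add: ip_def)
qed

lemma ip_smult_left:
  assumes f: "f \<in> L2fun S" and h: "h \<in> L2fun S"
  shows "ip S (\<lambda>t. c \<cdot>\<^sub>v f t) h = c * ip S f h"
proof -
  have "ip S (\<lambda>t. c \<cdot>\<^sub>v f t) h = (LINT t : ival S | lborel. c * wprod S f h t)"
    unfolding ip_def using L2fun_carrier[OF f] L2fun_carrier[OF h]
    by (intro set_lebesgue_integral_cong) (auto simp: wprod_smult_left)
  then show ?thesis by (simp add: ip_def)
qed

lemma ip_cnj:
  assumes f: "f \<in> L2fun S" and g: "g \<in> L2fun S"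
  shows "cnj (ip S f g) = ip S g f"
proof -
  have "cnj (ip S f g) = (\<integral>t. cnj (indicator (ival S) t *\<^sub>R wprod S f g t) \<partial>lborel)"
    unfolding ip_def set_lebesgue_integral_def by (rule Bochner_Integration.integral_cnj[symmetric])
  also have "\<dots> = (\<integral>t. indicator (ival S) t *\<^sub>R wprod S g f t \<partial>lborel)"
  proof (rule integral_cong_AE)
    show "(\<lambda>t. indicator (ival S) t *\<^sub>R wprod S g f t) \<in> borel_measurable lborel"
      using f g by (intro wprod_measurable) (auto simp: L2fun_def)
    have "(\<lambda>t. indicator (ival S) t *\<^sub>R wprod S f g t) \<in> borel_measurable lborel"
      using f g by (intro wprod_measurable) (auto simp: L2fun_def)
    then show "(\<lambda>t. cnj (indicator (ival S) t *\<^sub>R wprod S f g t)) \<in> borel_measurable lborel"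
      by (rule borel_measurable_cnj)
    show "AE t in lborel. cnj (indicator (ival S) t *\<^sub>R wprod S f g t) = indicator (ival S) t *\<^sub>R wprod S g f t"
      using weight_nonneg
    proof eventually_elim
      case (elim t)
      then show ?case
        using op_nonneg_hermitian[OF _ L2fun_carrier[OF f, of t] L2fun_carrier[OF g, of t]]
        by (cases "t \<in> ival S") (auto simp: wprod_def)
    qed
  qed
  finally show ?thesis by (simp add: ip_def set_lebesgue_integral_def)
qed

lemma ip_add_right:
  assumes "f \<in> L2fun S" "g \<in> L2fun S" "h \<in> L2fun S"
  shows "ip S h (\<lambda>t. f t + g t) = ip S h f + ip S h g"
  unfolding ip_cnj[OF L2fun_add[OF assms(1,2)] assms(3), symmetric] ip_cnj[OF assms(1,3), symmetric]
    ip_cnj[OF assms(2,3), symmetric] ip_add_left[OF assms] by simp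

lemma ip_smult_right:
  assumes "f \<in> L2fun S" "h \<in> L2fun S"
  shows "ip S h (\<lambda>t. c \<cdot>\<^sub>v f t) = cnj c * ip S h f"
  unfolding ip_cnj[OF L2fun_smult[OF assms(1)] assms(2), symmetric] ip_cnj[OF assms, symmetric]
    ip_smult_left[OF assms] by simp

lemma ip_self:
  assumes f: "f \<in> L2fun S"
  shows "Im (ip S f f) = 0" "0 \<le> Re (ip S f f)" "ip S f f = of_real ((wnorm S f)\<^sup>2)"
proof -
  have "cnj (ip S f f) = ip S f f" using ip_cnj[OF f f] .
  then show im: "Im (ip S f f) = 0" by (simp add: complex_eq_iff)
  have "0 \<le> integral\<^sup>L lborel (\<lambda>t. Re (indicator (ival S) t *\<^sub>R wprod S f f t))"
  proof (rule integral_nonneg_AE, use weight_nonneg in eventually_elim)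
    case (elim t)
    then show ?case using L2fun_carrier[OF f, of t]
      by (cases "t \<in> ival S") (auto simp: op_nonneg_def wprod_def)
  qed
  also have "\<dots> = Re (ip S f f)"
    using wprod_integrable[OF f f] unfolding ip_def set_lebesgue_integral_def set_integrable_def
    by (rule integral_Re)
  finally show "0 \<le> Re (ip S f f)" .
  then show "ip S f f = of_real ((wnorm S f)\<^sup>2)" using im by (simp add: wnorm_def complex_eq_iff)
qed

lemma wnorm_nonneg [simp]: "f \<in> L2fun S \<Longrightarrow> 0 \<le> wnorm S f"
  using ip_self(2) by (simp add: wnorm_def)

lemma ip_Cauchy_Schwarz:
  assumes f: "f \<in> L2fun S" and g: "g \<in> L2fun S"
  shows "cmod (ip S f g) \<le> wnorm S f * wnorm S g"
proof -
  have "(cmod (ip S f g))\<^sup>2 \<le> Re (ip S f f) * Re (ip S g g)"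
  proof (rule quadratic_nonneg_imp_discriminant)
    fix c
    let ?h = "\<lambda>t. f t + c \<cdot>\<^sub>v g t"
    have cg: "(\<lambda>t. c \<cdot>\<^sub>v g t) \<in> L2fun S" by (rule L2fun_smult[OF g])
    have h: "?h \<in> L2fun S" by (rule L2fun_add[OF f cg])
    have "ip S ?h ?h = ip S f f + cnj c * ip S f g + c * cnj (ip S f g) + c * cnj c * ip S g g"
      unfolding ip_add_left[OF f cg h] ip_add_right[OF f cg f] ip_add_right[OF f cg cg]
        ip_smult_left[OF g f] ip_smult_left[OF g cg] ip_smult_right[OF g f] ip_smult_right[OF g g]
        ip_cnj[OF f g] by (simp add: algebra_simps)
    moreover have "cnj c * ip S f g + c * cnj (ip S f g) = of_real (2 * Re (cnj c * ip S f g))"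
      using complex_add_cnj[of "cnj c * ip S f g"] by simp
    moreover have "c * cnj c = of_real ((cmod c)\<^sup>2)" by (rule complex_norm_square[symmetric])
    ultimately have "ip S ?h ?h = ip S f f + of_real (2 * Re (cnj c * ip S f g)) + of_real ((cmod c)\<^sup>2) * ip S g g"
      by (simp only: add.assoc)
    then show "0 \<le> Re (ip S f f) + 2 * Re (cnj c * ip S f g) + (cmod c)\<^sup>2 * Re (ip S g g)"
      using ip_self(2)[OF h] by simp
  qed (rule ip_self(2)[OF g])
  also have "\<dots> = (wnorm S f * wnorm S g)\<^sup>2"
    using ip_self(2)[OF f] ip_self(2)[OF g] by (simp add: wnorm_def power_mult_distrib)
  finally show ?thesis
    by (rule power2_le_imp_le) (use f g in simp)
qed

end

section \<open>Green's identity\<close>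

lemma Jmat_carrier [simp]: "Jmat S \<in> carrier_mat (dimHH S) (dimHH S)"
  by (simp add: Jmat_def)

lemma Jmat_adjoint: "mat_adjoint (Jmat S) = - Jmat S"
proof (rule eq_matI)
  fix i j assume "i < dim_row (- Jmat S)" "j < dim_col (- Jmat S)"
  then have ij: "i < dimHH S" "j < dimHH S" by (auto simp: Jmat_def)
  then show "mat_adjoint (Jmat S) $$ (i, j) = (- Jmat S) $$ (i, j)"
    by (subst mat_adjoint_index[OF Jmat_carrier ij]) (auto simp: Jmat_def dimHH_def dim0_def)
qed (auto simp: Jmat_def mat_adjoint_def)

lemma Jmat_cdot_right:
  assumes x: "x \<in> carrier_vec (dimHH S)" and y: "y \<in> carrier_vec (dimHH S)"
  shows "(Jmat S *\<^sub>v x) \<bullet>c y = - (x \<bullet>c (Jmat S *\<^sub>v y))"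
proof -
  have "(Jmat S *\<^sub>v x) \<bullet>c y = x \<bullet>c ((- Jmat S) *\<^sub>v y)"
    using cdot_adjoint[OF Jmat_carrier x y] by (simp add: Jmat_adjoint)
  also have "(- Jmat S) *\<^sub>v y = (- 1) \<cdot>\<^sub>v (Jmat S *\<^sub>v y)"
    using y by (auto simp: Jmat_def)
  finally show ?thesis
    using cdot_smult_right[OF x mult_mat_vec_carrier[OF Jmat_carrier y], of "- 1"] by simp
qed

text \<open>
  Green's identity says that this function is a primitive of \<open>(\<Delta> f, z) - (\<Delta> y, g)\<close>; its limit at \<open>b\<close>
  is \<open>[y, z]\<^sub>b\<close>.
\<close>

definition bracket :: "symsys \<Rightarrow> (real \<Rightarrow> complex vec) \<Rightarrow> (real \<Rightarrow> complex vec) \<Rightarrow> real \<Rightarrow> complex" where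
  "bracket S y z t = (Jmat S *\<^sub>v y t) \<bullet>c z t"

lemma bracket_eq_sum:
  assumes "\<And>t. y t \<in> carrier_vec (dimHH S)" "\<And>t. z t \<in> carrier_vec (dimHH S)"
  shows "bracket S y z t = (\<Sum>i<dimHH S. (\<Sum>j<dimHH S. Jmat S $$ (i, j) * y t $ j) * cnj (z t $ i))"
  unfolding bracket_def cdot_eq_sum[OF assms(2)]
  by (simp add: mult_mat_vec_index_sum[OF Jmat_carrier assms(1)] del: index_mult_mat_vec)

lemma AC_carrier: "y \<in> AC S \<Longrightarrow> y t \<in> carrier_vec (dimHH S)"
  by (simp add: AC_def)

lemma bracket_ac:
  assumes y: "y \<in> AC S" and z: "z \<in> AC S" and "\<beta> \<in> ival S"
  shows "ac_on (bracket S y z) (lend S) \<beta>"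
proof -
  have "ac_on (\<lambda>t. \<Sum>i<dimHH S. (\<Sum>j<dimHH S. Jmat S $$ (i, j) * y t $ j) * cnj (z t $ i)) (lend S) \<beta>"
    using assms by (intro ac_on_sum ac_on_mult ac_on_cnj ac_on_const) (auto simp: AC_def)
  also have "(\<lambda>t. \<Sum>i<dimHH S. (\<Sum>j<dimHH S. Jmat S $$ (i, j) * y t $ j) * cnj (z t $ i)) = bracket S y z"
    by (rule ext, rule bracket_eq_sum[symmetric]) (use y z AC_carrier in auto)
  finally show ?thesis .
qed

lemma bracket_deriv:
  assumes y: "\<And>t. y t \<in> carrier_vec (dimHH S)" and z: "\<And>t. z t \<in> carrier_vec (dimHH S)"
    and dy: "has_vec_deriv (dimHH S) y dy t" and dz: "has_vec_deriv (dimHH S) z dz t"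
  shows "(bracket S y z has_vector_derivative
     (Jmat S *\<^sub>v dy) \<bullet>c z t + (Jmat S *\<^sub>v y t) \<bullet>c dz) (at t)"
proof -
  let ?N = "dimHH S"
  have dyc: "dy \<in> carrier_vec ?N" and dzc: "dz \<in> carrier_vec ?N"
    and dy': "\<And>i. i < ?N \<Longrightarrow> ((\<lambda>s. y s $ i) has_vector_derivative dy $ i) (at t)"
    and dz': "\<And>i. i < ?N \<Longrightarrow> ((\<lambda>s. z s $ i) has_vector_derivative dz $ i) (at t)"
    using dy dz by (auto simp: has_vec_deriv_def)
  have "((\<lambda>s. \<Sum>i<?N. (\<Sum>j<?N. Jmat S $$ (i, j) * y s $ j) * cnj (z s $ i)) has_vector_derivative
     (\<Sum>i<?N. (\<Sum>j<?N. Jmat S $$ (i, j) * y t $ j) * cnj (dz $ i) +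
             (\<Sum>j<?N. Jmat S $$ (i, j) * dy $ j) * cnj (z t $ i))) (at t)"
    by (intro has_vector_derivative_sum has_vector_derivative_mult has_vector_derivative_mult_right
        has_vector_derivative_cnj dy' dz') auto
  also have "(\<lambda>s. \<Sum>i<?N. (\<Sum>j<?N. Jmat S $$ (i, j) * y s $ j) * cnj (z s $ i)) = bracket S y z"
    using bracket_eq_sum[of y S z, OF y z] by (simp add: fun_eq_iff)
  also have "(\<Sum>i<?N. (\<Sum>j<?N. Jmat S $$ (i, j) * y t $ j) * cnj (dz $ i) +
             (\<Sum>j<?N. Jmat S $$ (i, j) * dy $ j) * cnj (z t $ i)) =
      (Jmat S *\<^sub>v dy) \<bullet>c z t + (Jmat S *\<^sub>v y t) \<bullet>c dz"
    unfolding cdot_eq_sum[OF z] cdot_eq_sum[OF dzc]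
    by (simp add: mult_mat_vec_index_sum[OF Jmat_carrier y] mult_mat_vec_index_sum[OF Jmat_carrier dyc]
        sum.distrib add.commute del: index_mult_mat_vec)
  finally show ?thesis .
qed

context symmetric_sys
begin

lemma coefB_hermitian:
  "AE t in lborel. t \<in> ival S \<longrightarrow> (\<forall>x \<in> carrier_vec N. \<forall>y \<in> carrier_vec N.
     (coefB S t *\<^sub>v x) \<bullet>c y = x \<bullet>c (coefB S t *\<^sub>v y))"
proof -
  have "AE t in lborel. t \<in> ival S \<longrightarrow> mat_adjoint (coefB S t) = coefB S t"
    using sys by (simp add: symmetric_system_def)
  then show ?thesis
  proof eventually_elim
    case (elim t)
    then show ?case using sys cdot_adjoint[of "coefB S t" N N]
      by (auto simp: symmetric_system_def)
  qed
qed

text \<open>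
  The terms with \<open>B\<close> cancel because \<open>B(t)\<close> is selfadjoint and \<open>J\<close> is skew-adjoint.
\<close>

lemma bracket_derivative:
  assumes yf: "(y, f) \<in> Tmax_fun S" and zg: "(z, g) \<in> Tmax_fun S"
  shows "AE t in lborel. t \<in> ival S \<longrightarrow>
    (bracket S y z has_vector_derivative wprod S f z t - wprod S y g t) (at t)"
proof -
  have y: "y \<in> AC S" "f \<in> L2fun S" "sys_eq S y f" and z: "z \<in> AC S" "g \<in> L2fun S" "sys_eq S z g"
    using yf zg by (auto simp: Tmax_fun_def)
  have ey: "AE t in lborel. t \<in> ival S \<longrightarrow> (\<exists>d. has_vec_deriv N y d t \<and>
     Jmat S *\<^sub>v d - coefB S t *\<^sub>v y t = weight S t *\<^sub>v f t)" using y(3) by (simp add: sys_eq_def)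
  have ez: "AE t in lborel. t \<in> ival S \<longrightarrow> (\<exists>d. has_vec_deriv N z d t \<and>
     Jmat S *\<^sub>v d - coefB S t *\<^sub>v z t = weight S t *\<^sub>v g t)" using z(3) by (simp add: sys_eq_def)
  show ?thesis
    using ey ez coefB_hermitian weight_nonneg
  proof eventually_elim
    case (elim t)
    show ?case
    proof
      assume t: "t \<in> ival S"
      obtain dy where dy: "has_vec_deriv N y dy t"
        "Jmat S *\<^sub>v dy - coefB S t *\<^sub>v y t = weight S t *\<^sub>v f t" using elim t by auto
      obtain dz where dz: "has_vec_deriv N z dz t"
        "Jmat S *\<^sub>v dz - coefB S t *\<^sub>v z t = weight S t *\<^sub>v g t" using elim t by auto
      have B: "coefB S t \<in> carrier_mat N N" using sys t by (auto simp: symmetric_system_def)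
      note W = weight_carrier[OF t]
      note c = AC_carrier[OF y(1), of t] AC_carrier[OF z(1), of t] L2fun_carrier[OF y(2), of t]
        L2fun_carrier[OF z(2), of t]
      have d: "dy \<in> carrier_vec N" "dz \<in> carrier_vec N" using dy dz by (auto simp: has_vec_deriv_def)
      have split: "u = (u - v) + v" if "u \<in> carrier_vec N" "v \<in> carrier_vec N" for u v :: "complex vec"
        using that by auto
      have Jdy: "Jmat S *\<^sub>v dy = weight S t *\<^sub>v f t + coefB S t *\<^sub>v y t"
        using split[of "Jmat S *\<^sub>v dy" "coefB S t *\<^sub>v y t"] dy(2) d B c
        by (metis Jmat_carrier mult_mat_vec_carrier)
      have Jdz: "Jmat S *\<^sub>v dz = weight S t *\<^sub>v g t + coefB S t *\<^sub>v z t"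
        using split[of "Jmat S *\<^sub>v dz" "coefB S t *\<^sub>v z t"] dz(2) d B c
        by (metis Jmat_carrier mult_mat_vec_carrier)
      have e1: "(Jmat S *\<^sub>v dy) \<bullet>c z t = wprod S f z t + (coefB S t *\<^sub>v y t) \<bullet>c z t"
        unfolding Jdy wprod_def using c B W by (intro cdot_add_left[of _ N]) auto
      have "(Jmat S *\<^sub>v y t) \<bullet>c dz = - (y t \<bullet>c (weight S t *\<^sub>v g t + coefB S t *\<^sub>v z t))"
        using Jmat_cdot_right[of "y t" S dz] c d Jdz by simp
      also have "y t \<bullet>c (weight S t *\<^sub>v g t + coefB S t *\<^sub>v z t) =
          y t \<bullet>c (weight S t *\<^sub>v g t) + y t \<bullet>c (coefB S t *\<^sub>v z t)"
        using c B W by (intro cdot_add_right[of _ N]) auto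
      also have "y t \<bullet>c (weight S t *\<^sub>v g t) = wprod S y g t"
        using cdot_cnj[of "weight S t *\<^sub>v g t" N "y t"] op_nonneg_hermitian[of N "weight S t" "g t" "y t"]
          elim t c W by (simp add: wprod_def)
      also have "y t \<bullet>c (coefB S t *\<^sub>v z t) = (coefB S t *\<^sub>v y t) \<bullet>c z t"
        using elim t c by simp
      finally show "(bracket S y z has_vector_derivative wprod S f z t - wprod S y g t) (at t)"
        using bracket_deriv[OF AC_carrier[OF y(1)] AC_carrier[OF z(1)] dy(1) dz(1)] e1 by simp
    qed
  qed
qed

text \<open>
  Integrate \<open>bracket_derivative\<close> over \<open>[a, \<beta>]\<close> and let \<open>\<beta>\<close> tend to \<open>b\<close>. The integrand is
  integrable over the whole interval, so the limit that defines \<open>[y, z]\<^sub>b\<close> exists.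
\<close>

theorem Green_identity:
  assumes yf: "(y, f) \<in> Tmax_fun S" and zg: "(z, g) \<in> Tmax_fun S"
  shows "bracket_b S y z = ip S f z - ip S y g + bracket S y z (lend S)"
proof -
  define u where "u t = wprod S f z t - wprod S y g t" for t
  have y: "y \<in> AC S" "y \<in> L2fun S" "f \<in> L2fun S" and z: "z \<in> AC S" "z \<in> L2fun S" "g \<in> L2fun S"
    using yf zg by (auto simp: Tmax_fun_def)
  have u_int: "set_integrable lborel (ival S) u"
    unfolding u_def using y z by (intro set_integral_diff wprod_integrable)
  have u_ip: "(LINT t : ival S | lborel. u t) = ip S f z - ip S y g"
    unfolding u_def ip_def using y z by (intro set_integral_diff wprod_integrable)
  have lt: "ereal (lend S) < rend S" using sys by (simp add: symmetric_system_def)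
  have part: "(LINT t : {lend S..\<beta>} | lborel. u t) = bracket S y z \<beta> - bracket S y z (lend S)"
    if \<beta>: "\<beta> \<in> ival S" for \<beta>
  proof -
    have sub: "lend S \<le> \<beta>" "{lend S..\<beta>} \<subseteq> ival S" using ival_interval[OF \<beta>] by auto
    have "(u has_integral (bracket S y z \<beta> - bracket S y z (lend S))) {lend S..\<beta>}"
    proof (rule ac_on_has_integral[OF bracket_ac[OF y(1) z(1) \<beta>] sub(1)])
      show "AE t in lborel. t \<in> {lend S..\<beta>} \<longrightarrow> (bracket S y z has_vector_derivative u t) (at t)"
        using bracket_derivative[OF yf zg] sub(2) unfolding u_def by (auto elim!: eventually_mono)
    qed
    moreover have "set_integrable lborel {lend S..\<beta>} u"
      by (rule set_integrable_subset[OF u_int _ sub(2)]) simp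
    ultimately show ?thesis using set_borel_integral_eq_integral(2) integral_unique by metis
  qed
  define L where "L = ip S f z - ip S y g + bracket S y z (lend S)"
  (* Limits along sequences cover both shapes of the right endpoint. *)
  have seq: "(\<lambda>n. bracket S y z (X n)) \<longlonglongrightarrow> L"
    if X: "\<forall>\<^sub>F n in sequentially. X n \<in> ival S"
      and lim: "\<And>t. ereal t < rend S \<Longrightarrow> \<forall>\<^sub>F n in sequentially. t \<le> X n" for X
  proof -
    have "(\<lambda>n. integral\<^sup>L lborel (\<lambda>t. indicator ({lend S..X n} \<inter> ival S) t *\<^sub>R u t))
        \<longlonglongrightarrow> integral\<^sup>L lborel (\<lambda>t. indicator (ival S) t *\<^sub>R u t)"
    proof (rule integral_dominated_convergence[where w = "\<lambda>t. norm (indicator (ival S) t *\<^sub>R u t)"])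
      have m: "(\<lambda>t. indicator (ival S) t *\<^sub>R u t) \<in> borel_measurable lborel"
        using u_int by (simp add: set_integrable_def borel_measurable_integrable)
      then show "(\<lambda>t. indicator (ival S) t *\<^sub>R u t) \<in> borel_measurable lborel" .
      show "(\<lambda>t. indicator ({lend S..X n} \<inter> ival S) t *\<^sub>R u t) \<in> borel_measurable lborel" for n
      proof -
        have "(\<lambda>t. indicator {lend S..X n} t *\<^sub>R (indicator (ival S) t *\<^sub>R u t)) \<in> borel_measurable lborel"
          by (intro borel_measurable_scaleR m) auto
        then show ?thesis by (simp add: indicator_inter_arith)
      qed
      show "integrable lborel (\<lambda>t. norm (indicator (ival S) t *\<^sub>R u t))"
        using u_int unfolding set_integrable_def by (rule integrable_norm)
      show "AE t in lborel. (\<lambda>n. indicator ({lend S..X n} \<inter> ival S) t *\<^sub>R u t)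
          \<longlonglongrightarrow> indicator (ival S) t *\<^sub>R u t"
      proof -
        have "AE t in lborel. t \<noteq> real_of_ereal (rend S)" by (rule AE_lborel_singleton)
        then show ?thesis
        proof eventually_elim
          case (elim t)
          show ?case
          proof (cases "t \<in> ival S")
            case True
            then have "ereal t \<noteq> rend S" using elim by (metis real_of_ereal.simps(1))
            then have "ereal t < rend S" using ival_le[OF True] by auto
            from lim[OF this] have "\<forall>\<^sub>F n in sequentially.
                indicator (ival S) t *\<^sub>R u t = indicator ({lend S..X n} \<inter> ival S) t *\<^sub>R u t"
            proof eventually_elim
              case (elim n)
              have "lend S \<le> t" using ival_interval[OF True] by simp
              then show ?case using elim True by simp
            qed
            then show ?thesis by (rule Lim_transform_eventually[OF tendsto_const])
          qed auto
        qed
      qed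
      show "AE t in lborel. norm (indicator ({lend S..X n} \<inter> ival S) t *\<^sub>R u t)
          \<le> norm (indicator (ival S) t *\<^sub>R u t)" for n
        by (auto simp: indicator_def)
    qed
    also have "integral\<^sup>L lborel (\<lambda>t. indicator (ival S) t *\<^sub>R u t) = L - bracket S y z (lend S)"
      using u_ip by (simp add: L_def set_lebesgue_integral_def)
    finally have "(\<lambda>n. integral\<^sup>L lborel (\<lambda>t. indicator ({lend S..X n} \<inter> ival S) t *\<^sub>R u t) + bracket S y z (lend S))
        \<longlonglongrightarrow> (L - bracket S y z (lend S)) + bracket S y z (lend S)"
      by (intro tendsto_add tendsto_const)
    then have "(\<lambda>n. integral\<^sup>L lborel (\<lambda>t. indicator ({lend S..X n} \<inter> ival S) t *\<^sub>R u t) + bracket S y z (lend S))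
        \<longlonglongrightarrow> L" by simp
    moreover have "\<forall>\<^sub>F n in sequentially. integral\<^sup>L lborel (\<lambda>t. indicator ({lend S..X n} \<inter> ival S) t *\<^sub>R u t)
        + bracket S y z (lend S) = bracket S y z (X n)"
      using X
    proof eventually_elim
      case (elim n)
      have "{lend S..X n} \<inter> ival S = {lend S..X n}" using ival_interval[OF elim] by auto
      then show ?case using part[OF elim] by (simp add: set_lebesgue_integral_def)
    qed
    ultimately show ?thesis by (rule Lim_transform_eventually)
  qed
  define F where "F = (if rend S = \<infinity> then at_top else at_left (real_of_ereal (rend S)))"
  have "(bracket S y z \<longlongrightarrow> L) F"
  proof (cases "rend S = \<infinity>")
    case True
    have "(bracket S y z \<longlongrightarrow> L) at_top"
    proof (rule tendsto_at_topI_sequentially, rule seq)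
      fix X :: "nat \<Rightarrow> real" assume X: "filterlim X at_top sequentially"
      show "\<forall>\<^sub>F n in sequentially. t \<le> X n" for t
        using X by (simp add: filterlim_at_top)
      then have "\<forall>\<^sub>F n in sequentially. lend S \<le> X n" .
      then show "\<forall>\<^sub>F n in sequentially. X n \<in> ival S"
        by eventually_elim (use True ival_less in auto)
    qed
    then show ?thesis using True by (simp add: F_def)
  next
    case False
    then obtain b where b: "rend S = ereal b" using lt by (cases "rend S") auto
    have "(bracket S y z \<longlongrightarrow> L) (at_left b)"
    proof (rule tendsto_at_left_sequentially[of "lend S"], use lt b in simp, rule seq)
      fix X :: "nat \<Rightarrow> real" assume X: "\<And>n. X n < b" "\<And>n. lend S < X n" "incseq X" "X \<longlonglongrightarrow> b"
      show "\<forall>\<^sub>F n in sequentially. X n \<in> ival S"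
        using X ival_less b by (auto intro!: always_eventually less_imp_le)
      show "\<forall>\<^sub>F n in sequentially. t \<le> X n" if "ereal t < rend S" for t
        using order_tendstoD(1)[OF X(4), of t] that b by (auto elim!: eventually_mono)
    qed
    then show ?thesis using b by (simp add: F_def)
  qed
  moreover have "F \<noteq> bot" by (simp add: F_def)
  ultimately have "Lim F (bracket S y z) = L" by (intro tendsto_Lim)
  moreover have "bracket_b S y z = Lim F (bracket S y z)"
    by (simp add: bracket_b_def F_def bracket_def[abs_def])
  ultimately show ?thesis by (simp add: L_def)
qed

end

section \<open>Boundary forms and boundary parameters\<close>

lemma sum_lessThan_add:
  fixes f :: "nat \<Rightarrow> 'a :: comm_monoid_add"
  shows "sum f {..<m + n} = sum f {..<m} + (\<Sum>i<n. f (m + i))"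
  by (induction n) (simp_all add: add.assoc)

lemma cdot_first_last:
  fixes x y :: "complex vec"
  assumes "x \<in> carrier_vec (m + n)" "y \<in> carrier_vec (m + n)"
  shows "x \<bullet>c y = vec_first x m \<bullet>c vec_first y m + vec_last x n \<bullet>c vec_last y n"
proof -
  have "vec_first x m \<bullet>c vec_first y m = (\<Sum>i<m. x $ i * cnj (y $ i))"
    by (subst cdot_eq_sum[of _ m]) (auto simp: vec_first_def)
  moreover have "vec_last x n \<bullet>c vec_last y n = (\<Sum>i<n. x $ (m + i) * cnj (y $ (m + i)))"
    using assms by (subst cdot_eq_sum[of _ n]) (auto simp: vec_last_def)
  ultimately show ?thesis using assms(2) by (simp add: cdot_eq_sum[of _ "m + n"] sum_lessThan_add)
qed

text \<open>
  \<open>U\<close>-tilde preserves \<open>J\<close>, so the form at \<open>a\<close> may be computed from the boundary values.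
\<close>

lemma bracket_at_a:
  assumes bnd: "boundary_op_a S U Ut"
    and y: "\<And>t. y t \<in> carrier_vec (dimHH S)" and z: "\<And>t. z t \<in> carrier_vec (dimHH S)"
  shows "bracket S y z (lend S) = G0a S Ut y \<bullet>c G1a S Ut z - G1a S Ut y \<bullet>c G0a S Ut z
    + \<i> * (Gha S Ut y \<bullet>c Gha S Ut z)"
proof -
  let ?N = "dimHH S" and ?p = "dimH S" and ?q = "dimHh S" and ?J = "Jmat S"
  have U: "Ut \<in> carrier_mat ?N ?N" "mat_adjoint Ut * ?J * Ut = ?J"
    using bnd by (auto simp: boundary_op_a_def Let_def)
  define u v where "u = Ut *\<^sub>v y (lend S)" and "v = Ut *\<^sub>v z (lend S)"
  have uv: "u \<in> carrier_vec ?N" "v \<in> carrier_vec ?N"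
    using U y z by (auto simp: u_def v_def)
  have "?J *\<^sub>v y (lend S) = mat_adjoint Ut *\<^sub>v (?J *\<^sub>v u)"
  proof -
    have "(mat_adjoint Ut * ?J * Ut) *\<^sub>v y (lend S) = (mat_adjoint Ut * ?J) *\<^sub>v u"
      unfolding u_def using U(1) y
      by (intro assoc_mult_mat_vec[of _ ?N ?N _ ?N] mult_carrier_mat[of _ ?N ?N _ ?N] mat_adjoint_carrier Jmat_carrier)
    also have "\<dots> = mat_adjoint Ut *\<^sub>v (?J *\<^sub>v u)"
      using U uv by (intro assoc_mult_mat_vec[of _ ?N ?N _ ?N]) auto
    finally show ?thesis using U by simp
  qed
  then have "bracket S y z (lend S) = (?J *\<^sub>v u) \<bullet>c v"
    using cdot_adjoint[OF mat_adjoint_carrier[OF U(1)] mult_mat_vec_carrier[OF Jmat_carrier uv(1)] z]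
    by (simp add: bracket_def v_def)
  also have "\<dots> = (\<Sum>i<?N. (\<Sum>j<?N. ?J $$ (i, j) * u $ j) * cnj (v $ i))"
    using uv by (simp add: cdot_eq_sum[of _ ?N] mult_mat_vec_index_sum[OF Jmat_carrier] del: index_mult_mat_vec)
  also have "\<dots> = (\<Sum>i<?N. (if i < ?p then - u $ (i + (?p + ?q)) else if i < ?p + ?q then \<i> * u $ i
        else u $ (i - (?p + ?q))) * cnj (v $ i))"
  proof (rule sum.cong[OF refl])
    fix i assume i: "i \<in> {..<?N}"
    (* The column of the only nonzero entry in row i of J. *)
    define k where "k = (if i < ?p then i + (?p + ?q) else if i < ?p + ?q then i else i - (?p + ?q))"
    have k: "k < ?N" using i by (auto simp: k_def dimHH_def)
    have "(\<Sum>j<?N. ?J $$ (i, j) * u $ j) = (\<Sum>j<?N. if j = k then ?J $$ (i, k) * u $ k else 0)"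
      using i by (intro sum.cong) (auto simp: Jmat_def k_def dim0_def)
    also have "\<dots> = ?J $$ (i, k) * u $ k" using k by simp
    also have "\<dots> = (if i < ?p then - u $ (i + (?p + ?q)) else if i < ?p + ?q then \<i> * u $ i
        else u $ (i - (?p + ?q)))"
      using i k by (auto simp: Jmat_def k_def dim0_def)
    finally show "(\<Sum>j<?N. ?J $$ (i, j) * u $ j) * cnj (v $ i) = (if i < ?p then - u $ (i + (?p + ?q))
        else if i < ?p + ?q then \<i> * u $ i else u $ (i - (?p + ?q))) * cnj (v $ i)" by simp
  qed
  also have "\<dots> = - (\<Sum>i<?p. u $ (?p + ?q + i) * cnj (v $ i)) + \<i> * (\<Sum>i<?q. u $ (?p + i) * cnj (v $ (?p + i)))
      + (\<Sum>i<?p. u $ i * cnj (v $ (?p + ?q + i)))"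
    unfolding dimHH_def sum_lessThan_add by (simp add: sum_negf sum_distrib_left add_ac mult_ac)
  also have "(\<Sum>i<?p. u $ (?p + ?q + i) * cnj (v $ i)) = G1a S Ut y \<bullet>c G0a S Ut z"
    using uv unfolding G1a_def G0a_def u_def[symmetric] v_def[symmetric]
    by (subst cdot_eq_sum[of _ ?p]) (auto simp: vec_first_def vec_last_def dimHH_def)
  also have "(\<Sum>i<?p. u $ i * cnj (v $ (?p + ?q + i))) = G0a S Ut y \<bullet>c G1a S Ut z"
    using uv unfolding G1a_def G0a_def u_def[symmetric] v_def[symmetric]
    by (subst cdot_eq_sum[of _ ?p]) (auto simp: vec_first_def vec_last_def dimHH_def)
  also have "(\<Sum>i<?q. u $ (?p + i) * cnj (v $ (?p + i))) = Gha S Ut y \<bullet>c Gha S Ut z"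
    using uv unfolding Gha_def u_def[symmetric] v_def[symmetric]
    by (subst cdot_eq_sum[of _ ?q]) (auto simp: vec_first_def vec_last_def dim0_def)
  finally show ?thesis by simp
qed

text \<open>
  The part of \<open>[y, z]\<^sub>b\<close> that depends on the values of \<open>\<Gamma>\<^sub>0\<^sub>b\<close> and \<open>\<Gamma>\<^sub>1\<^sub>b\<close>.
\<close>

definition bform :: "nat \<Rightarrow> nat \<Rightarrow> complex vec \<Rightarrow> complex vec \<Rightarrow> complex vec \<Rightarrow> complex vec \<Rightarrow> complex" where
  "bform r s x0 x1 z0 z1 = vec_first x0 r \<bullet>c z1 - x1 \<bullet>c vec_first z0 r + \<i> * (vec_last x0 s \<bullet>c vec_last z0 s)"

lemma bform_eq_sum:
  assumes "x0 \<in> carrier_vec (r + s)" "z0 \<in> carrier_vec (r + s)" "x1 \<in> carrier_vec r" "z1 \<in> carrier_vec r"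
  shows "bform r s x0 x1 z0 z1 = (\<Sum>i<r. x0 $ i * cnj (z1 $ i) - x1 $ i * cnj (z0 $ i)) +
    \<i> * (\<Sum>j<s. x0 $ (r + j) * cnj (z0 $ (r + j)))"
proof -
  have "vec_first x0 r \<bullet>c z1 = (\<Sum>i<r. x0 $ i * cnj (z1 $ i))"
    "x1 \<bullet>c vec_first z0 r = (\<Sum>i<r. x1 $ i * cnj (z0 $ i))"
    using assms by (auto simp: cdot_eq_sum[of _ r] vec_first_def)
  moreover have "vec_last x0 s \<bullet>c vec_last z0 s = (\<Sum>j<s. x0 $ (r + j) * cnj (z0 $ (r + j)))"
    using assms by (subst cdot_eq_sum[of _ s]) (auto simp: vec_last_def)
  ultimately show ?thesis by (simp add: bform_def sum_subtractf)
qed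

lemma Im_bform_self:
  assumes "x0 \<in> carrier_vec (r + s)" "x1 \<in> carrier_vec r"
  shows "Im (bform r s x0 x1 x0 x1) = (\<Sum>i<r. 2 * Im (x0 $ i * cnj (x1 $ i))) + (\<Sum>j<s. (cmod (x0 $ (r + j)))\<^sup>2)"
    and "Re (bform r s x0 x1 x0 x1) = 0"
proof -
  have "Im (\<Sum>i<r. x0 $ i * cnj (x1 $ i) - x1 $ i * cnj (x0 $ i)) = (\<Sum>i<r. 2 * Im (x0 $ i * cnj (x1 $ i)))"
    "Re (\<Sum>i<r. x0 $ i * cnj (x1 $ i) - x1 $ i * cnj (x0 $ i)) = 0"
    unfolding Im_sum Re_sum by (auto intro!: sum.cong sum.neutral simp: algebra_simps)
  moreover have "(\<Sum>j<s. x0 $ (r + j) * cnj (x0 $ (r + j))) = of_real (\<Sum>j<s. (cmod (x0 $ (r + j)))\<^sup>2)"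
    by (simp flip: complex_norm_square)
  ultimately show "Im (bform r s x0 x1 x0 x1) = (\<Sum>i<r. 2 * Im (x0 $ i * cnj (x1 $ i))) + (\<Sum>j<s. (cmod (x0 $ (r + j)))\<^sup>2)"
    "Re (bform r s x0 x1 x0 x1) = 0"
    using bform_eq_sum[of x0 r s x0 x1 x1] assms by simp_all
qed

lemma blk_carrier [simp]: "blk A i m j n \<in> carrier_mat m n"
  by (simp add: blk_def)

lemma adjoint_blk_first:
  assumes A: "A \<in> carrier_mat m (r + s)" and x: "x \<in> carrier_vec m"
  shows "mat_adjoint (blk A 0 m 0 r) *\<^sub>v x = vec_first (mat_adjoint A *\<^sub>v x) r"
proof (rule eq_vecI)
  fix i assume "i < dim_vec (vec_first (mat_adjoint A *\<^sub>v x) r)"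
  then have i: "i < r" by simp
  have "(mat_adjoint (blk A 0 m 0 r) *\<^sub>v x) $ i = (\<Sum>k<m. cnj (A $$ (k, i)) * x $ k)"
    using i x A by (subst mult_mat_vec_index_sum[of _ r m])
      (auto simp: mat_adjoint_index[of _ m r] blk_def intro!: sum.cong)
  also have "\<dots> = (mat_adjoint A *\<^sub>v x) $ i"
    using i x A by (subst mult_mat_vec_index_sum[of _ "r + s" m])
      (auto simp: mat_adjoint_index[of _ m "r + s"])
  finally show "(mat_adjoint (blk A 0 m 0 r) *\<^sub>v x) $ i = vec_first (mat_adjoint A *\<^sub>v x) r $ i"
    using i by (simp add: vec_first_def)
qed (simp add: blk_def)

lemma adjoint_blk_last:
  assumes A: "A \<in> carrier_mat m (r + s)" and x: "x \<in> carrier_vec m"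
  shows "mat_adjoint (blk A 0 m r s) *\<^sub>v x = vec_last (mat_adjoint A *\<^sub>v x) s"
proof (rule eq_vecI)
  fix i assume "i < dim_vec (vec_last (mat_adjoint A *\<^sub>v x) s)"
  then have i: "i < s" by simp
  have "(mat_adjoint (blk A 0 m r s) *\<^sub>v x) $ i = (\<Sum>k<m. cnj (A $$ (k, r + i)) * x $ k)"
    using i x A by (subst mult_mat_vec_index_sum[of _ s m])
      (auto simp: mat_adjoint_index[of _ m s] blk_def intro!: sum.cong)
  also have "\<dots> = (mat_adjoint A *\<^sub>v x) $ (r + i)"
    using i x A by (subst mult_mat_vec_index_sum[of _ "r + s" m])
      (auto simp: mat_adjoint_index[of _ m "r + s"])
  finally show "(mat_adjoint (blk A 0 m r s) *\<^sub>v x) $ i = vec_last (mat_adjoint A *\<^sub>v x) s $ i"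
    using i mat_adjoint_carrier[OF A] by (auto simp: vec_last_def)
qed (simp add: blk_def)

lemma Im_op_carrier: "M \<in> carrier_mat m m \<Longrightarrow> Im_op M \<in> carrier_mat m m"
  unfolding Im_op_def by (intro smult_carrier_mat minus_carrier_mat mat_adjoint_carrier)

lemma Im_op_cdot:
  assumes M: "M \<in> carrier_mat m m" and x: "x \<in> carrier_vec m"
  shows "(Im_op M *\<^sub>v x) \<bullet>c x = of_real (Im ((M *\<^sub>v x) \<bullet>c x))"
proof -
  have M': "mat_adjoint M \<in> carrier_mat m m" using M by simp
  have c: "M *\<^sub>v x \<in> carrier_vec m" "mat_adjoint M *\<^sub>v x \<in> carrier_vec m"
    by (rule mult_mat_vec_carrier[OF M x], rule mult_mat_vec_carrier[OF M' x])
  have "Im_op M *\<^sub>v x = (1 / (2 * \<i>)) \<cdot>\<^sub>v (M *\<^sub>v x - mat_adjoint M *\<^sub>v x)"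
    unfolding Im_op_def smult_mat_vec[OF minus_carrier_mat[OF M'] x]
      minus_mult_distrib_mat_vec[OF M M' x] ..
  moreover have "(mat_adjoint M *\<^sub>v x) \<bullet>c x = cnj ((M *\<^sub>v x) \<bullet>c x)"
    using cdot_adjoint[OF M x x] cdot_cnj[OF x c(2)] by simp
  ultimately have "(Im_op M *\<^sub>v x) \<bullet>c x = 1 / (2 * \<i>) * ((M *\<^sub>v x) \<bullet>c x - cnj ((M *\<^sub>v x) \<bullet>c x))"
    using cdot_smult_left[OF minus_carrier_vec[OF c] x] cdot_diff_left[OF c x] by metis
  then show ?thesis by (simp add: complex_eq_iff)
qed

text \<open>
  The sign conditions on a boundary parameter are conditions on \<open>Im \<beta>\<close> at the vectors
  \<open>(A\<^sub>0\<^sup>* x, A\<^sub>1\<^sup>* x)\<close>. This links them with \<open>\<beta>\<close> on the kernel of \<open>(A\<^sub>0, A\<^sub>1)\<close>.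
\<close>

lemma adjoint_form_eq_bform:
  assumes A0: "A0 \<in> carrier_mat m (r + s)" and A1: "A1 \<in> carrier_mat m r" and x: "x \<in> carrier_vec m"
  shows "((2 \<cdot>\<^sub>m Im_op (A1 * mat_adjoint (blk A0 0 m 0 r)) +
      blk A0 0 m r s * mat_adjoint (blk A0 0 m r s)) *\<^sub>v x) \<bullet>c x =
    of_real (Im (bform r s (mat_adjoint A0 *\<^sub>v x) (mat_adjoint A1 *\<^sub>v x) (mat_adjoint A0 *\<^sub>v x) (mat_adjoint A1 *\<^sub>v x)))"
proof -
  define a g where "a = mat_adjoint A0 *\<^sub>v x" and "g = mat_adjoint A1 *\<^sub>v x"
  have c: "a \<in> carrier_vec (r + s)" "g \<in> carrier_vec r"
    using mat_adjoint_carrier[OF A0] mat_adjoint_carrier[OF A1] x by (auto simp: a_def g_def)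
  let ?M = "A1 * mat_adjoint (blk A0 0 m 0 r)" and ?L = "blk A0 0 m r s"
  have a1: "mat_adjoint (blk A0 0 m 0 r) \<in> carrier_mat r m" "mat_adjoint ?L \<in> carrier_mat s m"
    by (rule mat_adjoint_carrier, simp)+
  have M: "?M \<in> carrier_mat m m" by (rule mult_carrier_mat[OF A1 a1(1)])
  note IM = Im_op_carrier[OF M]
  have L: "?L * mat_adjoint ?L \<in> carrier_mat m m" by (rule mult_carrier_mat[OF blk_carrier a1(2)])
  have c2: "Im_op ?M *\<^sub>v x \<in> carrier_vec m" "(?L * mat_adjoint ?L) *\<^sub>v x \<in> carrier_vec m"
    by (rule mult_mat_vec_carrier[OF IM x], rule mult_mat_vec_carrier[OF L x])
  have "(?M *\<^sub>v x) \<bullet>c x = (A1 *\<^sub>v vec_first a r) \<bullet>c x"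
    using assoc_mult_mat_vec[OF A1 a1(1) x] adjoint_blk_first[OF A0 x] by (simp add: a_def)
  also have "\<dots> = vec_first a r \<bullet>c g"
    using cdot_adjoint[OF A1 _ x] by (simp add: g_def)
  finally have 1: "(?M *\<^sub>v x) \<bullet>c x = vec_first a r \<bullet>c g" .
  have "((?L * mat_adjoint ?L) *\<^sub>v x) \<bullet>c x = (?L *\<^sub>v vec_last a s) \<bullet>c x"
    using assoc_mult_mat_vec[OF blk_carrier a1(2) x] adjoint_blk_last[OF A0 x] by (simp add: a_def)
  also have "\<dots> = vec_last a s \<bullet>c vec_last a s"
    using cdot_adjoint[OF blk_carrier _ x, of "vec_last a s" s] adjoint_blk_last[OF A0 x] by (simp add: a_def)
  also have "\<dots> = (\<Sum>j<s. a $ (r + j) * cnj (a $ (r + j)))"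
    using c by (subst cdot_eq_sum[of _ s]) (auto simp: vec_last_def)
  also have "\<dots> = of_real (\<Sum>j<s. (cmod (a $ (r + j)))\<^sup>2)" by (simp flip: complex_norm_square)
  finally have 2: "((?L * mat_adjoint ?L) *\<^sub>v x) \<bullet>c x = of_real (\<Sum>j<s. (cmod (a $ (r + j)))\<^sup>2)" .
  have "vec_first a r \<bullet>c g = (\<Sum>i<r. a $ i * cnj (g $ i))"
    using c by (simp add: cdot_eq_sum[of _ r] vec_first_def)
  then have 3: "2 * Im (vec_first a r \<bullet>c g) = (\<Sum>i<r. 2 * Im (a $ i * cnj (g $ i)))"
    by (simp add: Im_sum sum_distrib_left del: times_complex.sel)
  have "((2 \<cdot>\<^sub>m Im_op ?M + ?L * mat_adjoint ?L) *\<^sub>v x) \<bullet>c x =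
      2 * ((Im_op ?M *\<^sub>v x) \<bullet>c x) + ((?L * mat_adjoint ?L) *\<^sub>v x) \<bullet>c x"
    unfolding add_mult_distrib_mat_vec[OF smult_carrier_mat[OF IM] L x] smult_mat_vec[OF IM x]
      cdot_add_left[OF smult_carrier_vec[THEN iffD2, OF c2(1)] c2(2) x] cdot_smult_left[OF c2(1) x] ..
  also have "\<dots> = of_real (Im (bform r s a g a g))"
    unfolding Im_op_cdot[OF M x] 1 2 Im_bform_self(1)[OF c] 3[symmetric] by simp
  finally show ?thesis unfolding a_def g_def .
qed

lemma invertible_adjoint_solve:
  fixes X :: "complex mat"
  assumes inv: "invertible_mat X" and X: "X \<in> carrier_mat n n"
  obtains Y where "Y \<in> carrier_mat n n"
    "\<And>p. p \<in> carrier_vec n \<Longrightarrow> mat_adjoint X *\<^sub>v (Y *\<^sub>v p) = p"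
    "\<And>p. p \<in> carrier_vec n \<Longrightarrow> X *\<^sub>v p = 0\<^sub>v n \<Longrightarrow> p = 0\<^sub>v n"
proof -
  obtain B where B: "X * B = 1\<^sub>m n" "B * X = 1\<^sub>m (dim_row B)"
    using inv X unfolding invertible_mat_def inverts_mat_def by auto
  have Bc: "B \<in> carrier_mat n n"
    using arg_cong[OF B(1), of dim_col] arg_cong[OF B(2), of dim_col] X by auto
  have X': "mat_adjoint X \<in> carrier_mat n n" and B': "mat_adjoint B \<in> carrier_mat n n"
    using X Bc by auto
  have "mat_adjoint X *\<^sub>v (mat_adjoint B *\<^sub>v p) = p" if p: "p \<in> carrier_vec n" for p
  proof -
    have "mat_adjoint X * mat_adjoint B = 1\<^sub>m n"
    proof (rule mat_eqI_cdot)
      show "mat_adjoint X * mat_adjoint B \<in> carrier_mat n n" by (rule mult_carrier_mat[OF X' B'])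
      fix x y :: "complex vec" assume x: "x \<in> carrier_vec n" and y: "y \<in> carrier_vec n"
      have Bx: "mat_adjoint B *\<^sub>v x \<in> carrier_vec n" by (rule mult_mat_vec_carrier[OF B' x])
      have Xy: "X *\<^sub>v y \<in> carrier_vec n" by (rule mult_mat_vec_carrier[OF X y])
      have "(mat_adjoint X * mat_adjoint B *\<^sub>v x) \<bullet>c y = (mat_adjoint X *\<^sub>v (mat_adjoint B *\<^sub>v x)) \<bullet>c y"
        using assoc_mult_mat_vec[OF X' B' x] by simp
      also have "\<dots> = x \<bullet>c (B *\<^sub>v (X *\<^sub>v y))"
        using cdot_adjoint[OF X' Bx y] cdot_adjoint[OF B' x Xy] by simp
      also have "B *\<^sub>v (X *\<^sub>v y) = y" using assoc_mult_mat_vec[OF Bc X y] B(2) Bc y by simp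
      finally show "(mat_adjoint X * mat_adjoint B *\<^sub>v x) \<bullet>c y = (1\<^sub>m n *\<^sub>v x) \<bullet>c y" using x by simp
    qed simp
    then show ?thesis using assoc_mult_mat_vec[OF X' B' p] p by simp
  qed
  moreover have "p = 0\<^sub>v n" if p: "p \<in> carrier_vec n" "X *\<^sub>v p = 0\<^sub>v n" for p
  proof -
    have "p = B *\<^sub>v (X *\<^sub>v p)" using assoc_mult_mat_vec[OF Bc X p(1)] B(2) Bc p(1) by simp
    also have "\<dots> = 0\<^sub>v n" using p Bc by auto
    finally show ?thesis .
  qed
  ultimately show ?thesis using that[OF B'] by blast
qed

text \<open>
  The adjoint of \<open>C\<^sub>0 - \<i> C\<^sub>1 P\<close> maps \<open>x\<close> to the combination \<open>a + \<i> g\<close> of \<open>a = C\<^sub>0\<^sup>* x\<close> and \<open>g = C\<^sub>1\<^sup>* x\<close> on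
  \<open>\<H>\<^sub>b\<close>, and to \<open>a\<close> on the complement. Invertibility of the operator thus allows this combination to
  be prescribed.
\<close>

lemma adjoint_Cayley_index:
  assumes A0: "A0 \<in> carrier_mat m (r + s)" and A1: "A1 \<in> carrier_mat m r" and x: "x \<in> carrier_vec m"
    and i: "i < r + s"
  shows "(mat_adjoint (A0 - \<i> \<cdot>\<^sub>m (A1 * mat_of_op r (r + s) (\<lambda>x. vec_first x r))) *\<^sub>v x) $ i =
    (mat_adjoint A0 *\<^sub>v x) $ i + (if i < r then \<i> * (mat_adjoint A1 *\<^sub>v x) $ i else 0)"
proof -
  let ?P = "mat_of_op r (r + s) (\<lambda>x. vec_first x r)" and ?X = "A0 - \<i> \<cdot>\<^sub>m (A1 * mat_of_op r (r + s) (\<lambda>x. vec_first x r))"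
  have P: "?P \<in> carrier_mat r (r + s)" unfolding mat_of_op_def by (rule carrier_matI) simp_all
  have Pi: "?P $$ (l, i) = (if l = i then 1 else 0)" if "l < r" for l
    using i that by (auto simp: mat_of_op_def mat_of_cols_def vec_first_def unit_vec_def)
  have X: "?X \<in> carrier_mat m (r + s)"
    by (intro minus_carrier_mat smult_carrier_mat mult_carrier_mat[OF A1 P])
  have Xi: "?X $$ (k, i) = A0 $$ (k, i) - (if i < r then \<i> * A1 $$ (k, i) else 0)" if "k < m" for k
  proof -
    have "(A1 * ?P) $$ (k, i) = (\<Sum>l<r. A1 $$ (k, l) * ?P $$ (l, i))"
      using A1 P i that by (auto simp: scalar_prod_def atLeast0LessThan intro!: sum.cong)
    also have "\<dots> = (if i < r then A1 $$ (k, i) else 0)"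
      by (simp add: Pi if_distrib cong: if_cong)
    finally show ?thesis using A0 A1 P i that by auto
  qed
  have "(mat_adjoint ?X *\<^sub>v x) $ i = (\<Sum>k<m. cnj (?X $$ (k, i)) * x $ k)"
    unfolding mult_mat_vec_index_sum[OF mat_adjoint_carrier[OF X] x i]
    using i by (simp add: mat_adjoint_index[OF X])
  also have "\<dots> = (\<Sum>k<m. cnj (A0 $$ (k, i) - (if i < r then \<i> * A1 $$ (k, i) else 0)) * x $ k)"
    by (intro sum.cong) (simp_all only: Xi lessThan_iff)
  also have "\<dots> = (\<Sum>k<m. cnj (A0 $$ (k, i)) * x $ k) +
      (if i < r then \<i> * (\<Sum>k<m. cnj (A1 $$ (k, i)) * x $ k) else 0)"
    by (simp add: algebra_simps sum.distrib sum_distrib_left)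
  also have "(\<Sum>k<m. cnj (A0 $$ (k, i)) * x $ k) = (mat_adjoint A0 *\<^sub>v x) $ i"
    unfolding mult_mat_vec_index_sum[OF mat_adjoint_carrier[OF A0] x i]
    using i by (simp add: mat_adjoint_index[OF A0])
  also have "(if i < r then \<i> * (\<Sum>k<m. cnj (A1 $$ (k, i)) * x $ k) else 0) =
      (if i < r then \<i> * (mat_adjoint A1 *\<^sub>v x) $ i else 0)"
    using mult_mat_vec_index_sum[OF mat_adjoint_carrier[OF A1] x, of i]
    by (simp add: mat_adjoint_index[OF A1] del: index_mult_mat_vec)
  finally show ?thesis .
qed

lemma boundary_pairing:
  assumes A0: "A0 \<in> carrier_mat m (r + s)" and A1: "A1 \<in> carrier_mat m r" and x: "x \<in> carrier_vec m"
    and w0: "w0 \<in> carrier_vec (r + s)" and w1: "w1 \<in> carrier_vec r"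
  shows "(A0 *\<^sub>v w0 + A1 *\<^sub>v w1) \<bullet>c x =
    (\<Sum>i<r. w0 $ i * cnj ((mat_adjoint A0 *\<^sub>v x) $ i) + w1 $ i * cnj ((mat_adjoint A1 *\<^sub>v x) $ i)) +
    (\<Sum>j<s. w0 $ (r + j) * cnj ((mat_adjoint A0 *\<^sub>v x) $ (r + j)))"
proof -
  have "(A0 *\<^sub>v w0 + A1 *\<^sub>v w1) \<bullet>c x = w0 \<bullet>c (mat_adjoint A0 *\<^sub>v x) + w1 \<bullet>c (mat_adjoint A1 *\<^sub>v x)"
    unfolding cdot_adjoint[OF A0 w0 x, symmetric] cdot_adjoint[OF A1 w1 x, symmetric]
    by (rule cdot_add_left[OF mult_mat_vec_carrier[OF A0 w0] mult_mat_vec_carrier[OF A1 w1] x])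
  then show ?thesis
    unfolding cdot_eq_sum[OF adjoint_mult_carrier[OF A0 x]] cdot_eq_sum[OF adjoint_mult_carrier[OF A1 x]]
    by (simp add: sum_lessThan_add sum.distrib del: index_mult_mat_vec)
qed

text \<open>
  If \<open>(a, g)\<close> and \<open>(w\<^sub>0, w\<^sub>1)\<close> have the same combination \<open>a + \<i> g = w\<^sub>0 + \<i> w\<^sub>1\<close> on \<open>\<H>\<^sub>b\<close> and agree on its
  complement, then twice the real part of the pairing is \<open>Im \<beta>(w) + Im \<beta>(a, g)\<close> plus a square. On the
  kernel of \<open>(A\<^sub>0, A\<^sub>1)\<close> the pairing vanishes, so \<open>Im \<beta>(a, g) \<ge> 0\<close> forces \<open>Im \<beta>(w) \<le> 0\<close> there; off the
  kernel the error is linear in \<open>A\<^sub>0 w\<^sub>0 + A\<^sub>1 w\<^sub>1\<close>.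
\<close>

lemma dissipative_bform_upper:
  assumes A0: "A0 \<in> carrier_mat m (r + s)" and A1: "A1 \<in> carrier_mat m r" and x: "x \<in> carrier_vec m"
    and w0: "w0 \<in> carrier_vec (r + s)" and w1: "w1 \<in> carrier_vec r"
    and nn: "0 \<le> Im (bform r s (mat_adjoint A0 *\<^sub>v x) (mat_adjoint A1 *\<^sub>v x) (mat_adjoint A0 *\<^sub>v x) (mat_adjoint A1 *\<^sub>v x))"
    and eq: "\<And>i. i < r + s \<Longrightarrow> (mat_adjoint A0 *\<^sub>v x) $ i + (if i < r then \<i> * (mat_adjoint A1 *\<^sub>v x) $ i else 0)
      = w0 $ i + (if i < r then \<i> * w1 $ i else 0)"
  shows "Im (bform r s w0 w1 w0 w1) \<le> 2 * Re ((A0 *\<^sub>v w0 + A1 *\<^sub>v w1) \<bullet>c x)"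
proof -
  define a g where "a = mat_adjoint A0 *\<^sub>v x" and "g = mat_adjoint A1 *\<^sub>v x"
  note c = adjoint_mult_carrier[OF A0 x, folded a_def] adjoint_mult_carrier[OF A1 x, folded g_def]
  have e: "2 * Re ((A0 *\<^sub>v w0 + A1 *\<^sub>v w1) \<bullet>c x) =
      (\<Sum>i<r. 2 * Re (w0 $ i * cnj (a $ i) + w1 $ i * cnj (g $ i))) + (\<Sum>j<s. 2 * Re (w0 $ (r + j) * cnj (a $ (r + j))))"
    unfolding boundary_pairing[OF A0 A1 x w0 w1] a_def[symmetric] g_def[symmetric]
    by (simp add: Re_sum sum_distrib_left del: times_complex.sel)
  have 1: "2 * Im (w0 $ i * cnj (w1 $ i)) + 2 * Im (a $ i * cnj (g $ i))
      \<le> 2 * Re (w0 $ i * cnj (a $ i) + w1 $ i * cnj (g $ i))" if "i < r" for i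
  proof -
    have "a $ i = w0 $ i + \<i> * w1 $ i - \<i> * g $ i" using eq[of i] that by (simp add: a_def g_def eq_diff_eq)
    (* The square is that of (w0 - i w1 + a - i g) / 2. *)
    moreover have "2 * Re (w * cnj (w + \<i> * v - \<i> * u) + v * cnj u) = 2 * Im (w * cnj v)
        + 2 * Im ((w + \<i> * v - \<i> * u) * cnj u) + 2 * (cmod (w - \<i> * u))\<^sup>2" for w v u
      by (simp add: cmod_power2) (simp add: power2_eq_square algebra_simps)
    ultimately show ?thesis by simp
  qed
  have 2: "(cmod (w0 $ (r + j)))\<^sup>2 + (cmod (a $ (r + j)))\<^sup>2 = 2 * Re (w0 $ (r + j) * cnj (a $ (r + j)))" if "j < s" for j
  proof -
    have "a $ (r + j) = w0 $ (r + j)" using eq[of "r + j"] that by (simp add: a_def)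
    then show ?thesis by (simp add: cmod_power2) (simp add: power2_eq_square)
  qed
  have "Im (bform r s w0 w1 w0 w1) + Im (bform r s a g a g) \<le> 2 * Re ((A0 *\<^sub>v w0 + A1 *\<^sub>v w1) \<bullet>c x)"
  proof -
    have "(\<Sum>i<r. 2 * Im (w0 $ i * cnj (w1 $ i)) + 2 * Im (a $ i * cnj (g $ i)))
        \<le> (\<Sum>i<r. 2 * Re (w0 $ i * cnj (a $ i) + w1 $ i * cnj (g $ i)))"
      by (rule sum_mono) (use 1 in simp)
    moreover have "(\<Sum>j<s. (cmod (w0 $ (r + j)))\<^sup>2 + (cmod (a $ (r + j)))\<^sup>2) =
        (\<Sum>j<s. 2 * Re (w0 $ (r + j) * cnj (a $ (r + j))))"
      by (rule sum.cong) (use 2 in simp_all)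
    ultimately show ?thesis
      unfolding e Im_bform_self(1)[OF w0 w1] Im_bform_self(1)[OF c] sum.distrib by linarith
  qed
  then show ?thesis using nn by (simp add: a_def g_def)
qed

text \<open>
  The same argument with \<open>a - \<i> g = w\<^sub>0 - \<i> w\<^sub>1\<close> and with signs reversed. On the complement of \<open>\<H>\<^sub>b\<close>, where
  \<open>a\<close> and \<open>w\<^sub>0\<close> are unrelated, the pairing is completed to a square.
\<close>

lemma dissipative_bform_lower:
  assumes A0: "A0 \<in> carrier_mat m (r + s)" and A1: "A1 \<in> carrier_mat m r" and x: "x \<in> carrier_vec m"
    and w0: "w0 \<in> carrier_vec (r + s)" and w1: "w1 \<in> carrier_vec r"
    and np: "Im (bform r s (mat_adjoint A0 *\<^sub>v x) (mat_adjoint A1 *\<^sub>v x) (mat_adjoint A0 *\<^sub>v x) (mat_adjoint A1 *\<^sub>v x)) \<le> 0"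
    and eq: "\<And>i. i < r \<Longrightarrow> (mat_adjoint A0 *\<^sub>v x) $ i - \<i> * (mat_adjoint A1 *\<^sub>v x) $ i = w0 $ i - \<i> * w1 $ i"
  shows "- Im (bform r s w0 w1 w0 w1) \<le> 2 * Re ((A0 *\<^sub>v w0 + A1 *\<^sub>v w1) \<bullet>c x)"
proof -
  define a g where "a = mat_adjoint A0 *\<^sub>v x" and "g = mat_adjoint A1 *\<^sub>v x"
  note c = adjoint_mult_carrier[OF A0 x, folded a_def] adjoint_mult_carrier[OF A1 x, folded g_def]
  have e: "2 * Re ((A0 *\<^sub>v w0 + A1 *\<^sub>v w1) \<bullet>c x) =
      (\<Sum>i<r. 2 * Re (w0 $ i * cnj (a $ i) + w1 $ i * cnj (g $ i))) + (\<Sum>j<s. 2 * Re (w0 $ (r + j) * cnj (a $ (r + j))))"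
    unfolding boundary_pairing[OF A0 A1 x w0 w1] a_def[symmetric] g_def[symmetric]
    by (simp add: Re_sum sum_distrib_left del: times_complex.sel)
  have 1: "- (2 * Im (w0 $ i * cnj (w1 $ i))) - 2 * Im (a $ i * cnj (g $ i))
      \<le> 2 * Re (w0 $ i * cnj (a $ i) + w1 $ i * cnj (g $ i))" if "i < r" for i
  proof -
    have "a $ i = w0 $ i - \<i> * w1 $ i + \<i> * g $ i" using eq[of i] that by (simp add: a_def g_def algebra_simps)
    (* The square is that of (w0 + i w1 + a + i g) / 2. *)
    moreover have "2 * Re (w * cnj (w - \<i> * v + \<i> * u) + v * cnj u) = - (2 * Im (w * cnj v))
        - 2 * Im ((w - \<i> * v + \<i> * u) * cnj u) + 2 * (cmod (w + \<i> * u))\<^sup>2" for w v u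
      by (simp add: cmod_power2) (simp add: power2_eq_square algebra_simps)
    ultimately show ?thesis by simp
  qed
  have 2: "- (cmod (w0 $ (r + j)))\<^sup>2 - (cmod (a $ (r + j)))\<^sup>2 \<le> 2 * Re (w0 $ (r + j) * cnj (a $ (r + j)))" for j
  proof -
    have "2 * Re (w * cnj u) = (cmod (w + u))\<^sup>2 - (cmod w)\<^sup>2 - (cmod u)\<^sup>2" for w u
      by (simp add: cmod_power2) (simp add: power2_eq_square algebra_simps)
    then show ?thesis by simp
  qed
  have "- Im (bform r s w0 w1 w0 w1) - Im (bform r s a g a g) \<le> 2 * Re ((A0 *\<^sub>v w0 + A1 *\<^sub>v w1) \<bullet>c x)"
  proof -
    have "(\<Sum>i<r. - (2 * Im (w0 $ i * cnj (w1 $ i))) - 2 * Im (a $ i * cnj (g $ i)))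
        \<le> (\<Sum>i<r. 2 * Re (w0 $ i * cnj (a $ i) + w1 $ i * cnj (g $ i)))"
      by (rule sum_mono) (use 1 in simp)
    moreover have "(\<Sum>j<s. - (cmod (w0 $ (r + j)))\<^sup>2 - (cmod (a $ (r + j)))\<^sup>2) \<le>
        (\<Sum>j<s. 2 * Re (w0 $ (r + j) * cnj (a $ (r + j))))"
      by (rule sum_mono) (use 2 in simp)
    ultimately show ?thesis
      unfolding e Im_bform_self(1)[OF w0 w1] Im_bform_self(1)[OF c] sum.distrib sum_subtractf sum_negf
      by linarith
  qed
  then show ?thesis using np by (simp add: a_def g_def)
qed

text \<open>
  The vectors \<open>(g, - \<i> a\<^sub>2; - a\<^sub>1)\<close> built from \<open>a = A\<^sub>0\<^sup>* x\<close>, \<open>g = A\<^sub>1\<^sup>* x\<close> (with \<open>a\<^sub>1\<close>, \<open>a\<^sub>2\<close> the parts of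
  \<open>a\<close> in \<open>\<H>\<^sub>b\<close> and in its complement) are those on which \<open>\<beta>\<close> factors through \<open>A\<^sub>0 y\<^sub>0 + A\<^sub>1 y\<^sub>1\<close>.
\<close>

lemma bform_adjoint_pair:
  assumes A0: "A0 \<in> carrier_mat m (r + s)" and A1: "A1 \<in> carrier_mat m r" and x: "x \<in> carrier_vec m"
    and y0: "y0 \<in> carrier_vec (r + s)" and y1: "y1 \<in> carrier_vec r"
    and z0: "z0 \<in> carrier_vec (r + s)" and z1: "z1 \<in> carrier_vec r"
    and eq1: "\<And>i. i < r \<Longrightarrow> z0 $ i = (mat_adjoint A1 *\<^sub>v x) $ i"
    and eq2: "\<And>i. i < r \<Longrightarrow> z1 $ i = - (mat_adjoint A0 *\<^sub>v x) $ i"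
    and eq3: "\<And>j. j < s \<Longrightarrow> z0 $ (r + j) = - \<i> * (mat_adjoint A0 *\<^sub>v x) $ (r + j)"
  shows "bform r s y0 y1 z0 z1 = - ((A0 *\<^sub>v y0 + A1 *\<^sub>v y1) \<bullet>c x)"
proof -
  define a g where "a = mat_adjoint A0 *\<^sub>v x" and "g = mat_adjoint A1 *\<^sub>v x"
  note c = adjoint_mult_carrier[OF A0 x, folded a_def] adjoint_mult_carrier[OF A1 x, folded g_def]
  have "(A0 *\<^sub>v y0 + A1 *\<^sub>v y1) \<bullet>c x =
      (\<Sum>i<r. y0 $ i * cnj (a $ i) + y1 $ i * cnj (g $ i)) + (\<Sum>j<s. y0 $ (r + j) * cnj (a $ (r + j)))"
    unfolding boundary_pairing[OF A0 A1 x y0 y1] a_def g_def ..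
  also have "\<dots> = - bform r s y0 y1 z0 z1"
    unfolding bform_eq_sum[OF y0 z0 y1 z1]
    using eq1 eq2 eq3 by (simp add: a_def[symmetric] g_def[symmetric] sum_negf sum_distrib_left algebra_simps
        sum.distrib sum_subtractf)
  finally show ?thesis by simp
qed

text \<open>
  Every element of the kernel of \<open>(E\<^sub>0, E\<^sub>1)\<close> has the form required in \<open>bform_adjoint_pair\<close>. The
  compatibility relation says that the vector \<open>k\<close> of that form, built from \<open>x\<close>, lies in the kernel. The
  equation for \<open>x\<close> makes \<open>k\<close> agree with \<open>z\<close> on the complement of \<open>\<H>\<^sub>b\<close> and in the combination
  \<open>z\<^sub>0 + \<i> z\<^sub>1\<close> on \<open>\<H>\<^sub>b\<close>, and an element of the kernel is determined by these data because \<open>E\<^sub>0\<^sub>1 + \<i> E\<^sub>1\<close> is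
  injective.
\<close>

lemma adjoint_kernel_representation:
  assumes A0: "A0 \<in> carrier_mat m (r + s)" and A1: "A1 \<in> carrier_mat m r" and x: "x \<in> carrier_vec m"
    and E0: "E0 \<in> carrier_mat r (r + s)" and E1: "E1 \<in> carrier_mat r r"
    and compat: "A1 * mat_adjoint (blk E0 0 r 0 r) - blk A0 0 m 0 r * mat_adjoint E1 +
       \<i> \<cdot>\<^sub>m (blk A0 0 m r s * mat_adjoint (blk E0 0 r r s)) = 0\<^sub>m m r"
    and inj: "\<And>p. p \<in> carrier_vec r \<Longrightarrow> (blk E0 0 r 0 r + \<i> \<cdot>\<^sub>m E1) *\<^sub>v p = 0\<^sub>v r \<Longrightarrow> p = 0\<^sub>v r"
    and z0: "z0 \<in> carrier_vec (r + s)" and z1: "z1 \<in> carrier_vec r"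
    and ker: "E0 *\<^sub>v z0 + E1 *\<^sub>v z1 = 0\<^sub>v r"
    and eq: "\<And>i. i < r + s \<Longrightarrow> (mat_adjoint A0 *\<^sub>v x) $ i + (if i < r then \<i> * (mat_adjoint A1 *\<^sub>v x) $ i else 0)
      = \<i> * (z0 $ i + (if i < r then \<i> * z1 $ i else 0))"
  shows "\<And>i. i < r \<Longrightarrow> z0 $ i = (mat_adjoint A1 *\<^sub>v x) $ i"
    and "\<And>i. i < r \<Longrightarrow> z1 $ i = - (mat_adjoint A0 *\<^sub>v x) $ i"
    and "\<And>j. j < s \<Longrightarrow> z0 $ (r + j) = - \<i> * (mat_adjoint A0 *\<^sub>v x) $ (r + j)"
proof -
  define a g where "a = mat_adjoint A0 *\<^sub>v x" and "g = mat_adjoint A1 *\<^sub>v x"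
  note c = adjoint_mult_carrier[OF A0 x, folded a_def] adjoint_mult_carrier[OF A1 x, folded g_def]
  define k0 where "k0 = vec (r + s) (\<lambda>i. if i < r then g $ i else - \<i> * a $ i)"
  define k1 where "k1 = vec r (\<lambda>i. - a $ i)"
  have k: "k0 \<in> carrier_vec (r + s)" "k1 \<in> carrier_vec r" by (auto simp: k0_def k1_def)
  let ?E01 = "blk E0 0 r 0 r" and ?E02 = "blk E0 0 r r s" and ?A01 = "blk A0 0 m 0 r" and ?A02 = "blk A0 0 m r s"
  have kk: "E0 *\<^sub>v k0 + E1 *\<^sub>v k1 \<in> carrier_vec r"
    by (intro add_carrier_vec mult_mat_vec_carrier[OF E0 k(1)] mult_mat_vec_carrier[OF E1 k(2)])
  have difference_of_zeros: "(A - C) + (B - D) = 0" if "A + X + B = 0" "C + Y + D = 0" "X = Y"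
    for A B C D X Y :: complex
  proof -
    have "(A + X + B) - (C + Y + D) = 0" using that(1,2) by simp
    then show ?thesis using that(3) by (simp add: algebra_simps)
  qed
  have orth: "(E0 *\<^sub>v k0 + E1 *\<^sub>v k1) \<bullet>c v = 0" if v: "v \<in> carrier_vec r" for v
  proof -
    define e f where "e = mat_adjoint E0 *\<^sub>v v" and "f = mat_adjoint E1 *\<^sub>v v"
    have ef: "e \<in> carrier_vec (r + s)" "f \<in> carrier_vec r"
      unfolding e_def f_def
      by (rule adjoint_mult_carrier[OF E0 v],
          rule adjoint_mult_carrier[OF E1 v])
    have e12: "mat_adjoint ?E01 *\<^sub>v v = vec_first e r" "mat_adjoint ?E02 *\<^sub>v v = vec_last e s"
      unfolding e_def by (rule adjoint_blk_first[OF E0 v], rule adjoint_blk_last[OF E0 v])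
    have cm: "mat_adjoint ?E01 \<in> carrier_mat r r" "mat_adjoint ?E02 \<in> carrier_mat s r"
      "mat_adjoint E1 \<in> carrier_mat r r"
      using E1 by (auto intro: mat_adjoint_carrier)
    note p1 = mult_carrier_mat[OF A1 cm(1)]
    have p2: "?A01 * mat_adjoint E1 \<in> carrier_mat m r" by (rule mult_carrier_mat[OF blk_carrier cm(3)])
    have p3: "?A02 * mat_adjoint ?E02 \<in> carrier_mat m r" by (rule mult_carrier_mat[OF blk_carrier cm(2)])
    have q: "A1 *\<^sub>v vec_first e r \<in> carrier_vec m" "?A01 *\<^sub>v f \<in> carrier_vec m" "?A02 *\<^sub>v vec_last e s \<in> carrier_vec m"
      by (rule mult_mat_vec_carrier[OF A1], simp) (rule mult_mat_vec_carrier[OF blk_carrier], use ef in simp)+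
    have "0 = x \<bullet>c (0\<^sub>m m r *\<^sub>v v)"
      by (subst cdot_eq_sum[OF mult_mat_vec_carrier[OF zero_carrier_mat v]])
        (simp add: mult_mat_vec_index_sum[OF zero_carrier_mat v] del: index_mult_mat_vec)
    also have "0\<^sub>m m r *\<^sub>v v = (A1 *\<^sub>v vec_first e r - ?A01 *\<^sub>v f) + \<i> \<cdot>\<^sub>v (?A02 *\<^sub>v vec_last e s)"
      unfolding compat[symmetric] add_mult_distrib_mat_vec[OF minus_carrier_mat[OF p2] smult_carrier_mat[OF p3] v]
        minus_mult_distrib_mat_vec[OF p1 p2 v] smult_mat_vec[OF p3 v]
        assoc_mult_mat_vec[OF A1 cm(1) v] assoc_mult_mat_vec[OF blk_carrier cm(3) v]
        assoc_mult_mat_vec[OF blk_carrier cm(2) v] e12 f_def[symmetric] ..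
    also have "x \<bullet>c \<dots> = cnj (((A1 *\<^sub>v vec_first e r - ?A01 *\<^sub>v f) + \<i> \<cdot>\<^sub>v (?A02 *\<^sub>v vec_last e s)) \<bullet>c x)"
      using q x by (intro cdot_cnj[symmetric, of _ m]) auto
    also have "((A1 *\<^sub>v vec_first e r - ?A01 *\<^sub>v f) + \<i> \<cdot>\<^sub>v (?A02 *\<^sub>v vec_last e s)) \<bullet>c x =
        (A1 *\<^sub>v vec_first e r) \<bullet>c x - (?A01 *\<^sub>v f) \<bullet>c x + \<i> * ((?A02 *\<^sub>v vec_last e s) \<bullet>c x)"
      using q x by (simp add: cdot_add_left[of _ m] cdot_diff_left[of _ m] cdot_smult_left[of _ m])
    also have "(A1 *\<^sub>v vec_first e r) \<bullet>c x = vec_first e r \<bullet>c g"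
      unfolding g_def by (rule cdot_adjoint[OF A1 _ x]) simp
    also have "(?A01 *\<^sub>v f) \<bullet>c x = f \<bullet>c vec_first a r"
      unfolding a_def adjoint_blk_first[OF A0 x, symmetric] by (rule cdot_adjoint[OF blk_carrier ef(2) x])
    also have "(?A02 *\<^sub>v vec_last e s) \<bullet>c x = vec_last e s \<bullet>c vec_last a s"
      unfolding a_def adjoint_blk_last[OF A0 x, symmetric] by (rule cdot_adjoint[OF blk_carrier _ x]) simp
    also have "cnj (vec_first e r \<bullet>c g - f \<bullet>c vec_first a r + \<i> * (vec_last e s \<bullet>c vec_last a s)) =
        (\<Sum>i<r. g $ i * cnj (e $ i)) - (\<Sum>i<r. a $ i * cnj (f $ i)) - \<i> * (\<Sum>j<s. a $ (r + j) * cnj (e $ (r + j)))"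
      using c ef by (simp add: cdot_eq_sum[of _ r] cdot_eq_sum[of _ s] vec_first_def vec_last_def mult.commute)
    also have "\<dots> = k0 \<bullet>c e + k1 \<bullet>c f"
      unfolding cdot_eq_sum[OF ef(1)] cdot_eq_sum[OF ef(2)] sum_lessThan_add
      by (simp add: k0_def k1_def sum_negf sum_distrib_left mult.assoc)
    also have "\<dots> = (E0 *\<^sub>v k0 + E1 *\<^sub>v k1) \<bullet>c v"
      unfolding e_def f_def cdot_adjoint[OF E0 k(1) v, symmetric] cdot_adjoint[OF E1 k(2) v, symmetric]
      by (rule cdot_add_left[symmetric, OF mult_mat_vec_carrier[OF E0 k(1)] mult_mat_vec_carrier[OF E1 k(2)] v])
    finally show ?thesis ..
  qed
  have k_ker: "E0 *\<^sub>v k0 + E1 *\<^sub>v k1 = 0\<^sub>v r"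
    using orth[OF kk] conjugate_square_eq_0_vec[OF kk] by simp
  (* The difference of z and k is (p, 0; i p), so the kernel equation reads (E01 + i E1) p = 0. *)
  define p where "p = vec r (\<lambda>i. z0 $ i - k0 $ i)"
  have p_c: "p \<in> carrier_vec r" by (simp add: p_def)
  have lst: "z0 $ (r + j) = k0 $ (r + j)" if "j < s" for j
    using eq[of "r + j"] that by (simp add: k0_def a_def[symmetric] g_def[symmetric])
  have snd: "z1 $ i - k1 $ i = \<i> * p $ i" if "i < r" for i
  proof -
    have "a $ i + \<i> * g $ i = \<i> * (z0 $ i + \<i> * z1 $ i)"
      using eq[of i] that by (simp add: a_def[symmetric] g_def[symmetric])
    then have "z1 $ i + a $ i = \<i> * (z0 $ i - g $ i)" by (simp add: algebra_simps)
    then show ?thesis using that by (simp add: k0_def k1_def p_def)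
  qed
  have "(blk E0 0 r 0 r + \<i> \<cdot>\<^sub>m E1) *\<^sub>v p = 0\<^sub>v r"
  proof (rule eq_vecI)
    fix i assume "i < dim_vec (0\<^sub>v r :: complex vec)"
    then have i: "i < r" by simp
    have "(\<Sum>j<r + s. E0 $$ (i, j) * z0 $ j) + (\<Sum>j<r. E1 $$ (i, j) * z1 $ j) = 0"
      using arg_cong[OF ker, of "\<lambda>v. v $ i"] i E1
      by (simp add: mult_mat_vec_index_sum[OF E0 z0 i] mult_mat_vec_index_sum[OF E1 z1 i] del: index_mult_mat_vec)
    moreover have "(\<Sum>j<r + s. E0 $$ (i, j) * k0 $ j) + (\<Sum>j<r. E1 $$ (i, j) * k1 $ j) = 0"
      using arg_cong[OF k_ker, of "\<lambda>v. v $ i"] i E1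
      by (simp add: mult_mat_vec_index_sum[OF E0 k(1) i] mult_mat_vec_index_sum[OF E1 k(2) i] del: index_mult_mat_vec)
    moreover have "(\<Sum>j<s. E0 $$ (i, r + j) * z0 $ (r + j)) = (\<Sum>j<s. E0 $$ (i, r + j) * k0 $ (r + j))"
      by (intro sum.cong) (simp_all add: lst)
    ultimately have "(\<Sum>j<r. E0 $$ (i, j) * (z0 $ j - k0 $ j)) + (\<Sum>j<r. E1 $$ (i, j) * (z1 $ j - k1 $ j)) = 0"
      unfolding right_diff_distrib sum_subtractf sum_lessThan_add by (rule difference_of_zeros)
    moreover have "(\<Sum>j<r. E0 $$ (i, j) * (z0 $ j - k0 $ j)) = (\<Sum>j<r. E0 $$ (i, j) * p $ j)"
      by (intro sum.cong) (simp_all add: p_def)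
    moreover have "(\<Sum>j<r. E1 $$ (i, j) * (z1 $ j - k1 $ j)) = (\<Sum>j<r. E1 $$ (i, j) * (\<i> * p $ j))"
      by (intro sum.cong) (simp_all add: snd)
    ultimately have "(\<Sum>j<r. (E0 $$ (i, j) + \<i> * E1 $$ (i, j)) * p $ j) = 0"
      by (simp add: algebra_simps sum.distrib)
    moreover have "((blk E0 0 r 0 r + \<i> \<cdot>\<^sub>m E1) *\<^sub>v p) $ i =
        (\<Sum>j<r. (E0 $$ (i, j) + \<i> * E1 $$ (i, j)) * p $ j)"
      using i E1 by (subst mult_mat_vec_index_sum[OF _ p_c i]) (auto simp: blk_def intro!: sum.cong)
    ultimately show "((blk E0 0 r 0 r + \<i> \<cdot>\<^sub>m E1) *\<^sub>v p) $ i = 0\<^sub>v r $ i"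
      using i by simp
  qed (use E1 in simp)
  from inj[OF p_c this] have p0: "p $ i = 0" if "i < r" for i using that by simp
  show "z0 $ i = (mat_adjoint A1 *\<^sub>v x) $ i" if "i < r" for i
    using p0[OF that] that by (simp add: p_def k0_def g_def[symmetric])
  show "z1 $ i = - (mat_adjoint A0 *\<^sub>v x) $ i" if "i < r" for i
    using snd[OF that] p0[OF that] that by (simp add: k1_def a_def[symmetric] eq_neg_iff_add_eq_0)
  show "z0 $ (r + j) = - \<i> * (mat_adjoint A0 *\<^sub>v x) $ (r + j)" if "j < s" for j
    using lst[OF that] that by (simp add: k0_def a_def[symmetric])
qed

section \<open>Linearity of the maximal relation\<close>

lemma vec_add_diff_add:
  fixes u v u' v' :: "complex vec"
  assumes "u \<in> carrier_vec n" "v \<in> carrier_vec n" "u' \<in> carrier_vec n" "v' \<in> carrier_vec n"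
  shows "(u + v) - (u' + v') = (u - u') + (v - v')"
  using assms by (intro eq_vecI) auto

lemma vec_smult_diff:
  fixes u v :: "complex vec"
  assumes "u \<in> carrier_vec n" "v \<in> carrier_vec n"
  shows "k \<cdot>\<^sub>v u - k \<cdot>\<^sub>v v = k \<cdot>\<^sub>v (u - v)"
  using assms by (intro eq_vecI) (auto simp: right_diff_distrib)

lemma has_vec_deriv_add:
  assumes "\<And>t. y t \<in> carrier_vec n" "\<And>t. z t \<in> carrier_vec n"
    and "has_vec_deriv n y d t" "has_vec_deriv n z e t"
  shows "has_vec_deriv n (\<lambda>t. y t + z t) (d + e) t"
proof -
  note index_add_fun[where z = z, OF assms(2)]
  moreover have de: "d \<in> carrier_vec n" "e \<in> carrier_vec n" using assms(3,4) by (auto simp: has_vec_deriv_def)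
  moreover have "(d + e) $ i = d $ i + e $ i" if "i < n" for i using de that by simp
  ultimately show ?thesis using assms(3,4) unfolding has_vec_deriv_def
    by (auto simp del: index_add_vec(1) intro!: has_vector_derivative_add)
qed

lemma has_vec_deriv_smult:
  assumes "\<And>t. y t \<in> carrier_vec n" and "has_vec_deriv n y d t"
  shows "has_vec_deriv n (\<lambda>t. c \<cdot>\<^sub>v y t) (c \<cdot>\<^sub>v d) t"
proof -
  have "(\<lambda>s. (c \<cdot>\<^sub>v y s) $ i) = (\<lambda>s. c * y s $ i)" if "i < n" for i
    using assms(1) that by (intro ext index_smult_vec(1)) (metis carrier_vecD)
  moreover have d: "d \<in> carrier_vec n" using assms(2) by (auto simp: has_vec_deriv_def)
  moreover have "(c \<cdot>\<^sub>v d) $ i = c * d $ i" if "i < n" for i using d that by simp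
  ultimately show ?thesis using assms(2) unfolding has_vec_deriv_def
    by (auto simp del: index_smult_vec(1) intro!: has_vector_derivative_mult_right)
qed

lemma AC_add:
  assumes "y \<in> AC S" "z \<in> AC S"
  shows "(\<lambda>t. y t + z t) \<in> AC S"
  using assms index_add_fun[where z = z, OF AC_carrier[OF assms(2)]]
  by (auto simp: AC_def simp del: index_add_vec(1) intro!: ac_on_add)

lemma AC_smult:
  assumes "y \<in> AC S"
  shows "(\<lambda>t. c \<cdot>\<^sub>v y t) \<in> AC S"
  using assms index_smult_fun[where y = y, OF AC_carrier[OF assms]]
  by (auto simp: AC_def simp del: index_smult_vec(1) intro!: ac_on_mult ac_on_const)

context symmetric_sys
begin

lemma coefB_carrier: "t \<in> ival S \<Longrightarrow> coefB S t \<in> carrier_mat N N"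
  using sys by (auto simp: symmetric_system_def)

lemma Tmax_fun_add:
  assumes yf: "(y, f) \<in> Tmax_fun S" and zg: "(z, g) \<in> Tmax_fun S"
  shows "(\<lambda>t. y t + z t, \<lambda>t. f t + g t) \<in> Tmax_fun S"
proof -
  have y: "y \<in> AC S" "y \<in> L2fun S" "f \<in> L2fun S" "sys_eq S y f"
    and z: "z \<in> AC S" "z \<in> L2fun S" "g \<in> L2fun S" "sys_eq S z g"
    using yf zg by (auto simp: Tmax_fun_def)
  have "AE t in lborel. t \<in> ival S \<longrightarrow> (\<exists>d. has_vec_deriv N (\<lambda>t. y t + z t) d t \<and>
     Jmat S *\<^sub>v d - coefB S t *\<^sub>v (y t + z t) = weight S t *\<^sub>v (f t + g t))"
    using y(4) z(4) unfolding sys_eq_def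
  proof eventually_elim
    case (elim t)
    show ?case
    proof
      assume t: "t \<in> ival S"
      obtain d where d: "has_vec_deriv N y d t" "Jmat S *\<^sub>v d - coefB S t *\<^sub>v y t = weight S t *\<^sub>v f t"
        using elim t by auto
      obtain e where e: "has_vec_deriv N z e t" "Jmat S *\<^sub>v e - coefB S t *\<^sub>v z t = weight S t *\<^sub>v g t"
        using elim t by auto
      have c: "d \<in> carrier_vec N" "e \<in> carrier_vec N" using d e by (auto simp: has_vec_deriv_def)
      note B = coefB_carrier[OF t] and W = weight_carrier[OF t]
      note yc = AC_carrier[OF y(1), of t] AC_carrier[OF z(1), of t] L2fun_carrier[OF y(3), of t] L2fun_carrier[OF z(3), of t]
      have v: "Jmat S *\<^sub>v d \<in> carrier_vec N" "Jmat S *\<^sub>v e \<in> carrier_vec N"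
        "coefB S t *\<^sub>v y t \<in> carrier_vec N" "coefB S t *\<^sub>v z t \<in> carrier_vec N"
        using c B yc by (auto intro: mult_mat_vec_carrier[OF Jmat_carrier])
      have "Jmat S *\<^sub>v (d + e) - coefB S t *\<^sub>v (y t + z t) =
          (Jmat S *\<^sub>v d + Jmat S *\<^sub>v e) - (coefB S t *\<^sub>v y t + coefB S t *\<^sub>v z t)"
        unfolding mult_add_distrib_mat_vec[OF Jmat_carrier c] mult_add_distrib_mat_vec[OF B yc(1,2)] ..
      also have "\<dots> = (Jmat S *\<^sub>v d - coefB S t *\<^sub>v y t) + (Jmat S *\<^sub>v e - coefB S t *\<^sub>v z t)"
        by (rule vec_add_diff_add[OF v])
      also have "\<dots> = weight S t *\<^sub>v (f t + g t)"
        unfolding d(2) e(2) mult_add_distrib_mat_vec[OF W yc(3,4)] ..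
      finally show "\<exists>d. has_vec_deriv N (\<lambda>t. y t + z t) d t \<and>
          Jmat S *\<^sub>v d - coefB S t *\<^sub>v (y t + z t) = weight S t *\<^sub>v (f t + g t)"
        using has_vec_deriv_add[OF AC_carrier[OF y(1)] AC_carrier[OF z(1)] d(1) e(1)] by blast
    qed
  qed
  then show ?thesis using y z by (simp add: Tmax_fun_def sys_eq_def AC_add L2fun_add)
qed

lemma Tmax_fun_smult:
  assumes yf: "(y, f) \<in> Tmax_fun S"
  shows "(\<lambda>t. k \<cdot>\<^sub>v y t, \<lambda>t. k \<cdot>\<^sub>v f t) \<in> Tmax_fun S"
proof -
  have y: "y \<in> AC S" "y \<in> L2fun S" "f \<in> L2fun S" "sys_eq S y f"
    using yf by (auto simp: Tmax_fun_def)
  have "AE t in lborel. t \<in> ival S \<longrightarrow> (\<exists>d. has_vec_deriv N (\<lambda>t. k \<cdot>\<^sub>v y t) d t \<and>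
     Jmat S *\<^sub>v d - coefB S t *\<^sub>v (k \<cdot>\<^sub>v y t) = weight S t *\<^sub>v (k \<cdot>\<^sub>v f t))"
    using y(4) unfolding sys_eq_def
  proof eventually_elim
    case (elim t)
    show ?case
    proof
      assume t: "t \<in> ival S"
      obtain d where d: "has_vec_deriv N y d t" "Jmat S *\<^sub>v d - coefB S t *\<^sub>v y t = weight S t *\<^sub>v f t"
        using elim t by auto
      have c: "d \<in> carrier_vec N" using d by (auto simp: has_vec_deriv_def)
      note B = coefB_carrier[OF t] and W = weight_carrier[OF t]
      note yc = AC_carrier[OF y(1), of t] L2fun_carrier[OF y(3), of t]
      have v: "Jmat S *\<^sub>v d \<in> carrier_vec N" "coefB S t *\<^sub>v y t \<in> carrier_vec N"
        using c B yc by (auto intro: mult_mat_vec_carrier[OF Jmat_carrier])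
      have "Jmat S *\<^sub>v (k \<cdot>\<^sub>v d) - coefB S t *\<^sub>v (k \<cdot>\<^sub>v y t) =
          k \<cdot>\<^sub>v (Jmat S *\<^sub>v d) - k \<cdot>\<^sub>v (coefB S t *\<^sub>v y t)"
        unfolding mult_mat_vec[OF Jmat_carrier c] mult_mat_vec[OF B yc(1)] ..
      also have "\<dots> = k \<cdot>\<^sub>v (Jmat S *\<^sub>v d - coefB S t *\<^sub>v y t)"
        by (rule vec_smult_diff[OF v])
      also have "\<dots> = weight S t *\<^sub>v (k \<cdot>\<^sub>v f t)"
        unfolding d(2) mult_mat_vec[OF W yc(2)] ..
      finally show "\<exists>d. has_vec_deriv N (\<lambda>t. k \<cdot>\<^sub>v y t) d t \<and>
          Jmat S *\<^sub>v d - coefB S t *\<^sub>v (k \<cdot>\<^sub>v y t) = weight S t *\<^sub>v (k \<cdot>\<^sub>v f t)"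
        using has_vec_deriv_smult[OF AC_carrier[OF y(1)] d(1)] by blast
    qed
  qed
  then show ?thesis using y by (simp add: Tmax_fun_def sys_eq_def AC_smult L2fun_smult)
qed

end

section \<open>Boundary values of the solutions\<close>

locale boundary_problem = symmetric_sys S for S +
  fixes U Ut :: "complex mat" and r s :: nat
    and G0b Ghb G1b :: "(real \<Rightarrow> complex vec) \<Rightarrow> complex vec"
    and C0 C1 D0 D1 :: "complex \<Rightarrow> complex mat"
    and v :: "complex \<Rightarrow> real \<Rightarrow> complex mat"
  assumes bnd_a: "boundary_op_a S U Ut"
    and bnd_b: "boundary_map_b S r s G0b Ghb G1b"
    and param: "boundary_parameter r s C0 C1 D0 D1"
    and v_tau: "\<And>\<zeta>. Im \<zeta> \<noteq> 0 \<Longrightarrow> is_v_tau S Ut r s G0b Ghb G1b C0 C1 D0 D1 \<zeta> (v \<zeta>)"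
begin

abbreviation "p \<equiv> dimH S"
abbreviation "q \<equiv> dimHh S"
abbreviation "M \<equiv> m_function S Ut v"
abbreviation "D \<equiv> Domain (Tmax_fun S)"

lemma Ut_carrier: "Ut \<in> carrier_mat N N"
  using bnd_a by (simp add: boundary_op_a_def Let_def)

lemma Gb_carrier:
  assumes "y \<in> D"
  shows "G0b y \<in> carrier_vec (r + s)" "Ghb y \<in> carrier_vec q" "G1b y \<in> carrier_vec r"
  using bnd_b assms by (auto simp: boundary_map_b_def Let_def)

lemma Gb_add:
  assumes "y \<in> D" "z \<in> D"
  shows "G0b (\<lambda>t. y t + z t) = G0b y + G0b z" "Ghb (\<lambda>t. y t + z t) = Ghb y + Ghb z"
    "G1b (\<lambda>t. y t + z t) = G1b y + G1b z"
  using bnd_b assms by (simp_all add: boundary_map_b_def Let_def)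

lemma Gb_smult:
  assumes "y \<in> D"
  shows "G0b (\<lambda>t. c \<cdot>\<^sub>v y t) = c \<cdot>\<^sub>v G0b y" "Ghb (\<lambda>t. c \<cdot>\<^sub>v y t) = c \<cdot>\<^sub>v Ghb y"
    "G1b (\<lambda>t. c \<cdot>\<^sub>v y t) = c \<cdot>\<^sub>v G1b y"
  using bnd_b assms by (simp_all add: boundary_map_b_def Let_def)

lemma Gb_surj:
  assumes "x0 \<in> carrier_vec (r + s)" "xh \<in> carrier_vec q" "x1 \<in> carrier_vec r"
  obtains y f where "(y, f) \<in> Tmax_fun S" "G0b y = x0" "Ghb y = xh" "G1b y = x1"
proof -
  have "\<exists>y \<in> D. G0b y = x0 \<and> Ghb y = xh \<and> G1b y = x1"
    using bnd_b assms by (simp add: boundary_map_b_def Let_def)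
  then show ?thesis using that by blast
qed

lemma bracket_b_eq:
  assumes "y \<in> D" "z \<in> D"
  shows "bracket_b S y z = bform r s (G0b y) (G1b y) (G0b z) (G1b z) + \<i> * (Ghb y \<bullet>c Ghb z)"
  using bnd_b assms by (simp add: boundary_map_b_def Let_def bform_def)

lemma Ga_carrier [simp]: "G0a S Ut y \<in> carrier_vec p" "Gha S Ut y \<in> carrier_vec q" "G1a S Ut y \<in> carrier_vec p"
  by (simp_all add: G0a_def Gha_def G1a_def)

lemma Tmax_D: "(y, f) \<in> Tmax_fun S \<Longrightarrow> y \<in> D" by blast

lemma Tmax_carrier: "(y, f) \<in> Tmax_fun S \<Longrightarrow> y t \<in> carrier_vec N"
  by (auto simp: Tmax_fun_def AC_carrier)

lemma Tmax_L2: "(y, f) \<in> Tmax_fun S \<Longrightarrow> y \<in> L2fun S" "(y, f) \<in> Tmax_fun S \<Longrightarrow> f \<in> L2fun S"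
  by (auto simp: Tmax_fun_def)

lemma Green_boundary:
  assumes yf: "(y, f) \<in> Tmax_fun S" and zg: "(z, g) \<in> Tmax_fun S"
  shows "ip S f z - ip S y g = bform r s (G0b y) (G1b y) (G0b z) (G1b z) + \<i> * (Ghb y \<bullet>c Ghb z)
    - (G0a S Ut y \<bullet>c G1a S Ut z - G1a S Ut y \<bullet>c G0a S Ut z + \<i> * (Gha S Ut y \<bullet>c Gha S Ut z))"
  using Green_identity[OF yf zg] bracket_b_eq[OF Tmax_D[OF yf] Tmax_D[OF zg]]
    bracket_at_a[OF bnd_a Tmax_carrier[OF yf] Tmax_carrier[OF zg]] by simp

definition sol :: "complex \<Rightarrow> complex vec \<Rightarrow> real \<Rightarrow> complex vec" where
  "sol \<zeta> h t = v \<zeta> t *\<^sub>v h"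

lemma v_carrier: "Im \<zeta> \<noteq> 0 \<Longrightarrow> v \<zeta> t \<in> carrier_mat N (dim0 S)"
  using v_tau by (simp add: is_v_tau_def L2op_def)

lemma sol_L2: "Im \<zeta> \<noteq> 0 \<Longrightarrow> h \<in> carrier_vec (dim0 S) \<Longrightarrow> sol \<zeta> h \<in> L2fun S"
  using v_tau unfolding sol_def by (simp add: is_v_tau_def L2op_def)

lemma sol_Tmax:
  assumes "Im \<zeta> \<noteq> 0" "h \<in> carrier_vec (dim0 S)"
  shows "(sol \<zeta> h, \<lambda>t. \<zeta> \<cdot>\<^sub>v sol \<zeta> h t) \<in> Tmax_fun S"
proof -
  have "solution S \<zeta> (sol \<zeta> h)"
    using v_tau[OF assms(1)] assms(2) by (simp add: is_v_tau_def operator_solution_def sol_def[abs_def])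
  then show ?thesis
    using sol_L2[OF assms] by (simp add: Tmax_fun_def solution_def L2fun_smult)
qed

lemma sol_boundary:
  assumes "Im \<zeta> \<noteq> 0" "h \<in> carrier_vec (dim0 S)"
  shows "G1a S Ut (sol \<zeta> h) = - vec_first h p"
    and "\<i> \<cdot>\<^sub>v (Gha S Ut (sol \<zeta> h) - Ghb (sol \<zeta> h)) = vec_last h q"
    and "Im \<zeta> > 0 \<Longrightarrow> C0 \<zeta> *\<^sub>v G0b (sol \<zeta> h) + C1 \<zeta> *\<^sub>v G1b (sol \<zeta> h) = 0\<^sub>v (r + s)"
    and "Im \<zeta> < 0 \<Longrightarrow> D0 \<zeta> *\<^sub>v G0b (sol \<zeta> h) + D1 \<zeta> *\<^sub>v G1b (sol \<zeta> h) = 0\<^sub>v r"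
  using v_tau[OF assms(1)] assms(2) by (simp_all add: is_v_tau_def Let_def sol_def[abs_def])

lemma sol_Ghb:
  assumes "Im \<zeta> \<noteq> 0" "h \<in> carrier_vec (dim0 S)"
  shows "Ghb (sol \<zeta> h) = Gha S Ut (sol \<zeta> h) + \<i> \<cdot>\<^sub>v vec_last h q"
proof -
  have c: "Ghb (sol \<zeta> h) \<in> carrier_vec q" by (rule Gb_carrier(2)[OF Tmax_D[OF sol_Tmax[OF assms]]])
  show ?thesis
    unfolding sol_boundary(2)[OF assms, symmetric] using c
    by (intro eq_vecI) (auto simp: right_diff_distrib)
qed

lemma mat_of_op_mult:
  assumes A: "A \<in> carrier_mat m n" and F: "\<And>h. h \<in> carrier_vec n \<Longrightarrow> F h = A *\<^sub>v h"
  shows "mat_of_op m n F = A"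
  using A F by (intro eq_matI) (auto simp: mat_of_op_def mat_of_cols_def)

text \<open>
  The components of \<open>m(\<zeta>) h\<close> are the boundary values at \<open>a\<close> of \<open>v(\<zeta>) h\<close>, the second one shifted by
  \<open>\<i> h\<^sub>2 / 2\<close>. The proof writes both summands of the \<open>m\<close>-function as explicit matrices.
\<close>

lemma M_mult:
  assumes "Im \<zeta> \<noteq> 0" "h \<in> carrier_vec (dim0 S)"
  shows "M \<zeta> \<in> carrier_mat (dim0 S) (dim0 S)"
    and "vec_first (M \<zeta> *\<^sub>v h) p = G0a S Ut (sol \<zeta> h)"
    and "vec_last (M \<zeta> *\<^sub>v h) q = Gha S Ut (sol \<zeta> h) + (\<i> / 2) \<cdot>\<^sub>v vec_last h q"
proof -
  let ?n = "dim0 S"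
  define A where "A = mat ?n ?n (\<lambda>(i, j). (Ut * v \<zeta> (lend S)) $$ (i, j))"
  define Q where "Q = mat ?n ?n (\<lambda>(i, j). if i = j \<and> p \<le> i then 1 else (0 :: complex))"
  have AQ: "A \<in> carrier_mat ?n ?n" "Q \<in> carrier_mat ?n ?n" by (simp_all add: A_def Q_def)
  note V = v_carrier[OF assms(1), of "lend S"]
  have UV: "Ut * v \<zeta> (lend S) \<in> carrier_mat N ?n" by (rule mult_carrier_mat[OF Ut_carrier V])
  have n: "?n \<le> N" by (simp add: dim0_def dimHH_def)
  have A_mult: "(A *\<^sub>v h) $ i = (Ut *\<^sub>v sol \<zeta> h (lend S)) $ i" if "h \<in> carrier_vec ?n" "i < ?n" for h i
  proof -
    have "(A *\<^sub>v h) $ i = ((Ut * v \<zeta> (lend S)) *\<^sub>v h) $ i"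
      unfolding mult_mat_vec_index_sum[OF AQ(1) that] mult_mat_vec_index_sum[OF UV that(1) order_less_le_trans[OF that(2) n]]
      using that by (simp add: A_def)
    then show ?thesis unfolding assoc_mult_mat_vec[OF Ut_carrier V that(1)] sol_def .
  qed
  have Ut_dim: "dim_vec (Ut *\<^sub>v w) = N" for w using Ut_carrier by simp
  have 1: "G0a S Ut (sol \<zeta> h) @\<^sub>v Gha S Ut (sol \<zeta> h) = A *\<^sub>v h" if "h \<in> carrier_vec ?n" for h
    using that AQ n by (intro eq_vecI) (auto simp: A_mult G0a_def Gha_def vec_first_def vec_last_def dim0_def
        simp del: index_mult_mat_vec)
  have Q_mult: "(Q *\<^sub>v h) $ i = (if p \<le> i then h $ i else 0)" if "h \<in> carrier_vec ?n" "i < ?n" for h i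
    unfolding mult_mat_vec_index_sum[OF AQ(2) that]
    using that by (simp add: Q_def if_distrib[of "\<lambda>x. x * _"] sum.delta' cong: if_cong)
  have 2: "0\<^sub>v p @\<^sub>v vec_last h q = Q *\<^sub>v h" if "h \<in> carrier_vec ?n" for h
    using that AQ by (intro eq_vecI) (auto simp: Q_mult vec_last_def dim0_def simp del: index_mult_mat_vec)
  have sol_fold: "(\<lambda>t. v \<zeta> t *\<^sub>v h) = sol \<zeta> h" for h by (simp add: sol_def fun_eq_iff)
  have M_eq: "M \<zeta> = A + (\<i> / 2) \<cdot>\<^sub>m Q"
    unfolding m_function_def sol_fold
    using mat_of_op_mult[OF AQ(1), of "\<lambda>h. G0a S Ut (sol \<zeta> h) @\<^sub>v Gha S Ut (sol \<zeta> h)"] 1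
      mat_of_op_mult[OF AQ(2), of "\<lambda>h. 0\<^sub>v p @\<^sub>v vec_last h q"] 2 by simp
  then show "M \<zeta> \<in> carrier_mat ?n ?n" using AQ by simp
  note h = assms(2)
  have Mh: "M \<zeta> *\<^sub>v h = (G0a S Ut (sol \<zeta> h) @\<^sub>v Gha S Ut (sol \<zeta> h)) + (\<i> / 2) \<cdot>\<^sub>v (0\<^sub>v p @\<^sub>v vec_last h q)"
    unfolding M_eq add_mult_distrib_mat_vec[OF AQ(1) smult_carrier_mat[OF AQ(2)] h] smult_mat_vec[OF AQ(2) h]
      1[OF h] 2[OF h] ..
  show "vec_first (M \<zeta> *\<^sub>v h) p = G0a S Ut (sol \<zeta> h)"
    unfolding Mh by (intro eq_vecI) (auto simp: vec_first_def G0a_def Gha_def)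
  show "vec_last (M \<zeta> *\<^sub>v h) q = Gha S Ut (sol \<zeta> h) + (\<i> / 2) \<cdot>\<^sub>v vec_last h q"
    unfolding Mh by (intro eq_vecI) (auto simp: vec_last_def G0a_def Gha_def)
qed

lemma M_carrier: "Im \<zeta> \<noteq> 0 \<Longrightarrow> M \<zeta> \<in> carrier_mat (dim0 S) (dim0 S)"
  using M_mult(1)[of \<zeta> "0\<^sub>v (dim0 S)"] by simp

text \<open>
  The shift by \<open>\<i> / 2\<close> in the \<open>m\<close>-function is what absorbs the terms with \<open>(h\<^sub>2, k\<^sub>2)\<close> that
  the condition \<open>Ghb = Gha + \<i> h\<^sub>2\<close> on the middle boundary values produces.
\<close>

theorem sol_identity:
  assumes "Im \<zeta> \<noteq> 0" "Im \<omega> \<noteq> 0" and h: "h \<in> carrier_vec (dim0 S)" and k: "k \<in> carrier_vec (dim0 S)"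
  defines "y \<equiv> sol \<zeta> h" and "z \<equiv> sol \<omega> k"
  shows "(\<zeta> - cnj \<omega>) * ip S y z = bform r s (G0b y) (G1b y) (G0b z) (G1b z)
     + (M \<zeta> *\<^sub>v h) \<bullet>c k - h \<bullet>c (M \<omega> *\<^sub>v k)"
proof -
  note yT = sol_Tmax[OF assms(1) h, folded y_def] and zT = sol_Tmax[OF assms(2) k, folded z_def]
  define a0 ah b0 bh where "a0 = G0a S Ut y" and "ah = Gha S Ut y" and "b0 = G0a S Ut z" and "bh = Gha S Ut z"
  define h1 h2 k1 k2 where "h1 = vec_first h p" and "h2 = vec_last h q" and "k1 = vec_first k p" and "k2 = vec_last k q"
  have cp: "a0 \<in> carrier_vec p" "b0 \<in> carrier_vec p" "h1 \<in> carrier_vec p" "k1 \<in> carrier_vec p"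
    by (simp_all add: a0_def b0_def h1_def k1_def)
  have cq: "ah \<in> carrier_vec q" "bh \<in> carrier_vec q" "h2 \<in> carrier_vec q" "k2 \<in> carrier_vec q"
    by (simp_all add: ah_def bh_def h2_def k2_def)
  have "(\<zeta> - cnj \<omega>) * ip S y z = ip S (\<lambda>t. \<zeta> \<cdot>\<^sub>v y t) z - ip S y (\<lambda>t. \<omega> \<cdot>\<^sub>v z t)"
    using yT zT by (simp add: ip_smult_left ip_smult_right Tmax_L2 left_diff_distrib)
  also have "\<dots> = bform r s (G0b y) (G1b y) (G0b z) (G1b z)
      + \<i> * ((ah + \<i> \<cdot>\<^sub>v h2) \<bullet>c (bh + \<i> \<cdot>\<^sub>v k2)) - (a0 \<bullet>c (- k1) - (- h1) \<bullet>c b0 + \<i> * (ah \<bullet>c bh))"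
    unfolding Green_boundary[OF yT zT]
    using sol_Ghb[OF assms(1) h] sol_Ghb[OF assms(2) k] sol_boundary(1)[OF assms(1) h] sol_boundary(1)[OF assms(2) k]
    by (simp add: y_def z_def a0_def ah_def b0_def bh_def h1_def h2_def k1_def k2_def)
  also have "(ah + \<i> \<cdot>\<^sub>v h2) \<bullet>c (bh + \<i> \<cdot>\<^sub>v k2) = ah \<bullet>c bh - \<i> * (ah \<bullet>c k2) + \<i> * (h2 \<bullet>c bh) + h2 \<bullet>c k2"
    using cq by (simp add: cdot_add_left[of _ q] cdot_add_right[of _ q] cdot_smult_left[of _ q] cdot_smult_right[of _ q] algebra_simps)
  also have "a0 \<bullet>c (- k1) = - (a0 \<bullet>c k1)"
    using cp by (simp add: cdot_eq_sum[of _ p] sum_negf)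
  also have "(- h1) \<bullet>c b0 = - (h1 \<bullet>c b0)"
    using cp by (simp add: cdot_eq_sum[of _ p] sum_negf)
  finally have 1: "(\<zeta> - cnj \<omega>) * ip S y z = bform r s (G0b y) (G1b y) (G0b z) (G1b z) +
      ((a0 \<bullet>c k1) + (ah \<bullet>c k2) + \<i> * (h2 \<bullet>c k2) - h1 \<bullet>c b0 - h2 \<bullet>c bh)" by (simp add: algebra_simps)
  have Mh: "M \<zeta> *\<^sub>v h \<in> carrier_vec (p + q)" "M \<omega> *\<^sub>v k \<in> carrier_vec (p + q)" and hk: "h \<in> carrier_vec (p + q)" "k \<in> carrier_vec (p + q)"
    using mult_mat_vec_carrier[OF M_carrier[OF assms(1)] h] mult_mat_vec_carrier[OF M_carrier[OF assms(2)] k] h k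
    by (simp_all add: dim0_def)
  have 2: "(M \<zeta> *\<^sub>v h) \<bullet>c k = a0 \<bullet>c k1 + ah \<bullet>c k2 + \<i> / 2 * (h2 \<bullet>c k2)"
    unfolding cdot_first_last[OF Mh(1) hk(2)] M_mult(2,3)[OF assms(1) h]
    using cq by (simp add: cdot_add_left[of _ q] cdot_smult_left[of _ q] y_def a0_def ah_def k1_def h2_def k2_def)
  have 3: "h \<bullet>c (M \<omega> *\<^sub>v k) = h1 \<bullet>c b0 + h2 \<bullet>c bh - \<i> / 2 * (h2 \<bullet>c k2)"
    unfolding cdot_first_last[OF hk(1) Mh(2)] M_mult(2,3)[OF assms(2) k]
    using cq by (simp add: cdot_add_right[of _ q] cdot_smult_right[of _ q] z_def b0_def bh_def h1_def h2_def k2_def)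
  show ?thesis unfolding 1 2 3 by (simp add: algebra_simps)
qed

end

section \<open>Symmetry and the Weyl inequality\<close>

lemma adjoint_Cayley_lower_index:
  assumes A0: "A0 \<in> carrier_mat r (r + s)" and A1: "A1 \<in> carrier_mat r r" and x: "x \<in> carrier_vec r"
    and i: "i < r"
  shows "(mat_adjoint (blk A0 0 r 0 r + \<i> \<cdot>\<^sub>m A1) *\<^sub>v x) $ i =
    (mat_adjoint A0 *\<^sub>v x) $ i - \<i> * (mat_adjoint A1 *\<^sub>v x) $ i"
proof -
  have X: "blk A0 0 r 0 r + \<i> \<cdot>\<^sub>m A1 \<in> carrier_mat r r" using A1 by auto
  have i': "i < r + s" using i by simp
  have Xi: "(blk A0 0 r 0 r + \<i> \<cdot>\<^sub>m A1) $$ (k, i) = A0 $$ (k, i) + \<i> * A1 $$ (k, i)" if "k < r" for k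
    using that i A1 by (simp add: blk_def)
  have "(mat_adjoint (blk A0 0 r 0 r + \<i> \<cdot>\<^sub>m A1) *\<^sub>v x) $ i = (\<Sum>k<r. cnj (A0 $$ (k, i) + \<i> * A1 $$ (k, i)) * x $ k)"
    unfolding mult_mat_vec_index_sum[OF mat_adjoint_carrier[OF X] x i]
    using i by (intro sum.cong refl) (simp add: mat_adjoint_index[OF X] Xi del: index_add_mat)
  also have "\<dots> = (mat_adjoint A0 *\<^sub>v x) $ i - \<i> * (mat_adjoint A1 *\<^sub>v x) $ i"
    unfolding mult_mat_vec_index_sum[OF mat_adjoint_carrier[OF A0] x i'] mult_mat_vec_index_sum[OF mat_adjoint_carrier[OF A1] x i]
    using i by (simp add: mat_adjoint_index[OF A0] mat_adjoint_index[OF A1] sum_distrib_left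
        sum_subtractf[symmetric] algebra_simps)
  finally show ?thesis .
qed

lemma set_integral_sum:
  fixes f :: "'i \<Rightarrow> 'a \<Rightarrow> complex"
  assumes "finite A" "\<And>i. i \<in> A \<Longrightarrow> set_integrable M X (f i)"
  shows "set_integrable M X (\<lambda>t. \<Sum>i\<in>A. f i t) \<and> (LINT t:X|M. \<Sum>i\<in>A. f i t) = (\<Sum>i\<in>A. LINT t:X|M. f i t)"
  using assms
proof (induction A rule: finite_induct)
  case empty
  then show ?case by (simp add: set_integrable_def set_lebesgue_integral_def)
next
  case (insert j A)
  then show ?case using set_integral_add[of M X "f j" "\<lambda>t. \<Sum>i\<in>A. f i t"] by simp
qed

definition cayley_vec :: "nat \<Rightarrow> nat \<Rightarrow> complex vec \<Rightarrow> complex vec \<Rightarrow> complex vec" where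
  "cayley_vec r s x0 x1 = vec (r + s) (\<lambda>i. x0 $ i + (if i < r then \<i> * x1 $ i else 0))"

lemma cayley_vec_carrier [simp]: "cayley_vec r s x0 x1 \<in> carrier_vec (r + s)"
  by (simp add: cayley_vec_def)

context boundary_problem
begin

lemma C_carrier: "Im z > 0 \<Longrightarrow> C0 z \<in> carrier_mat (r + s) (r + s)" "Im z > 0 \<Longrightarrow> C1 z \<in> carrier_mat (r + s) r"
  using param by (auto simp: boundary_parameter_def Let_def holomorphic_op_def)

lemma D_carrier: "Im z < 0 \<Longrightarrow> D0 z \<in> carrier_mat r (r + s)" "Im z < 0 \<Longrightarrow> D1 z \<in> carrier_mat r r"
  using param by (auto simp: boundary_parameter_def Let_def holomorphic_op_def)

lemma C_adjoint_bform_nonneg: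
  assumes z: "Im z > 0" and x: "x \<in> carrier_vec (r + s)"
  shows "0 \<le> Im (bform r s (mat_adjoint (C0 z) *\<^sub>v x) (mat_adjoint (C1 z) *\<^sub>v x) (mat_adjoint (C0 z) *\<^sub>v x) (mat_adjoint (C1 z) *\<^sub>v x))"
proof -
  have "op_nonneg (r + s) (2 \<cdot>\<^sub>m Im_op (C1 z * mat_adjoint (blk (C0 z) 0 (r + s) 0 r)) +
      blk (C0 z) 0 (r + s) r s * mat_adjoint (blk (C0 z) 0 (r + s) r s))"
    using param z by (simp add: boundary_parameter_def Let_def)
  then show ?thesis
    using adjoint_form_eq_bform[OF C_carrier[OF z] x] x unfolding op_nonneg_def by fastforce
qed

lemma D_adjoint_bform_nonpos:
  assumes z: "Im z < 0" and x: "x \<in> carrier_vec r"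
  shows "Im (bform r s (mat_adjoint (D0 z) *\<^sub>v x) (mat_adjoint (D1 z) *\<^sub>v x) (mat_adjoint (D0 z) *\<^sub>v x) (mat_adjoint (D1 z) *\<^sub>v x)) \<le> 0"
proof -
  let ?F = "2 \<cdot>\<^sub>m Im_op (D1 z * mat_adjoint (blk (D0 z) 0 r 0 r)) +
      blk (D0 z) 0 r r s * mat_adjoint (blk (D0 z) 0 r r s)"
  have nn: "op_nonneg r (- ?F)" using param z by (simp add: boundary_parameter_def Let_def)
  then have F: "?F \<in> carrier_mat r r" unfolding op_nonneg_def by (metis uminus_carrier_iff_mat)
  have "(- ?F) *\<^sub>v x = (- 1) \<cdot>\<^sub>v (?F *\<^sub>v x)"
    using F x by (subst uminus_mult_mat_vec) auto
  then have "((- ?F) *\<^sub>v x) \<bullet>c x = - ((?F *\<^sub>v x) \<bullet>c x)"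
    using cdot_smult_left[OF mult_mat_vec_carrier[OF F x] x, of "- 1"] by simp
  moreover have "0 \<le> Re (((- ?F) *\<^sub>v x) \<bullet>c x)" using nn x unfolding op_nonneg_def by blast
  ultimately show ?thesis
    using adjoint_form_eq_bform[OF D_carrier[OF z] x] by simp
qed

lemma C_adjoint_solve:
  assumes z: "Im z > 0"
  obtains Y where "Y \<in> carrier_mat (r + s) (r + s)"
    "\<And>p i. p \<in> carrier_vec (r + s) \<Longrightarrow> i < r + s \<Longrightarrow> (mat_adjoint (C0 z) *\<^sub>v (Y *\<^sub>v p)) $ i +
       (if i < r then \<i> * (mat_adjoint (C1 z) *\<^sub>v (Y *\<^sub>v p)) $ i else 0) = p $ i"
proof -
  let ?P = "mat_of_op r (r + s) (\<lambda>x. vec_first x r)"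
  have inv: "invertible_mat (C0 z - \<i> \<cdot>\<^sub>m (C1 z * ?P))"
    using param z by (simp add: boundary_parameter_def Let_def)
  have "?P \<in> carrier_mat r (r + s)" unfolding mat_of_op_def by (rule carrier_matI) simp_all
  then have X: "C0 z - \<i> \<cdot>\<^sub>m (C1 z * ?P) \<in> carrier_mat (r + s) (r + s)"
    using C_carrier[OF z] by (intro minus_carrier_mat smult_carrier_mat mult_carrier_mat)
  obtain Y where Y: "Y \<in> carrier_mat (r + s) (r + s)"
    "\<And>p. p \<in> carrier_vec (r + s) \<Longrightarrow> mat_adjoint (C0 z - \<i> \<cdot>\<^sub>m (C1 z * ?P)) *\<^sub>v (Y *\<^sub>v p) = p"
    using invertible_adjoint_solve[OF inv X] by metis
  show ?thesis
  proof (rule that[OF Y(1)])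
    fix p :: "complex vec" and i assume p: "p \<in> carrier_vec (r + s)" and i: "i < r + s"
    show "(mat_adjoint (C0 z) *\<^sub>v (Y *\<^sub>v p)) $ i +
       (if i < r then \<i> * (mat_adjoint (C1 z) *\<^sub>v (Y *\<^sub>v p)) $ i else 0) = p $ i"
      using adjoint_Cayley_index[OF C_carrier[OF z] mult_mat_vec_carrier[OF Y(1) p] i] Y(2)[OF p] by simp
  qed
qed

lemma D_invertible:
  assumes z: "Im z < 0"
  shows "invertible_mat (blk (D0 z) 0 r 0 r + \<i> \<cdot>\<^sub>m D1 z)" "blk (D0 z) 0 r 0 r + \<i> \<cdot>\<^sub>m D1 z \<in> carrier_mat r r"
  using param z D_carrier[OF z] by (auto simp: boundary_parameter_def Let_def)

text \<open>
  \<open>Im \<beta>\<close> is nonpositive on the boundary condition at \<open>z\<close>. The error term serves vectors that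
  satisfy the condition only approximately.
\<close>

lemma bform_upper_bound:
  assumes z: "Im z > 0"
  obtains Y where "Y \<in> carrier_mat (r + s) (r + s)"
    "\<And>w0 w1. w0 \<in> carrier_vec (r + s) \<Longrightarrow> w1 \<in> carrier_vec r \<Longrightarrow>
      Im (bform r s w0 w1 w0 w1) \<le> 2 * Re ((C0 z *\<^sub>v w0 + C1 z *\<^sub>v w1) \<bullet>c (Y *\<^sub>v cayley_vec r s w0 w1))"
proof -
  obtain Y where Y: "Y \<in> carrier_mat (r + s) (r + s)"
    "\<And>p i. p \<in> carrier_vec (r + s) \<Longrightarrow> i < r + s \<Longrightarrow> (mat_adjoint (C0 z) *\<^sub>v (Y *\<^sub>v p)) $ i +
       (if i < r then \<i> * (mat_adjoint (C1 z) *\<^sub>v (Y *\<^sub>v p)) $ i else 0) = p $ i"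
    using C_adjoint_solve[OF z] by blast
  show ?thesis
  proof (rule that[OF Y(1)])
    fix w0 w1 :: "complex vec" assume w: "w0 \<in> carrier_vec (r + s)" "w1 \<in> carrier_vec r"
    have x: "Y *\<^sub>v cayley_vec r s w0 w1 \<in> carrier_vec (r + s)" by (rule mult_mat_vec_carrier[OF Y(1)]) simp
    show "Im (bform r s w0 w1 w0 w1) \<le> 2 * Re ((C0 z *\<^sub>v w0 + C1 z *\<^sub>v w1) \<bullet>c (Y *\<^sub>v cayley_vec r s w0 w1))"
    proof (rule dissipative_bform_upper[OF C_carrier[OF z] x w C_adjoint_bform_nonneg[OF z x]])
      fix i assume "i < r + s"
      then show "(mat_adjoint (C0 z) *\<^sub>v (Y *\<^sub>v cayley_vec r s w0 w1)) $ i +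
          (if i < r then \<i> * (mat_adjoint (C1 z) *\<^sub>v (Y *\<^sub>v cayley_vec r s w0 w1)) $ i else 0) =
          w0 $ i + (if i < r then \<i> * w1 $ i else 0)"
        unfolding Y(2)[OF cayley_vec_carrier \<open>i < r + s\<close>] by (simp add: cayley_vec_def)
    qed
  qed
qed

lemma bform_lower_nonneg:
  assumes z: "Im z < 0" and w: "w0 \<in> carrier_vec (r + s)" "w1 \<in> carrier_vec r"
    and ker: "D0 z *\<^sub>v w0 + D1 z *\<^sub>v w1 = 0\<^sub>v r"
  shows "0 \<le> Im (bform r s w0 w1 w0 w1)"
proof -
  obtain Y where Y: "Y \<in> carrier_mat r r"
    "\<And>p. p \<in> carrier_vec r \<Longrightarrow> mat_adjoint (blk (D0 z) 0 r 0 r + \<i> \<cdot>\<^sub>m D1 z) *\<^sub>v (Y *\<^sub>v p) = p"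
    using invertible_adjoint_solve[OF D_invertible[OF z]] by metis
  define x where "x = Y *\<^sub>v vec r (\<lambda>i. w0 $ i - \<i> * w1 $ i)"
  have x: "x \<in> carrier_vec r" unfolding x_def by (rule mult_mat_vec_carrier[OF Y(1)]) simp
  have "- Im (bform r s w0 w1 w0 w1) \<le> 2 * Re ((D0 z *\<^sub>v w0 + D1 z *\<^sub>v w1) \<bullet>c x)"
  proof (rule dissipative_bform_lower[OF D_carrier[OF z] x w D_adjoint_bform_nonpos[OF z x]])
    fix i assume i: "i < r"
    show "(mat_adjoint (D0 z) *\<^sub>v x) $ i - \<i> * (mat_adjoint (D1 z) *\<^sub>v x) $ i = w0 $ i - \<i> * w1 $ i"
      unfolding adjoint_Cayley_lower_index[OF D_carrier[OF z] x i, symmetric] using i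
      by (simp add: x_def Y(2) del: index_mult_mat_vec)
  qed
  then show ?thesis using x unfolding ker by (simp add: cdot_eq_sum[of _ r])
qed

text \<open>
  The boundary conditions at \<open>w\<close> and at \<open>cnj w\<close> are adjoint with respect to \<open>\<beta>\<close>. The statement keeps
  the defect \<open>C\<^sub>0 y\<^sub>0 + C\<^sub>1 y\<^sub>1\<close>, since \<open>y\<close> will satisfy a boundary condition at another point.
\<close>

lemma bform_compat:
  assumes w: "Im w > 0" and z: "z0 \<in> carrier_vec (r + s)" "z1 \<in> carrier_vec r"
    and ker: "D0 (cnj w) *\<^sub>v z0 + D1 (cnj w) *\<^sub>v z1 = 0\<^sub>v r"
  obtains x where "x \<in> carrier_vec (r + s)"
    "\<And>y0 y1. y0 \<in> carrier_vec (r + s) \<Longrightarrow> y1 \<in> carrier_vec r \<Longrightarrow>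
       bform r s y0 y1 z0 z1 = - ((C0 w *\<^sub>v y0 + C1 w *\<^sub>v y1) \<bullet>c x)"
proof -
  have w': "Im (cnj w) < 0" using w by simp
  obtain Y where Y: "Y \<in> carrier_mat (r + s) (r + s)"
    "\<And>p i. p \<in> carrier_vec (r + s) \<Longrightarrow> i < r + s \<Longrightarrow> (mat_adjoint (C0 w) *\<^sub>v (Y *\<^sub>v p)) $ i +
       (if i < r then \<i> * (mat_adjoint (C1 w) *\<^sub>v (Y *\<^sub>v p)) $ i else 0) = p $ i"
    using C_adjoint_solve[OF w] by blast
  (* A kernel element (g, - i a; - a) has the combination g - i a, and i (g - i a) = a + i g. *)
  define x where "x = Y *\<^sub>v (\<i> \<cdot>\<^sub>v cayley_vec r s z0 z1)"
  have x: "x \<in> carrier_vec (r + s)" unfolding x_def by (rule mult_mat_vec_carrier[OF Y(1)]) simp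
  have eq: "(mat_adjoint (C0 w) *\<^sub>v x) $ i + (if i < r then \<i> * (mat_adjoint (C1 w) *\<^sub>v x) $ i else 0)
      = \<i> * (z0 $ i + (if i < r then \<i> * z1 $ i else 0))" if "i < r + s" for i
    unfolding x_def using that by (subst Y(2)) (auto simp: cayley_vec_def)
  have compat: "C1 w * mat_adjoint (blk (D0 (cnj w)) 0 r 0 r) - blk (C0 w) 0 (r + s) 0 r * mat_adjoint (D1 (cnj w)) +
       \<i> \<cdot>\<^sub>m (blk (C0 w) 0 (r + s) r s * mat_adjoint (blk (D0 (cnj w)) 0 r r s)) = 0\<^sub>m (r + s) r"
    using param w by (simp add: boundary_parameter_def Let_def)
  have inj: "p = 0\<^sub>v r" if "p \<in> carrier_vec r" "(blk (D0 (cnj w)) 0 r 0 r + \<i> \<cdot>\<^sub>m D1 (cnj w)) *\<^sub>v p = 0\<^sub>v r" for p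
    using invertible_adjoint_solve[OF D_invertible[OF w']] that by metis
  note rep = adjoint_kernel_representation[OF C_carrier[OF w] x D_carrier[OF w'] compat inj z ker eq]
  show ?thesis
    by (rule that[OF x], rule bform_adjoint_pair[OF C_carrier[OF w] x _ _ z]) (simp_all add: rep del: index_mult_mat_vec)
qed

lemma sol_Gb_carrier:
  assumes "Im \<zeta> \<noteq> 0" "h \<in> carrier_vec (dim0 S)"
  shows "G0b (sol \<zeta> h) \<in> carrier_vec (r + s)" "G1b (sol \<zeta> h) \<in> carrier_vec r"
  using Gb_carrier[OF Tmax_D[OF sol_Tmax[OF assms]]] by auto

lemma sol_energy:
  assumes "Im \<zeta> \<noteq> 0" and h: "h \<in> carrier_vec (dim0 S)"
  shows "2 * Im \<zeta> * (wnorm S (sol \<zeta> h))\<^sup>2 = Im (bform r s (G0b (sol \<zeta> h)) (G1b (sol \<zeta> h)) (G0b (sol \<zeta> h)) (G1b (sol \<zeta> h)))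
     + 2 * Im ((M \<zeta> *\<^sub>v h) \<bullet>c h)"
proof -
  have "h \<bullet>c (M \<zeta> *\<^sub>v h) = cnj ((M \<zeta> *\<^sub>v h) \<bullet>c h)"
    using cdot_cnj[OF mult_mat_vec_carrier[OF M_carrier[OF assms(1)] h] h] by simp
  moreover have "Im ((\<zeta> - cnj \<zeta>) * ip S (sol \<zeta> h) (sol \<zeta> h)) = 2 * Im \<zeta> * (wnorm S (sol \<zeta> h))\<^sup>2"
    unfolding ip_self(3)[OF sol_L2[OF assms]] by simp
  ultimately show ?thesis unfolding sol_identity[OF assms(1) assms(1) h h] by simp
qed

lemma Weyl_inequality_form:
  assumes "Im \<zeta> \<noteq> 0" and h: "h \<in> carrier_vec (dim0 S)"
  shows "(wnorm S (sol \<zeta> h))\<^sup>2 \<le> inverse (Im \<zeta>) * Im ((M \<zeta> *\<^sub>v h) \<bullet>c h)"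
proof -
  note c = sol_Gb_carrier[OF assms]
  define b where "b = Im (bform r s (G0b (sol \<zeta> h)) (G1b (sol \<zeta> h)) (G0b (sol \<zeta> h)) (G1b (sol \<zeta> h)))"
  define n where "n = (wnorm S (sol \<zeta> h))\<^sup>2"
  define m where "m = Im ((M \<zeta> *\<^sub>v h) \<bullet>c h)"
  have e: "2 * Im \<zeta> * n = b + 2 * m" using sol_energy[OF assms] by (simp add: b_def m_def n_def)
  show ?thesis
  proof (cases "Im \<zeta> > 0")
    case True
    obtain Y where Y: "Y \<in> carrier_mat (r + s) (r + s)" "b \<le> 2 * Re ((C0 \<zeta> *\<^sub>v G0b (sol \<zeta> h) + C1 \<zeta> *\<^sub>v G1b (sol \<zeta> h))
        \<bullet>c (Y *\<^sub>v cayley_vec r s (G0b (sol \<zeta> h)) (G1b (sol \<zeta> h))))"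
      using bform_upper_bound[OF True] c unfolding b_def by metis
    then have "b \<le> 0"
      unfolding sol_boundary(3)[OF assms True] cdot_eq_sum[OF mult_mat_vec_carrier[OF Y(1) cayley_vec_carrier]] by simp
    then have "Im \<zeta> * n \<le> m" using e by simp
    then show ?thesis using True by (simp add: n_def m_def field_simps)
  next
    case False
    then have neg: "Im \<zeta> < 0" using assms by simp
    have "0 \<le> b" unfolding b_def by (rule bform_lower_nonneg[OF neg c sol_boundary(4)[OF assms neg]])
    then have "m \<le> Im \<zeta> * n" using e by simp
    then show ?thesis using neg by (simp add: n_def m_def field_simps)
  qed
qed

lemma sol_compat:
  assumes w: "Im w > 0" and k: "k \<in> carrier_vec (dim0 S)"
  obtains x where "x \<in> carrier_vec (r + s)"
    "\<And>\<zeta> h. Im \<zeta> > 0 \<Longrightarrow> h \<in> carrier_vec (dim0 S) \<Longrightarrow>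
       (\<zeta> - w) * ip S (sol \<zeta> h) (sol (cnj w) k) =
         - ((C0 w *\<^sub>v G0b (sol \<zeta> h) + C1 w *\<^sub>v G1b (sol \<zeta> h)) \<bullet>c x) + (M \<zeta> *\<^sub>v h) \<bullet>c k - h \<bullet>c (M (cnj w) *\<^sub>v k)"
proof -
  have w': "Im (cnj w) \<noteq> 0" "Im (cnj w) < 0" using w by auto
  obtain x where x: "x \<in> carrier_vec (r + s)"
    "\<And>y0 y1. y0 \<in> carrier_vec (r + s) \<Longrightarrow> y1 \<in> carrier_vec r \<Longrightarrow>
       bform r s y0 y1 (G0b (sol (cnj w) k)) (G1b (sol (cnj w) k)) = - ((C0 w *\<^sub>v y0 + C1 w *\<^sub>v y1) \<bullet>c x)"
    using bform_compat[OF w sol_Gb_carrier[OF w'(1) k] sol_boundary(4)[OF w'(1) k w'(2)]] by blast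
  show ?thesis
  proof (rule that[OF x(1)])
    fix \<zeta> and h :: "complex vec" assume z: "Im \<zeta> > 0" and h: "h \<in> carrier_vec (dim0 S)"
    then have z0: "Im \<zeta> \<noteq> 0" by simp
    show "(\<zeta> - w) * ip S (sol \<zeta> h) (sol (cnj w) k) =
         - ((C0 w *\<^sub>v G0b (sol \<zeta> h) + C1 w *\<^sub>v G1b (sol \<zeta> h)) \<bullet>c x) + (M \<zeta> *\<^sub>v h) \<bullet>c k - h \<bullet>c (M (cnj w) *\<^sub>v k)"
      using sol_identity[OF z0 w'(1) h k] x(2)[OF sol_Gb_carrier[OF z0 h]] by simp
  qed
qed

lemma M_adjoint_upper:
  assumes w: "Im w > 0"
  shows "mat_adjoint (M w) = M (cnj w)"
proof (rule mat_eqI_cdot)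
  have w0: "Im w \<noteq> 0" "Im (cnj w) \<noteq> 0" using w by auto
  show "mat_adjoint (M w) \<in> carrier_mat (dim0 S) (dim0 S)" "M (cnj w) \<in> carrier_mat (dim0 S) (dim0 S)"
    using M_carrier w0 by auto
  fix k h :: "complex vec" assume k: "k \<in> carrier_vec (dim0 S)" and h: "h \<in> carrier_vec (dim0 S)"
  obtain x where x: "x \<in> carrier_vec (r + s)"
    "\<And>\<zeta> h. Im \<zeta> > 0 \<Longrightarrow> h \<in> carrier_vec (dim0 S) \<Longrightarrow>
       (\<zeta> - w) * ip S (sol \<zeta> h) (sol (cnj w) k) =
         - ((C0 w *\<^sub>v G0b (sol \<zeta> h) + C1 w *\<^sub>v G1b (sol \<zeta> h)) \<bullet>c x) + (M \<zeta> *\<^sub>v h) \<bullet>c k - h \<bullet>c (M (cnj w) *\<^sub>v k)"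
    using sol_compat[OF w k] by blast
  have "(M w *\<^sub>v h) \<bullet>c k = h \<bullet>c (M (cnj w) *\<^sub>v k)"
    using x(2)[OF w h] x(1) unfolding sol_boundary(3)[OF w0(1) h w] by (simp add: cdot_eq_sum[of x])
  then have "h \<bullet>c (mat_adjoint (M w) *\<^sub>v k) = h \<bullet>c (M (cnj w) *\<^sub>v k)"
    using cdot_adjoint[OF M_carrier[OF w0(1)] h k] by simp
  then show "(mat_adjoint (M w) *\<^sub>v k) \<bullet>c h = (M (cnj w) *\<^sub>v k) \<bullet>c h"
    using cdot_cnj[OF h adjoint_mult_carrier[OF M_carrier[OF w0(1)] k]]
      cdot_cnj[OF h mult_mat_vec_carrier[OF M_carrier[OF w0(2)] k]] by metis
qed

lemma M_adjoint:
  assumes "Im w \<noteq> 0"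
  shows "mat_adjoint (M w) = M (cnj w)"
proof (cases "Im w > 0")
  case False
  then have "Im (cnj w) > 0" using assms by simp
  from M_adjoint_upper[OF this] show ?thesis by (metis complex_cnj_cnj mat_adjoint_adjoint)
qed (rule M_adjoint_upper)

text \<open>
  The matrix of integrals represents the form \<open>h \<mapsto> \<parallel>v(\<zeta>) h\<parallel>\<^sup>2\<close>: exchange the integral with the finite
  sums.
\<close>

lemma Weyl_integral_mult:
  assumes z: "Im \<zeta> \<noteq> 0" and h: "h \<in> carrier_vec (dim0 S)"
  shows "(weyl_integral S (v \<zeta>) *\<^sub>v h) \<bullet>c h = ip S (sol \<zeta> h) (sol \<zeta> h)"
proof -
  let ?n = "dim0 S"
  define E where "E i j t = (mat_adjoint (v \<zeta> t) * weight S t * v \<zeta> t) $$ (i, j)" for i j t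
  have Q: "mat_adjoint (v \<zeta> t) * weight S t * v \<zeta> t \<in> carrier_mat ?n ?n"
    "\<And>x y. x \<in> carrier_vec ?n \<Longrightarrow> y \<in> carrier_vec ?n \<Longrightarrow>
      (mat_adjoint (v \<zeta> t) * weight S t * v \<zeta> t *\<^sub>v x) \<bullet>c y = wprod S (sol \<zeta> x) (sol \<zeta> y) t"
    if t: "t \<in> ival S" for t
    using mat_sandwich[OF v_carrier[OF z, of t] weight_carrier[OF t]] by (simp_all add: wprod_def sol_def)
  have E: "E i j t = wprod S (sol \<zeta> (unit_vec ?n j)) (sol \<zeta> (unit_vec ?n i)) t"
    if "t \<in> ival S" "i < ?n" "j < ?n" for i j t
    unfolding E_def mat_index_eq_cdot[OF Q(1)[OF that(1)] that(2,3)] by (rule Q(2)[OF that(1)]) simp_all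
  have E_int: "set_integrable lborel (ival S) (E i j)" if "i < ?n" "j < ?n" for i j
  proof -
    have "set_integrable lborel (ival S) (wprod S (sol \<zeta> (unit_vec ?n j)) (sol \<zeta> (unit_vec ?n i)))"
      by (intro wprod_integrable sol_L2 z) auto
    also have "?this \<longleftrightarrow> ?thesis" using that by (intro set_integrable_cong) (auto simp: E)
    finally show ?thesis .
  qed
  have w: "weyl_integral S (v \<zeta>) \<in> carrier_mat ?n ?n" by (simp add: weyl_integral_def op_integral_def)
  have "(weyl_integral S (v \<zeta>) *\<^sub>v h) \<bullet>c h =
      (\<Sum>i<?n. (\<Sum>j<?n. (LINT t : ival S | lborel. E i j t) * h $ j) * cnj (h $ i))"
  proof -
    have "weyl_integral S (v \<zeta>) $$ (i, j) = (LINT t : ival S | lborel. E i j t)" if "i < ?n" "j < ?n" for i j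
      using that by (simp add: weyl_integral_def op_integral_def E_def[abs_def])
    then show ?thesis
      unfolding cdot_eq_sum[OF h] by (simp add: mult_mat_vec_index_sum[OF w h] del: index_mult_mat_vec)
  qed
  also have "\<dots> = (\<Sum>i<?n. \<Sum>j<?n. (LINT t : ival S | lborel. E i j t * h $ j * cnj (h $ i)))"
    by (simp add: sum_distrib_right)
  also have "\<dots> = (LINT t : ival S | lborel. \<Sum>i<?n. \<Sum>j<?n. E i j t * h $ j * cnj (h $ i))"
  proof -
    have in1: "set_integrable lborel (ival S) (\<lambda>t. E i j t * h $ j * cnj (h $ i))" if "i < ?n" "j < ?n" for i j
      using E_int[OF that] by (intro set_integrable_mult_left)
    have in2: "set_integrable lborel (ival S) (\<lambda>t. \<Sum>j<?n. E i j t * h $ j * cnj (h $ i)) \<and>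
        (LINT t : ival S | lborel. \<Sum>j<?n. E i j t * h $ j * cnj (h $ i)) =
        (\<Sum>j<?n. LINT t : ival S | lborel. E i j t * h $ j * cnj (h $ i))" if "i < ?n" for i
      using in1[OF that] by (intro set_integral_sum) auto
    have "(LINT t : ival S | lborel. \<Sum>i<?n. \<Sum>j<?n. E i j t * h $ j * cnj (h $ i)) =
        (\<Sum>i<?n. LINT t : ival S | lborel. \<Sum>j<?n. E i j t * h $ j * cnj (h $ i))"
      using in2 by (intro set_integral_sum[THEN conjunct2]) auto
    then show ?thesis using in2 by simp
  qed
  also have "\<dots> = ip S (sol \<zeta> h) (sol \<zeta> h)"
    unfolding ip_def
  proof (rule set_lebesgue_integral_cong)
    show "\<forall>t. t \<in> ival S \<longrightarrow> (\<Sum>i<?n. \<Sum>j<?n. E i j t * h $ j * cnj (h $ i)) = wprod S (sol \<zeta> h) (sol \<zeta> h) t"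
    proof (intro allI impI)
      fix t assume t: "t \<in> ival S"
      have "(\<Sum>i<?n. \<Sum>j<?n. E i j t * h $ j * cnj (h $ i)) = (mat_adjoint (v \<zeta> t) * weight S t * v \<zeta> t *\<^sub>v h) \<bullet>c h"
        unfolding cdot_eq_sum[OF h]
        by (simp add: mult_mat_vec_index_sum[OF Q(1)[OF t] h] E_def sum_distrib_right del: index_mult_mat_vec)
      then show "(\<Sum>i<?n. \<Sum>j<?n. E i j t * h $ j * cnj (h $ i)) = wprod S (sol \<zeta> h) (sol \<zeta> h) t"
        using Q(2)[OF t h h] by simp
    qed
  qed simp
  finally show ?thesis .
qed

theorem Weyl_inequality:
  assumes z: "Im \<zeta> \<noteq> 0"
  shows "op_ge (dim0 S) (complex_of_real (inverse (Im \<zeta>)) \<cdot>\<^sub>m Im_op (M \<zeta>)) (weyl_integral S (v \<zeta>))"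
proof -
  let ?n = "dim0 S" and ?A = "complex_of_real (inverse (Im \<zeta>)) \<cdot>\<^sub>m Im_op (M \<zeta>)" and ?W = "weyl_integral S (v \<zeta>)"
  note I = Im_op_carrier[OF M_carrier[OF z]]
  have A: "?A \<in> carrier_mat ?n ?n" by (rule smult_carrier_mat[OF I])
  have W: "?W \<in> carrier_mat ?n ?n" by (simp add: weyl_integral_def op_integral_def)
  have "Im (((?A - ?W) *\<^sub>v h) \<bullet>c h) = 0 \<and> 0 \<le> Re (((?A - ?W) *\<^sub>v h) \<bullet>c h)" if h: "h \<in> carrier_vec ?n" for h
  proof -
    define m where "m = inverse (Im \<zeta>) * Im ((M \<zeta> *\<^sub>v h) \<bullet>c h)"
    have "((?A - ?W) *\<^sub>v h) \<bullet>c h = (?A *\<^sub>v h) \<bullet>c h - (?W *\<^sub>v h) \<bullet>c h"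
      unfolding minus_mult_distrib_mat_vec[OF A W h]
      by (rule cdot_diff_left[OF mult_mat_vec_carrier[OF A h] mult_mat_vec_carrier[OF W h] h])
    also have "(?A *\<^sub>v h) \<bullet>c h = of_real m"
      unfolding m_def smult_mat_vec[OF I h] cdot_smult_left[OF mult_mat_vec_carrier[OF I h] h] Im_op_cdot[OF M_carrier[OF z] h] by simp
    also have "(?W *\<^sub>v h) \<bullet>c h = of_real ((wnorm S (sol \<zeta> h))\<^sup>2)"
      unfolding Weyl_integral_mult[OF z h] by (rule ip_self(3)[OF sol_L2[OF z h]])
    finally have "((?A - ?W) *\<^sub>v h) \<bullet>c h = of_real (m - (wnorm S (sol \<zeta> h))\<^sup>2)" by simp
    then show ?thesis using Weyl_inequality_form[OF z h, folded m_def] by (simp only: Im_complex_of_real Re_complex_of_real) simp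
  qed
  then show ?thesis using A W by (auto simp: op_ge_def op_nonneg_def intro!: minus_carrier_mat)
qed

lemma Im_M_nonneg:
  assumes z: "Im \<zeta> \<noteq> 0"
  shows "op_nonneg (dim0 S) (complex_of_real (Im \<zeta>) \<cdot>\<^sub>m Im_op (M \<zeta>))"
proof -
  note I = Im_op_carrier[OF M_carrier[OF z]]
  have "((complex_of_real (Im \<zeta>) \<cdot>\<^sub>m Im_op (M \<zeta>)) *\<^sub>v h) \<bullet>c h = of_real (Im \<zeta> * Im ((M \<zeta> *\<^sub>v h) \<bullet>c h))"
    if h: "h \<in> carrier_vec (dim0 S)" for h
    unfolding smult_mat_vec[OF I h] cdot_smult_left[OF mult_mat_vec_carrier[OF I h] h] Im_op_cdot[OF M_carrier[OF z] h] by simp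
  moreover have "0 \<le> Im \<zeta> * Im ((M \<zeta> *\<^sub>v h) \<bullet>c h)" if h: "h \<in> carrier_vec (dim0 S)" for h
  proof -
    have "0 \<le> inverse (Im \<zeta>) * Im ((M \<zeta> *\<^sub>v h) \<bullet>c h)"
      using Weyl_inequality_form[OF z h] zero_le_power2 order_trans by blast
    then have "0 \<le> (Im \<zeta>)\<^sup>2 * (inverse (Im \<zeta>) * Im ((M \<zeta> *\<^sub>v h) \<bullet>c h))"
      by (intro mult_nonneg_nonneg[OF zero_le_power2])
    also have "\<dots> = Im \<zeta> * Im ((M \<zeta> *\<^sub>v h) \<bullet>c h)"
      using z by (simp add: power2_eq_square divide_inverse[symmetric])
    finally show ?thesis .
  qed
  ultimately show ?thesis using I by (auto simp: op_nonneg_def)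
qed

end

section \<open>Continuity of the solutions in the spectral parameter\<close>

text \<open>
  The closing argument for the continuity estimates. The second bound makes \<open>g\<close> comparable with \<open>W\<close>
  up to \<open>\<epsilon>\<close>, the first makes \<open>W\<close> of order \<open>\<surd>\<epsilon>\<close> relative to \<open>1 + W + g\<close>; for small \<open>\<epsilon>\<close> the sum \<open>1 + W + g\<close>
  is absorbed, hence bounded by \<open>2\<close>.
\<close>

lemma coupled_smallness:
  fixes W g \<epsilon> :: "'a \<Rightarrow> real"
  assumes eps: "(\<epsilon> \<longlongrightarrow> 0) F" and c: "0 \<le> c"
    and nn: "\<forall>\<^sub>F z in F. 0 \<le> W z \<and> 0 \<le> g z \<and> 0 \<le> \<epsilon> z"
    and W: "\<forall>\<^sub>F z in F. (W z)\<^sup>2 \<le> c * \<epsilon> z * (1 + W z + g z)\<^sup>2"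
    and g: "\<forall>\<^sub>F z in F. g z \<le> c * (W z + \<epsilon> z * (1 + W z + g z))"
  shows "(W \<longlongrightarrow> 0) F" "(g \<longlongrightarrow> 0) F"
proof -
  (* W is at most eta times 1 + W + g. *)
  define \<eta> where "\<eta> z = sqrt (c * \<epsilon> z)" for z
  have eta: "(\<eta> \<longlongrightarrow> 0) F"
    unfolding \<eta>_def using tendsto_real_sqrt[OF tendsto_mult_right_zero[OF eps, of c]] by simp
  have "((\<lambda>z. (1 + c) * \<eta> z + c * \<epsilon> z) \<longlongrightarrow> 0) F"
    using tendsto_add[OF tendsto_mult_right_zero[OF eta, of "1 + c"] tendsto_mult_right_zero[OF eps, of c]] by simp
  then have small: "\<forall>\<^sub>F z in F. (1 + c) * \<eta> z + c * \<epsilon> z < 1 / 2"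
    by (rule order_tendstoD(2)) simp
  have bound: "\<forall>\<^sub>F z in F. 0 \<le> W z \<and> 0 \<le> g z \<and> W z \<le> 2 * \<eta> z \<and> g z \<le> c * (2 * \<eta> z + 2 * \<epsilon> z)"
    using nn W g small
  proof eventually_elim
    case (elim z)
    define P where "P = 1 + W z + g z"
    have P: "P \<ge> 1" using elim by (simp add: P_def)
    have W': "W z \<le> \<eta> z * P"
    proof -
      have "W z = sqrt ((W z)\<^sup>2)" using elim by simp
      also have "\<dots> \<le> sqrt (c * \<epsilon> z * P\<^sup>2)"
        by (rule real_sqrt_le_mono) (use elim in \<open>simp add: P_def\<close>)
      also have "\<dots> = \<eta> z * P" using P by (simp add: \<eta>_def real_sqrt_mult)
      finally show ?thesis .
    qed
    have g': "g z \<le> c * W z + c * \<epsilon> z * P" using elim by (simp add: P_def algebra_simps)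
    have cW: "c * W z \<le> c * (\<eta> z * P)" using W' c by (rule mult_left_mono)
    have "P \<le> 1 + \<eta> z * P + (c * (\<eta> z * P) + c * \<epsilon> z * P)" unfolding P_def
      using W' g' cW unfolding P_def by linarith
    also have "\<dots> = 1 + ((1 + c) * \<eta> z + c * \<epsilon> z) * P" by (simp add: algebra_simps)
    also have "\<dots> \<le> 1 + 1 / 2 * P" using elim P by (intro add_left_mono mult_right_mono) auto
    finally have P2: "P \<le> 2" by simp
    have eta0: "0 \<le> \<eta> z" using elim c by (simp add: \<eta>_def)
    have "W z \<le> 2 * \<eta> z" using W' mult_left_mono[OF P2 eta0] by simp
    moreover have "\<epsilon> z * P \<le> 2 * \<epsilon> z" using mult_left_mono[OF P2, of "\<epsilon> z"] elim by simp
    ultimately have "c * (W z + \<epsilon> z * P) \<le> c * (2 * \<eta> z + 2 * \<epsilon> z)" using c by (intro mult_left_mono) auto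
    with elim \<open>W z \<le> 2 * \<eta> z\<close> show ?case by (simp add: P_def)
  qed
  have "((\<lambda>z. 2 * \<eta> z) \<longlongrightarrow> 0) F" by (rule tendsto_mult_right_zero[OF eta])
  then show "(W \<longlongrightarrow> 0) F"
    by (rule tendsto_sandwich[OF _ _ tendsto_const, rotated 2]) (use bound in eventually_elim, simp)+
  have "((\<lambda>z. c * (2 * \<eta> z + 2 * \<epsilon> z)) \<longlongrightarrow> 0) F"
    using tendsto_mult_right_zero[OF tendsto_add[OF tendsto_mult_right_zero[OF eta, of 2] tendsto_mult_right_zero[OF eps, of 2], simplified], of c] by simp
  then show "(g \<longlongrightarrow> 0) F"
    by (rule tendsto_sandwich[OF _ _ tendsto_const, rotated 2]) (use bound in eventually_elim, simp)+
qed

definition abs_sum :: "complex vec \<Rightarrow> real" where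
  "abs_sum x = (\<Sum>i<dim_vec x. cmod (x $ i))"

lemma abs_sum_nonneg [simp]: "0 \<le> abs_sum x"
  by (simp add: abs_sum_def sum_nonneg)

lemma index_le_abs_sum: "i < dim_vec x \<Longrightarrow> cmod (x $ i) \<le> abs_sum x"
  unfolding abs_sum_def by (rule member_le_sum) auto

lemma abs_sum_le:
  assumes "x \<in> carrier_vec n" "\<And>i. i < n \<Longrightarrow> cmod (x $ i) \<le> B"
  shows "abs_sum x \<le> n * B"
proof -
  have "abs_sum x \<le> (\<Sum>i<n. B)"
    using assms unfolding abs_sum_def by (simp only: carrier_vecD) (rule sum_mono, simp)
  then show ?thesis by simp
qed

lemma cdot_le_abs_sum:
  assumes x: "x \<in> carrier_vec n" and y: "y \<in> carrier_vec n" and b: "\<And>i. i < n \<Longrightarrow> cmod (x $ i) \<le> B"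
  shows "cmod (x \<bullet>c y) \<le> B * abs_sum y"
proof -
  have "cmod (x \<bullet>c y) \<le> (\<Sum>i<n. cmod (x $ i * cnj (y $ i)))"
    unfolding cdot_eq_sum[OF y] by (rule norm_sum)
  also have "\<dots> \<le> (\<Sum>i<n. B * cmod (y $ i))"
    by (intro sum_mono) (auto simp: norm_mult intro!: mult_right_mono b)
  finally show ?thesis using y by (simp add: abs_sum_def sum_distrib_left)
qed

lemma mult_mat_vec_abs_sum:
  assumes A: "A \<in> carrier_mat m n" and x: "x \<in> carrier_vec n" and i: "i < m"
  shows "cmod ((A *\<^sub>v x) $ i) \<le> (\<Sum>k<m. \<Sum>j<n. cmod (A $$ (k, j))) * abs_sum x"
proof -
  have "cmod ((A *\<^sub>v x) $ i) \<le> (\<Sum>j<n. cmod (A $$ (i, j) * x $ j))"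
    unfolding mult_mat_vec_index_sum[OF A x i] by (rule norm_sum)
  also have "\<dots> \<le> (\<Sum>j<n. cmod (A $$ (i, j)) * abs_sum x)"
    using x by (intro sum_mono) (auto simp: norm_mult intro!: mult_left_mono index_le_abs_sum)
  also have "\<dots> = (\<Sum>j<n. cmod (A $$ (i, j))) * abs_sum x" by (simp add: sum_distrib_right)
  also have "\<dots> \<le> (\<Sum>k<m. \<Sum>j<n. cmod (A $$ (k, j))) * abs_sum x"
    using i by (intro mult_right_mono member_le_sum) (auto intro: sum_nonneg)
  finally show ?thesis .
qed

context boundary_problem
begin

lemma Ga_linear:
  assumes y: "y (lend S) \<in> carrier_vec N" and z: "z (lend S) \<in> carrier_vec N"
  shows "G0a S Ut (\<lambda>t. y t + c \<cdot>\<^sub>v z t) = G0a S Ut y + c \<cdot>\<^sub>v G0a S Ut z"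
    and "Gha S Ut (\<lambda>t. y t + c \<cdot>\<^sub>v z t) = Gha S Ut y + c \<cdot>\<^sub>v Gha S Ut z"
    and "G1a S Ut (\<lambda>t. y t + c \<cdot>\<^sub>v z t) = G1a S Ut y + c \<cdot>\<^sub>v G1a S Ut z"
proof -
  define a b where "a = Ut *\<^sub>v y (lend S)" and "b = Ut *\<^sub>v z (lend S)"
  have ab: "a \<in> carrier_vec N" "b \<in> carrier_vec N"
    unfolding a_def b_def by (rule mult_mat_vec_carrier[OF Ut_carrier y], rule mult_mat_vec_carrier[OF Ut_carrier z])
  have e: "Ut *\<^sub>v (y (lend S) + c \<cdot>\<^sub>v z (lend S)) = a + c \<cdot>\<^sub>v b"
    using y z by (simp add: mult_add_distrib_mat_vec[OF Ut_carrier] mult_mat_vec[OF Ut_carrier] a_def b_def)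
  show "G0a S Ut (\<lambda>t. y t + c \<cdot>\<^sub>v z t) = G0a S Ut y + c \<cdot>\<^sub>v G0a S Ut z"
    "Gha S Ut (\<lambda>t. y t + c \<cdot>\<^sub>v z t) = Gha S Ut y + c \<cdot>\<^sub>v Gha S Ut z"
    "G1a S Ut (\<lambda>t. y t + c \<cdot>\<^sub>v z t) = G1a S Ut y + c \<cdot>\<^sub>v G1a S Ut z"
    unfolding G0a_def Gha_def G1a_def e a_def[symmetric] b_def[symmetric]
    using ab by (auto intro!: eq_vecI simp: vec_first_def vec_last_def dimHH_def dim0_def)
qed

definition bnorm :: "(real \<Rightarrow> complex vec) \<Rightarrow> real" where
  "bnorm y = abs_sum (G0b y) + abs_sum (G1b y)"

lemma bnorm_nonneg [simp]: "0 \<le> bnorm y" by (simp add: bnorm_def)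

lemma C_deriv:
  assumes w: "Im w > 0"
  shows "i < r + s \<Longrightarrow> j < r + s \<Longrightarrow> \<exists>d. ((\<lambda>z. C0 z $$ (i, j)) has_field_derivative d) (at w)"
    and "i < r + s \<Longrightarrow> j < r \<Longrightarrow> \<exists>d. ((\<lambda>z. C1 z $$ (i, j)) has_field_derivative d) (at w)"
proof -
  have hol: "\<exists>d. (f has_field_derivative d) (at w)" if "f holomorphic_on {z. Im z > 0}" for f
    using holomorphic_derivI[OF that open_halfspace_Im_gt, of w] w by auto
  show "i < r + s \<Longrightarrow> j < r + s \<Longrightarrow> \<exists>d. ((\<lambda>z. C0 z $$ (i, j)) has_field_derivative d) (at w)"
    "i < r + s \<Longrightarrow> j < r \<Longrightarrow> \<exists>d. ((\<lambda>z. C1 z $$ (i, j)) has_field_derivative d) (at w)"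
    using param by (intro hol; simp add: boundary_parameter_def Let_def holomorphic_op_def)+
qed

context
  fixes w :: complex and h :: "complex vec"
  assumes w: "Im w > 0" and h: "h \<in> carrier_vec (dim0 S)"
begin

text \<open>
  The difference of the solutions at \<open>z\<close> and at \<open>w\<close>. It satisfies the inhomogeneous equation at \<open>w\<close> with
  right-hand side \<open>(z - w) v(z) h\<close>, and the terms with \<open>h\<close> cancel in its boundary conditions (\<open>du_Ga\<close>).
\<close>

definition du :: "complex \<Rightarrow> real \<Rightarrow> complex vec" where
  "du z t = sol z h t + (- 1) \<cdot>\<^sub>v sol w h t"

text \<open>
  Distance of \<open>z\<close> from \<open>w\<close> together with that of the boundary conditions \<open>C(z)\<close> and \<open>C(w)\<close>.
\<close>

definition gap :: "complex \<Rightarrow> real" where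
  "gap z = cmod (z - w) + (\<Sum>i<r + s. \<Sum>j<r + s. cmod (C0 z $$ (i, j) - C0 w $$ (i, j)))
     + (\<Sum>i<r + s. \<Sum>j<r. cmod (C1 z $$ (i, j) - C1 w $$ (i, j)))"

lemma gap_bounds: "cmod (z - w) \<le> gap z" "0 \<le> gap z"
  by (auto simp: gap_def intro!: add_nonneg_nonneg sum_nonneg)

text \<open>
  No bound for \<open>du\<close> near \<open>w\<close> is known at first, so the estimates below are relative to its size.
\<close>

definition growth :: "complex \<Rightarrow> real" where
  "growth z = 1 + wnorm S (du z) + bnorm (du z)"

abbreviation u :: "complex \<Rightarrow> real \<Rightarrow> complex vec" where
  "u z \<equiv> sol z h"

lemma w0: "Im w \<noteq> 0" using w by simp

lemma du_Tmax:
  assumes z: "Im z > 0"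
  shows "(du z, \<lambda>t. z \<cdot>\<^sub>v u z t + (- 1) \<cdot>\<^sub>v (w \<cdot>\<^sub>v u w t)) \<in> Tmax_fun S"
proof -
  have z0: "Im z \<noteq> 0" using z by simp
  show ?thesis
    unfolding du_def[abs_def] using Tmax_fun_add[OF sol_Tmax[OF z0 h] Tmax_fun_smult[OF sol_Tmax[OF w0 h], of "- 1"]] .
qed

lemma ip_du_left:
  assumes z: "Im z > 0" and f: "f \<in> L2fun S"
  shows "ip S (du z) f = ip S (u z) f - ip S (u w) f"
    and "ip S (\<lambda>t. z \<cdot>\<^sub>v u z t + (- 1) \<cdot>\<^sub>v (w \<cdot>\<^sub>v u w t)) f = w * ip S (du z) f + (z - w) * ip S (u z) f"
proof -
  have z0: "Im z \<noteq> 0" using z by simp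
  note L = sol_L2[OF z0 h] sol_L2[OF w0 h]
  show 1: "ip S (du z) f = ip S (u z) f - ip S (u w) f"
    unfolding du_def[abs_def] ip_add_left[OF L(1) L2fun_smult[OF L(2)] f] ip_smult_left[OF L(2) f] by simp
  show "ip S (\<lambda>t. z \<cdot>\<^sub>v u z t + (- 1) \<cdot>\<^sub>v (w \<cdot>\<^sub>v u w t)) f = w * ip S (du z) f + (z - w) * ip S (u z) f"
    unfolding 1 ip_add_left[OF L2fun_smult[OF L(1)] L2fun_smult[OF L2fun_smult[OF L(2)]] f]
      ip_smult_left[OF L(1) f] ip_smult_left[OF L2fun_smult[OF L(2)] f] ip_smult_left[OF L(2) f]
    by (simp add: algebra_simps)
qed

lemma du_L2: "Im z > 0 \<Longrightarrow> du z \<in> L2fun S"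
  using Tmax_L2(1)[OF du_Tmax] by simp

lemma du_Gb:
  assumes z: "Im z > 0"
  shows "G0b (du z) = G0b (u z) + (- 1) \<cdot>\<^sub>v G0b (u w)"
    "Ghb (du z) = Ghb (u z) + (- 1) \<cdot>\<^sub>v Ghb (u w)"
    "G1b (du z) = G1b (u z) + (- 1) \<cdot>\<^sub>v G1b (u w)"
proof -
  have z0: "Im z \<noteq> 0" using z by simp
  note D1 = Tmax_D[OF sol_Tmax[OF z0 h]] and D2 = Tmax_D[OF sol_Tmax[OF w0 h]]
  note D3 = Tmax_D[OF Tmax_fun_smult[OF sol_Tmax[OF w0 h], of "- 1"]]
  show "G0b (du z) = G0b (u z) + (- 1) \<cdot>\<^sub>v G0b (u w)"
    "Ghb (du z) = Ghb (u z) + (- 1) \<cdot>\<^sub>v Ghb (u w)"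
    "G1b (du z) = G1b (u z) + (- 1) \<cdot>\<^sub>v G1b (u w)"
    unfolding du_def[abs_def] Gb_add[OF D1 D3] Gb_smult[OF D2] by (rule refl)+
qed

lemma du_Gb_carrier:
  assumes z: "Im z > 0"
  shows "G0b (du z) \<in> carrier_vec (r + s)" "Ghb (du z) \<in> carrier_vec q" "G1b (du z) \<in> carrier_vec r"
  using Gb_carrier[OF Tmax_D[OF du_Tmax[OF z]]] by auto

lemma du_Ga:
  assumes z: "Im z > 0"
  shows "G1a S Ut (du z) = 0\<^sub>v p" "Ghb (du z) = Gha S Ut (du z)"
    and "k \<in> carrier_vec (dim0 S) \<Longrightarrow> (M z *\<^sub>v h) \<bullet>c k - (M w *\<^sub>v h) \<bullet>c k =
       G0a S Ut (du z) \<bullet>c vec_first k p + Gha S Ut (du z) \<bullet>c vec_last k q"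
proof -
  have z0: "Im z \<noteq> 0" using z by simp
  have du_eq: "du z = (\<lambda>t. u z t + (- 1) \<cdot>\<^sub>v u w t)" by (simp add: du_def fun_eq_iff)
  note lin = Ga_linear[where y = "u z" and z = "u w" and c = "- 1",
      OF Tmax_carrier[OF sol_Tmax[OF z0 h]] Tmax_carrier[OF sol_Tmax[OF w0 h]], folded du_eq]
  show "G1a S Ut (du z) = 0\<^sub>v p"
    unfolding lin sol_boundary(1)[OF z0 h] sol_boundary(1)[OF w0 h] by (intro eq_vecI) auto
  show "Ghb (du z) = Gha S Ut (du z)"
    unfolding lin du_Gb[OF z] sol_Ghb[OF z0 h] sol_Ghb[OF w0 h]
    by (intro eq_vecI) (auto simp: Gha_def)
  assume k: "k \<in> carrier_vec (dim0 S)"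
  then have k': "k \<in> carrier_vec (p + q)" by (simp add: dim0_def)
  have Mh: "M z *\<^sub>v h \<in> carrier_vec (p + q)" "M w *\<^sub>v h \<in> carrier_vec (p + q)"
    using mult_mat_vec_carrier[OF M_carrier[OF z0] h] mult_mat_vec_carrier[OF M_carrier[OF w0] h]
    by (simp_all add: dim0_def)
  show "(M z *\<^sub>v h) \<bullet>c k - (M w *\<^sub>v h) \<bullet>c k =
       G0a S Ut (du z) \<bullet>c vec_first k p + Gha S Ut (du z) \<bullet>c vec_last k q"
    unfolding cdot_first_last[OF Mh(1) k'] cdot_first_last[OF Mh(2) k'] M_mult(2,3)[OF z0 h] M_mult(2,3)[OF w0 h] lin
    by (simp add: cdot_add_left[of _ p] cdot_add_left[of _ q] cdot_smult_left[of _ p] cdot_smult_left[of _ q])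
qed

text \<open>
  The amount by which the solution at \<open>z\<close> violates the boundary condition at \<open>w\<close>. It is small with \<open>gap\<close>
  because the solution satisfies the condition at \<open>z\<close>.
\<close>

definition defect :: "complex \<Rightarrow> complex vec" where
  "defect z = C0 w *\<^sub>v G0b (u z) + C1 w *\<^sub>v G1b (u z)"

lemma defect_carrier: "Im z \<noteq> 0 \<Longrightarrow> defect z \<in> carrier_vec (r + s)"
  unfolding defect_def
  by (intro add_carrier_vec mult_mat_vec_carrier[OF C_carrier(1)[OF w]] mult_mat_vec_carrier[OF C_carrier(2)[OF w]]
      sol_Gb_carrier h)

text \<open>
  The common bound for the boundary values of \<open>du\<close> at \<open>b\<close>.
\<close>

definition rate :: "complex \<Rightarrow> real" where
  "rate z = wnorm S (du z) + gap z * growth z"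

lemma defect_index:
  assumes z: "Im z > 0" and i: "i < r + s"
  shows "defect z $ i =
    - ((\<Sum>j<r + s. (C0 z $$ (i, j) - C0 w $$ (i, j)) * G0b (u z) $ j) +
       (\<Sum>j<r. (C1 z $$ (i, j) - C1 w $$ (i, j)) * G1b (u z) $ j))"
proof -
  have z0: "Im z \<noteq> 0" using z by simp
  note c = sol_Gb_carrier[OF z0 h] and Cz = C_carrier[OF z] and Cw = C_carrier[OF w]
  have "(C0 z *\<^sub>v G0b (u z)) $ i + (C1 z *\<^sub>v G1b (u z)) $ i = 0"
    using arg_cong[OF sol_boundary(3)[OF z0 h z], of "\<lambda>v. v $ i"] i Cz by (simp add: carrier_matD del: index_mult_mat_vec)
  moreover have "defect z $ i =
      (C0 w *\<^sub>v G0b (u z)) $ i + (C1 w *\<^sub>v G1b (u z)) $ i"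
    unfolding defect_def using i Cw by (simp add: carrier_matD del: index_mult_mat_vec)
  ultimately show ?thesis
    unfolding mult_mat_vec_index_sum[OF Cz(1) c(1) i] mult_mat_vec_index_sum[OF Cz(2) c(2) i]
      mult_mat_vec_index_sum[OF Cw(1) c(1) i] mult_mat_vec_index_sum[OF Cw(2) c(2) i]
      left_diff_distrib sum_subtractf by (simp add: algebra_simps)
qed

lemma defect_bound:
  assumes z: "Im z > 0" and i: "i < r + s"
  shows "cmod (defect z $ i) \<le> gap z * bnorm (u z)"
proof -
  have z0: "Im z \<noteq> 0" using z by simp
  note c = sol_Gb_carrier[OF z0 h]
  let ?x = "G0b (u z)" and ?y = "G1b (u z)"
  have row: "cmod (\<Sum>j<n. a i j * u $ j) \<le> (\<Sum>k<r + s. \<Sum>j<n. cmod (a k j)) * abs_sum u"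
    if "u \<in> carrier_vec n" for a u n
  proof -
    have "cmod (\<Sum>j<n. a i j * u $ j) \<le> (\<Sum>j<n. cmod (a i j * u $ j))" by (rule norm_sum)
    also have "\<dots> \<le> (\<Sum>j<n. cmod (a i j) * abs_sum u)"
      using that by (intro sum_mono) (auto simp: norm_mult intro!: mult_left_mono index_le_abs_sum)
    also have "\<dots> = (\<Sum>j<n. cmod (a i j)) * abs_sum u" by (simp add: sum_distrib_right)
    also have "\<dots> \<le> (\<Sum>k<r + s. \<Sum>j<n. cmod (a k j)) * abs_sum u"
      using i by (intro mult_right_mono member_le_sum[of i _ "\<lambda>k. \<Sum>j<n. cmod (a k j)"]) (auto intro: sum_nonneg)
    finally show ?thesis .
  qed
  have "cmod (defect z $ i) \<le>
      cmod (\<Sum>j<r + s. (C0 z $$ (i, j) - C0 w $$ (i, j)) * ?x $ j) + cmod (\<Sum>j<r. (C1 z $$ (i, j) - C1 w $$ (i, j)) * ?y $ j)"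
    unfolding defect_index[OF z i] norm_minus_cancel by (rule norm_triangle_ineq)
  also have "\<dots> \<le> (\<Sum>k<r + s. \<Sum>j<r + s. cmod (C0 z $$ (k, j) - C0 w $$ (k, j))) * abs_sum ?x +
      (\<Sum>k<r + s. \<Sum>j<r. cmod (C1 z $$ (k, j) - C1 w $$ (k, j))) * abs_sum ?y"
    by (intro add_mono row[OF c(1)] row[OF c(2)])
  also have "\<dots> \<le> gap z * abs_sum ?x + gap z * abs_sum ?y"
    by (intro add_mono mult_right_mono) (auto simp: gap_def intro!: sum_nonneg add_nonneg_nonneg)
  finally show ?thesis by (simp add: bnorm_def algebra_simps)
qed

definition refsize :: real where
  "refsize = 1 + wnorm S (u w) + bnorm (u w)"

lemma refsize_ge: "1 \<le> refsize" using sol_L2[OF w0 h] by (simp add: refsize_def)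

lemma growth_ge:
  assumes z: "Im z > 0"
  shows "1 \<le> growth z" "wnorm S (du z) \<le> growth z" "bnorm (du z) \<le> growth z"
  using du_L2[OF z] by (simp_all add: growth_def)

lemma add_le_mult_sizes:
  assumes z: "Im z > 0"
  shows "wnorm S (u w) + wnorm S (du z) \<le> refsize * growth z"
    and "bnorm (u w) + bnorm (du z) \<le> refsize * growth z"
proof -
  have gen: "a + b \<le> A * B" if "0 \<le> a" "0 \<le> b" "1 + a \<le> A" "1 + b \<le> B" for a b A B :: real
  proof -
    have "a + b \<le> (1 + a) * (1 + b)" using that by (simp add: distrib_left distrib_right)
    also have "\<dots> \<le> A * B" using that by (intro mult_mono) auto
    finally show ?thesis .
  qed
  have nn: "0 \<le> wnorm S (u w)" "0 \<le> wnorm S (du z)" using sol_L2[OF w0 h] du_L2[OF z] by auto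
  show "wnorm S (u w) + wnorm S (du z) \<le> refsize * growth z"
    by (rule gen) (use nn in \<open>auto simp: refsize_def growth_def\<close>)
  show "bnorm (u w) + bnorm (du z) \<le> refsize * growth z"
    by (rule gen) (use nn in \<open>auto simp: refsize_def growth_def\<close>)
qed

lemma ip_sol_bound:
  assumes z: "Im z > 0" and f: "f \<in> L2fun S"
  shows "cmod (ip S (u z) f) \<le> refsize * growth z * wnorm S f"
proof -
  have "ip S (u z) f = ip S (u w) f + ip S (du z) f" using ip_du_left(1)[OF z f] by simp
  then have "cmod (ip S (u z) f) \<le> cmod (ip S (u w) f) + cmod (ip S (du z) f)"
    by (simp only: norm_triangle_ineq)
  also have "\<dots> \<le> (wnorm S (u w) + wnorm S (du z)) * wnorm S f"
    using ip_Cauchy_Schwarz[OF sol_L2[OF w0 h] f] ip_Cauchy_Schwarz[OF du_L2[OF z] f] by (simp add: algebra_simps)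
  also have "\<dots> \<le> refsize * growth z * wnorm S f"
    using add_le_mult_sizes(1)[OF z] f by (intro mult_right_mono) auto
  finally show ?thesis .
qed

lemma bnorm_sol_bound:
  assumes z: "Im z > 0"
  shows "bnorm (u z) \<le> refsize * growth z"
proof -
  have z0: "Im z \<noteq> 0" using z by simp
  note c = sol_Gb_carrier[OF z0 h] sol_Gb_carrier[OF w0 h]
  have tri: "abs_sum x \<le> abs_sum y + abs_sum (x + (- 1) \<cdot>\<^sub>v y)" if "x \<in> carrier_vec n" "y \<in> carrier_vec n" for x y n
  proof -
    have "cmod (x $ i) \<le> cmod (y $ i) + cmod ((x + (- 1) \<cdot>\<^sub>v y) $ i)" if "i < n" for i
      using norm_triangle_ineq[of "y $ i" "x $ i - y $ i"] that \<open>x \<in> carrier_vec n\<close> \<open>y \<in> carrier_vec n\<close> by simp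
    then have "(\<Sum>i<n. cmod (x $ i)) \<le> (\<Sum>i<n. cmod (y $ i) + cmod ((x + (- 1) \<cdot>\<^sub>v y) $ i))"
      by (intro sum_mono) simp
    then show ?thesis using that by (simp add: abs_sum_def sum.distrib)
  qed
  have "bnorm (u z) \<le> bnorm (u w) + bnorm (du z)"
    unfolding bnorm_def du_Gb[OF z] using tri[OF c(1) c(3)] tri[OF c(2) c(4)] by simp
  then show ?thesis using add_le_mult_sizes(2)[OF z] by simp
qed

lemma defect_cdot_bound:
  assumes z: "Im z > 0" and x: "x \<in> carrier_vec (r + s)"
  shows "cmod (defect z \<bullet>c x) \<le> refsize * abs_sum x * (gap z * growth z)"
proof -
  have z0: "Im z \<noteq> 0" using z by simp
  note v = defect_carrier[OF z0]
  have "cmod (defect z \<bullet>c x) \<le> (gap z * bnorm (u z)) * abs_sum x"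
    by (rule cdot_le_abs_sum[OF v x defect_bound[OF z]])
  also have "\<dots> \<le> (gap z * (refsize * growth z)) * abs_sum x"
    using bnorm_sol_bound[OF z] gap_bounds(2) by (intro mult_right_mono mult_left_mono) auto
  finally show ?thesis by (simp add: mult_ac)
qed

text \<open>
  \<open>sol_identity\<close> for \<open>v(z) h\<close> and \<open>v(cnj w) k\<close>; the form \<open>\<beta>\<close> reduces to the defect by \<open>bform_compat\<close>.
\<close>

lemma M_difference_identity:
  assumes k: "k \<in> carrier_vec (dim0 S)"
  obtains x where "x \<in> carrier_vec (r + s)"
    "\<And>z. Im z > 0 \<Longrightarrow> (M z *\<^sub>v h) \<bullet>c k - (M w *\<^sub>v h) \<bullet>c k =
       (z - w) * ip S (u z) (sol (cnj w) k) + defect z \<bullet>c x"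
proof -
  obtain x where x: "x \<in> carrier_vec (r + s)"
    "\<And>z. Im z > 0 \<Longrightarrow>
       (z - w) * ip S (u z) (sol (cnj w) k) =
         - (defect z \<bullet>c x) + (M z *\<^sub>v h) \<bullet>c k - h \<bullet>c (M (cnj w) *\<^sub>v k)"
    using sol_compat[OF w k] h unfolding defect_def by metis
  have "h \<bullet>c (M (cnj w) *\<^sub>v k) = (M w *\<^sub>v h) \<bullet>c k"
    using cdot_adjoint[OF M_carrier[OF w0] h k] M_adjoint[OF w0] by simp
  then show ?thesis using that[OF x(1)] x(2) by (simp add: algebra_simps)
qed

lemma M_difference_bound:
  assumes k: "k \<in> carrier_vec (dim0 S)"
  obtains c where "0 \<le> c"
    "\<And>z. Im z > 0 \<Longrightarrow> cmod ((M z *\<^sub>v h) \<bullet>c k - (M w *\<^sub>v h) \<bullet>c k) \<le> c * (gap z * growth z)"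
proof -
  have w': "Im (cnj w) \<noteq> 0" using w by simp
  note L = sol_L2[OF w' k]
  obtain x where x: "x \<in> carrier_vec (r + s)"
    "\<And>z. Im z > 0 \<Longrightarrow> (M z *\<^sub>v h) \<bullet>c k - (M w *\<^sub>v h) \<bullet>c k =
       (z - w) * ip S (u z) (sol (cnj w) k) + defect z \<bullet>c x"
    using M_difference_identity[OF k] by blast
  define c where "c = refsize * wnorm S (sol (cnj w) k) + refsize * abs_sum x"
  show ?thesis
  proof (rule that[of c])
    show "0 \<le> c" using refsize_ge L by (simp add: c_def)
    fix z assume z: "Im z > 0"
    have "cmod ((z - w) * ip S (u z) (sol (cnj w) k)) \<le> gap z * (refsize * growth z * wnorm S (sol (cnj w) k))"
      unfolding norm_mult using gap_bounds[of z] by (intro mult_mono ip_sol_bound[OF z L]) auto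
    then have "cmod ((M z *\<^sub>v h) \<bullet>c k - (M w *\<^sub>v h) \<bullet>c k) \<le>
        gap z * (refsize * growth z * wnorm S (sol (cnj w) k)) + refsize * abs_sum x * (gap z * growth z)"
      unfolding x(2)[OF z] using defect_cdot_bound[OF z x(1)] norm_triangle_mono by blast
    then show "cmod ((M z *\<^sub>v h) \<bullet>c k - (M w *\<^sub>v h) \<bullet>c k) \<le> c * (gap z * growth z)"
      by (simp add: c_def algebra_simps)
  qed
qed

lemma rate_ge:
  assumes z: "Im z > 0"
  shows "wnorm S (du z) \<le> rate z" "gap z * growth z \<le> rate z"
  using gap_bounds(2)[of z] growth_ge(1)[OF z] du_L2[OF z] by (simp_all add: rate_def)

text \<open>
  Pairing \<open>du\<close> with a fixed element of the domain: Green's identity expresses the boundary form at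
  \<open>b\<close> by inner products, which are bounded by \<open>wnorm\<close>, and by the values at \<open>a\<close>, which are those of
  \<open>m(z) h - m(w) h\<close>.
\<close>

lemma du_form_bound:
  assumes zT: "(y, f) \<in> Tmax_fun S" and yh: "Ghb y = 0\<^sub>v q"
  obtains c where "0 \<le> c"
    "\<And>z. Im z > 0 \<Longrightarrow> cmod (bform r s (G0b (du z)) (G1b (du z)) (G0b y) (G1b y)) \<le> c * rate z"
proof -
  note L = Tmax_L2[OF zT]
  (* The last boundary value of du at a vanishes, so the form at a is the pairing of
     m(z) h - m(w) h with this k. *)
  define k where "k = G1a S Ut y @\<^sub>v (- \<i>) \<cdot>\<^sub>v Gha S Ut y"
  have k: "k \<in> carrier_vec (dim0 S)" by (auto simp: k_def dim0_def intro!: append_carrier_vec)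
  have k12: "vec_first k p = G1a S Ut y" "vec_last k q = (- \<i>) \<cdot>\<^sub>v Gha S Ut y"
    unfolding k_def by (intro eq_vecI; auto simp: vec_first_def vec_last_def G1a_def Gha_def)+
  obtain c0 where c0: "0 \<le> c0"
    "\<And>z. Im z > 0 \<Longrightarrow> cmod ((M z *\<^sub>v h) \<bullet>c k - (M w *\<^sub>v h) \<bullet>c k) \<le> c0 * (gap z * growth z)"
    using M_difference_bound[OF k] by blast
  define c where "c = c0 + cmod w * wnorm S y + wnorm S f + refsize * wnorm S y"
  show ?thesis
  proof (rule that[of c])
    show "0 \<le> c" using c0 L refsize_ge by (simp add: c_def)
    fix z assume z: "Im z > 0"
    let ?d = "du z"
    define b m where "b = bform r s (G0b ?d) (G1b ?d) (G0b y) (G1b y)"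
      and "m = (M z *\<^sub>v h) \<bullet>c k - (M w *\<^sub>v h) \<bullet>c k"
    have m: "m = G0a S Ut ?d \<bullet>c G1a S Ut y + \<i> * (Gha S Ut ?d \<bullet>c Gha S Ut y)"
      unfolding m_def du_Ga(3)[OF z k] k12 by (simp add: cdot_smult_right[of _ q])
    have beq: "b = w * ip S ?d y + (z - w) * ip S (u z) y - ip S ?d f + m"
      using Green_boundary[OF du_Tmax[OF z] zT] du_Gb_carrier(2)[OF z]
      unfolding ip_du_left(2)[OF z L(1)] du_Ga(1)[OF z] yh m b_def[symmetric]
      by (simp add: cdot_eq_sum[of _ p] cdot_eq_sum[of _ q] algebra_simps)
    have "cmod b \<le> cmod (w * ip S ?d y) + cmod ((z - w) * ip S (u z) y) + cmod (ip S ?d f) + cmod m"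
      unfolding beq using norm_triangle_ineq[of "w * ip S ?d y + (z - w) * ip S (u z) y - ip S ?d f" m]
        norm_triangle_ineq4[of "w * ip S ?d y + (z - w) * ip S (u z) y" "ip S ?d f"]
        norm_triangle_ineq[of "w * ip S ?d y" "(z - w) * ip S (u z) y"] by linarith
    moreover have "cmod (w * ip S ?d y) \<le> cmod w * wnorm S y * rate z"
      using mult_left_mono[OF ip_Cauchy_Schwarz[OF du_L2[OF z] L(1)], of "cmod w"]
        mult_left_mono[OF rate_ge(1)[OF z], of "cmod w * wnorm S y"] L by (simp add: norm_mult mult_ac)
    moreover have "cmod ((z - w) * ip S (u z) y) \<le> refsize * wnorm S y * rate z"
    proof -
      have "cmod ((z - w) * ip S (u z) y) \<le> gap z * (refsize * growth z * wnorm S y)"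
        unfolding norm_mult using gap_bounds[of z] by (intro mult_mono ip_sol_bound[OF z L(1)]) auto
      then show ?thesis
        using mult_left_mono[OF rate_ge(2)[OF z], of "refsize * wnorm S y"] refsize_ge L by (simp add: mult_ac)
    qed
    moreover have "cmod (ip S ?d f) \<le> wnorm S f * rate z"
      using ip_Cauchy_Schwarz[OF du_L2[OF z] L(2)] mult_left_mono[OF rate_ge(1)[OF z], of "wnorm S f"] L
      by (simp add: mult_ac)
    moreover have "cmod m \<le> c0 * rate z"
      using c0(2)[OF z] mult_left_mono[OF rate_ge(2)[OF z] c0(1)] by (simp add: m_def)
    ultimately show "cmod (bform r s (G0b ?d) (G1b ?d) (G0b y) (G1b y)) \<le> c * rate z"
      unfolding b_def[symmetric] c_def distrib_right by linarith
  qed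
qed

text \<open>
  Surjectivity of the boundary map at \<open>b\<close> provides elements of the domain whose pairing with \<open>du\<close> is a
  single coordinate of its boundary values.
\<close>

lemma du_component_bounds:
  shows "i < r + s \<Longrightarrow> \<exists>c\<ge>0. \<forall>z. Im z > 0 \<longrightarrow> cmod (G0b (du z) $ i) \<le> c * rate z"
    and "i < r \<Longrightarrow> \<exists>c\<ge>0. \<forall>z. Im z > 0 \<longrightarrow> cmod (G1b (du z) $ i) \<le> c * rate z"
proof -
  have unit: "unit_vec n i $ j = (if j = i then 1 else (0 :: complex))" if "j < n" for n i j
    using that by (simp add: unit_vec_def)
  have delta: "(\<Sum>j<n. a j * cnj (if j = i then 1 else 0)) = a i" if "i < n" for n i and a :: "nat \<Rightarrow> complex"
    using that by (simp add: if_distrib[of cnj] if_distrib[of "\<lambda>x. _ * x"] cong: if_cong)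
  have test: "\<exists>c\<ge>0. \<forall>z. Im z > 0 \<longrightarrow> cmod (f z) \<le> c * rate z"
    if x: "x0 \<in> carrier_vec (r + s)" "x1 \<in> carrier_vec r"
      and f: "\<And>z. Im z > 0 \<Longrightarrow> cmod (bform r s (G0b (du z)) (G1b (du z)) x0 x1) = cmod (f z)" for x0 x1 and f :: "complex \<Rightarrow> complex"
  proof -
    obtain y g where y: "(y, g) \<in> Tmax_fun S" "G0b y = x0" "Ghb y = 0\<^sub>v q" "G1b y = x1"
      using Gb_surj[OF x(1) zero_carrier_vec x(2)] by metis
    obtain c where "0 \<le> c" "\<And>z. Im z > 0 \<Longrightarrow> cmod (bform r s (G0b (du z)) (G1b (du z)) x0 x1) \<le> c * rate z"
      using du_form_bound[OF y(1,3)] unfolding y by blast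
    then show ?thesis using f by auto
  qed
  show "\<exists>c\<ge>0. \<forall>z. Im z > 0 \<longrightarrow> cmod (G0b (du z) $ i) \<le> c * rate z" if i: "i < r + s"
  proof (cases "i < r")
    case True
    show ?thesis
    proof (rule test[OF zero_carrier_vec unit_vec_carrier])
      fix z assume z: "Im z > 0"
      show "cmod (bform r s (G0b (du z)) (G1b (du z)) (0\<^sub>v (r + s)) (unit_vec r i)) = cmod (G0b (du z) $ i)"
        using True unfolding bform_eq_sum[OF du_Gb_carrier(1)[OF z] zero_carrier_vec du_Gb_carrier(3)[OF z] unit_vec_carrier]
        by (simp add: unit delta)
    qed
  next
    case False
    obtain j where j: "i = r + j" "j < s" using False i by (metis add_less_cancel_left le_add_diff_inverse not_less)
    show ?thesis
    proof (rule test[OF unit_vec_carrier zero_carrier_vec])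
      fix z assume z: "Im z > 0"
      show "cmod (bform r s (G0b (du z)) (G1b (du z)) (unit_vec (r + s) i) (0\<^sub>v r)) = cmod (G0b (du z) $ i)"
        using j unfolding bform_eq_sum[OF du_Gb_carrier(1)[OF z] unit_vec_carrier du_Gb_carrier(3)[OF z] zero_carrier_vec]
        by (simp add: unit delta norm_mult)
    qed
  qed
  show "\<exists>c\<ge>0. \<forall>z. Im z > 0 \<longrightarrow> cmod (G1b (du z) $ i) \<le> c * rate z" if i: "i < r"
  proof (rule test[OF unit_vec_carrier zero_carrier_vec])
    fix z assume z: "Im z > 0"
    show "cmod (bform r s (G0b (du z)) (G1b (du z)) (unit_vec (r + s) i) (0\<^sub>v r)) = cmod (G1b (du z) $ i)"
      using i unfolding bform_eq_sum[OF du_Gb_carrier(1)[OF z] unit_vec_carrier du_Gb_carrier(3)[OF z] zero_carrier_vec]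
      by (simp add: unit delta sum_negf)
  qed
qed

lemma bnorm_du_bound:
  obtains c where "0 \<le> c"
    "\<And>z. Im z > 0 \<Longrightarrow> bnorm (du z) \<le> c * rate z"
proof -
  have "\<forall>i\<in>{..<r + s}. \<exists>c\<ge>0. \<forall>z. Im z > 0 \<longrightarrow> cmod (G0b (du z) $ i) \<le> c * rate z"
    using du_component_bounds(1) by simp
  from bchoice[OF this] obtain c0 where c0: "\<And>i. i < r + s \<Longrightarrow> 0 \<le> c0 i"
    "\<And>i z. i < r + s \<Longrightarrow> Im z > 0 \<Longrightarrow> cmod (G0b (du z) $ i) \<le> c0 i * rate z" by auto
  have "\<forall>i\<in>{..<r}. \<exists>c\<ge>0. \<forall>z. Im z > 0 \<longrightarrow> cmod (G1b (du z) $ i) \<le> c * rate z"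
    using du_component_bounds(2) by simp
  from bchoice[OF this] obtain c1 where c1: "\<And>i. i < r \<Longrightarrow> 0 \<le> c1 i"
    "\<And>i z. i < r \<Longrightarrow> Im z > 0 \<Longrightarrow> cmod (G1b (du z) $ i) \<le> c1 i * rate z" by auto
  show ?thesis
  proof (rule that[of "(\<Sum>i<r + s. c0 i) + (\<Sum>i<r. c1 i)"])
    show "0 \<le> (\<Sum>i<r + s. c0 i) + (\<Sum>i<r. c1 i)"
      using c0 c1 by (intro add_nonneg_nonneg sum_nonneg) auto
    fix z assume z: "Im z > 0"
    have "bnorm (du z) = (\<Sum>i<r + s. cmod (G0b (du z) $ i)) + (\<Sum>i<r. cmod (G1b (du z) $ i))"
      using du_Gb_carrier[OF z] by (simp add: bnorm_def abs_sum_def)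
    also have "\<dots> \<le> (\<Sum>i<r + s. c0 i * rate z) + (\<Sum>i<r. c1 i * rate z)"
      using c0 c1 z by (intro add_mono sum_mono) auto
    finally show "bnorm (du z) \<le> ((\<Sum>i<r + s. c0 i) + (\<Sum>i<r. c1 i)) * rate z"
      by (simp add: sum_distrib_right distrib_right)
  qed
qed

text \<open>
  The energy estimate: Green's identity for \<open>du\<close> paired with itself. By \<open>du_Ga\<close> the
  boundary terms reduce to \<open>\<beta>\<close>, and \<open>Im \<beta>\<close> is bounded above by a multiple of the defect at \<open>w\<close>.
\<close>

lemma wnorm_du_bound:
  obtains c where "0 \<le> c"
    "\<And>z. Im z > 0 \<Longrightarrow> (wnorm S (du z))\<^sup>2 \<le> c * (gap z * (growth z)\<^sup>2)"
proof -
  obtain Y where Y: "Y \<in> carrier_mat (r + s) (r + s)"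
    "\<And>w0 w1. w0 \<in> carrier_vec (r + s) \<Longrightarrow> w1 \<in> carrier_vec r \<Longrightarrow>
      Im (bform r s w0 w1 w0 w1) \<le> 2 * Re ((C0 w *\<^sub>v w0 + C1 w *\<^sub>v w1) \<bullet>c (Y *\<^sub>v cayley_vec r s w0 w1))"
    using bform_upper_bound[OF w] by blast
  define Yn where "Yn = (\<Sum>k<r + s. \<Sum>j<r + s. cmod (Y $$ (k, j)))"
  have Yn: "0 \<le> Yn" by (simp add: Yn_def sum_nonneg)
  define c where "c = (refsize + refsize * ((r + s) * (Yn * (r + s)))) / Im w"
  show ?thesis
  proof (rule that[of c])
    show "0 \<le> c" using Yn refsize_ge w by (auto simp: c_def intro!: divide_nonneg_pos add_nonneg_nonneg mult_nonneg_nonneg)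
    fix z assume z: "Im z > 0"
    then have z0: "Im z \<noteq> 0" by simp
    define W P e where "W = wnorm S (du z)" and "P = growth z" and "e = gap z"
    have e0: "0 \<le> e" using gap_bounds(2) by (simp add: e_def)
    have W0: "0 \<le> W" "W \<le> P" "1 \<le> P" "bnorm (du z) \<le> P"
      using du_L2[OF z] growth_ge[OF z] by (auto simp: W_def P_def)
    note dT = du_Tmax[OF z] and dL = du_L2[OF z] and gc = du_Gb_carrier[OF z]
    define x where "x = Y *\<^sub>v cayley_vec r s (G0b (du z)) (G1b (du z))"
    have x: "x \<in> carrier_vec (r + s)" unfolding x_def by (rule mult_mat_vec_carrier[OF Y(1) cayley_vec_carrier])
    define b where "b = bform r s (G0b (du z)) (G1b (du z)) (G0b (du z)) (G1b (du z))"
    have "ip S (\<lambda>t. z \<cdot>\<^sub>v u z t + (- 1) \<cdot>\<^sub>v (w \<cdot>\<^sub>v u w t)) (du z) -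
        ip S (du z) (\<lambda>t. z \<cdot>\<^sub>v u z t + (- 1) \<cdot>\<^sub>v (w \<cdot>\<^sub>v u w t)) = b"
      unfolding Green_boundary[OF dT dT] du_Ga(1,2)[OF z] b_def by (simp add: cdot_eq_sum[of _ p] G0a_def)
    moreover have "ip S (du z) (\<lambda>t. z \<cdot>\<^sub>v u z t + (- 1) \<cdot>\<^sub>v (w \<cdot>\<^sub>v u w t)) =
        cnj (ip S (\<lambda>t. z \<cdot>\<^sub>v u z t + (- 1) \<cdot>\<^sub>v (w \<cdot>\<^sub>v u w t)) (du z))"
      using ip_cnj[OF Tmax_L2(2)[OF dT] dL] by simp
    moreover have "Im b = 2 * Im X" if "X - X' = b" "X' = cnj X" for X X' using that by auto
    ultimately have "Im b = 2 * Im (ip S (\<lambda>t. z \<cdot>\<^sub>v u z t + (- 1) \<cdot>\<^sub>v (w \<cdot>\<^sub>v u w t)) (du z))"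
      by blast
    also have "\<dots> = 2 * Im (w * ip S (du z) (du z) + (z - w) * ip S (u z) (du z))"
      unfolding ip_du_left(2)[OF z dL] ..
    also have "\<dots> = 2 * Im w * W\<^sup>2 + 2 * Im ((z - w) * ip S (u z) (du z))"
      unfolding ip_self(3)[OF dL] W_def by simp
    finally have energy: "Im b = 2 * Im w * W\<^sup>2 + 2 * Im ((z - w) * ip S (u z) (du z))" .
    have "Im b \<le> 2 * Re (defect z \<bullet>c x)"
    proof -
      have v: "C0 w *\<^sub>v G0b (u z) \<in> carrier_vec (r + s)" "C1 w *\<^sub>v G1b (u z) \<in> carrier_vec (r + s)"
        "C0 w *\<^sub>v G0b (u w) \<in> carrier_vec (r + s)" "C1 w *\<^sub>v G1b (u w) \<in> carrier_vec (r + s)"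
        using mult_mat_vec_carrier[OF C_carrier(1)[OF w] sol_Gb_carrier(1)[OF z0 h]] mult_mat_vec_carrier[OF C_carrier(2)[OF w] sol_Gb_carrier(2)[OF z0 h]]
          mult_mat_vec_carrier[OF C_carrier(1)[OF w] sol_Gb_carrier(1)[OF w0 h]] mult_mat_vec_carrier[OF C_carrier(2)[OF w] sol_Gb_carrier(2)[OF w0 h]] by auto
      have "C0 w *\<^sub>v G0b (du z) + C1 w *\<^sub>v G1b (du z) =
          (C0 w *\<^sub>v G0b (u z) + (- 1) \<cdot>\<^sub>v (C0 w *\<^sub>v G0b (u w))) + (C1 w *\<^sub>v G1b (u z) + (- 1) \<cdot>\<^sub>v (C1 w *\<^sub>v G1b (u w)))"
        unfolding du_Gb[OF z] using sol_Gb_carrier[OF z0 h] sol_Gb_carrier[OF w0 h] C_carrier[OF w]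
        by (simp add: mult_add_distrib_mat_vec[of _ "r + s" "r + s"] mult_add_distrib_mat_vec[of _ "r + s" r]
            mult_mat_vec[of _ "r + s" "r + s"] mult_mat_vec[of _ "r + s" r])
      also have "\<dots> = defect z + (- 1) \<cdot>\<^sub>v (C0 w *\<^sub>v G0b (u w) + C1 w *\<^sub>v G1b (u w))"
      proof -
        have "(a + (- 1) \<cdot>\<^sub>v b) + (c + (- 1) \<cdot>\<^sub>v d) = (a + c) + (- 1) \<cdot>\<^sub>v (b + d)"
          if "a \<in> carrier_vec n" "b \<in> carrier_vec n" "c \<in> carrier_vec n" "d \<in> carrier_vec n" for a b c d :: "complex vec" and n
          using that by (intro eq_vecI) auto
        from this[OF v(1,3,2,4)] show ?thesis unfolding defect_def .
      qed
      also have "\<dots> = defect z"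
        unfolding sol_boundary(3)[OF w0 h w] using add_carrier_vec[OF v(1,2), folded defect_def] by (intro eq_vecI) auto
      finally show ?thesis using Y(2)[OF gc(1) gc(3)] unfolding b_def x_def by simp
    qed
    with energy have "2 * Im w * W\<^sup>2 \<le> 2 * Re (defect z \<bullet>c x) - 2 * Im ((z - w) * ip S (u z) (du z))" by simp
    also have "\<dots> \<le> 2 * cmod (defect z \<bullet>c x) + 2 * cmod ((z - w) * ip S (u z) (du z))"
      using complex_Re_le_cmod[of "defect z \<bullet>c x"] abs_Im_le_cmod[of "(z - w) * ip S (u z) (du z)"] by linarith
    finally have main: "Im w * W\<^sup>2 \<le> cmod (defect z \<bullet>c x) + cmod ((z - w) * ip S (u z) (du z))" by simp
    have "cmod ((z - w) * ip S (u z) (du z)) \<le> e * (refsize * P * W)"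
      unfolding norm_mult e_def P_def W_def using gap_bounds[of z]
      by (intro mult_mono ip_sol_bound[OF z dL]) auto
    also have "\<dots> \<le> e * (refsize * P * P)"
      using e0 refsize_ge W0 by (intro mult_left_mono) auto
    finally have b1: "cmod ((z - w) * ip S (u z) (du z)) \<le> refsize * (e * P\<^sup>2)" by (simp add: power2_eq_square mult_ac)
    have cay: "abs_sum (cayley_vec r s (G0b (du z)) (G1b (du z))) \<le> (r + s) * P"
    proof -
      have "cmod (cayley_vec r s (G0b (du z)) (G1b (du z)) $ i) \<le> P" if i: "i < r + s" for i
      proof -
        have g0: "cmod (G0b (du z) $ i) \<le> abs_sum (G0b (du z))"
          using gc(1) i by (intro index_le_abs_sum) simp
        have g1: "cmod (G1b (du z) $ i) \<le> abs_sum (G1b (du z))" if "i < r"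
          using gc(3) that by (intro index_le_abs_sum) simp
        have "cmod (cayley_vec r s (G0b (du z)) (G1b (du z)) $ i) \<le> bnorm (du z)"
        proof (cases "i < r")
          case True
          then show ?thesis
            using norm_triangle_ineq[of "G0b (du z) $ i" "\<i> * G1b (du z) $ i"] g0 g1 i
            by (simp add: cayley_vec_def bnorm_def norm_mult)
        next
          case False
          then have idx: "cayley_vec r s (G0b (du z)) (G1b (du z)) $ i = G0b (du z) $ i"
            using i by (simp add: cayley_vec_def)
          show ?thesis unfolding bnorm_def idx using g0 abs_sum_nonneg[of "G1b (du z)"] by linarith
        qed
        then show ?thesis using W0 by simp
      qed
      then show ?thesis by (rule abs_sum_le[OF cayley_vec_carrier])
    qed
    have "abs_sum x \<le> (r + s) * (Yn * ((r + s) * P))"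
    proof -
      have "cmod (x $ i) \<le> Yn * ((r + s) * P)" if "i < r + s" for i
        using mult_mat_vec_abs_sum[OF Y(1) cayley_vec_carrier that] mult_left_mono[OF cay Yn] unfolding x_def Yn_def
        by (rule order_trans)
      then show ?thesis by (rule abs_sum_le[OF x])
    qed
    then have xb: "abs_sum x \<le> (r + s) * (Yn * (r + s)) * P" by (simp add: mult_ac)
    have "cmod (defect z \<bullet>c x) \<le> refsize * abs_sum x * (e * P)"
      unfolding e_def P_def by (rule defect_cdot_bound[OF z x])
    also have "\<dots> \<le> refsize * ((r + s) * (Yn * (r + s)) * P) * (e * P)"
      using xb refsize_ge e0 W0 by (intro mult_right_mono mult_left_mono) auto
    finally have b2: "cmod (defect z \<bullet>c x) \<le> refsize * ((r + s) * (Yn * (r + s))) * (e * P\<^sup>2)" by (simp add: power2_eq_square mult_ac)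
    have "Im w * W\<^sup>2 \<le> (refsize + refsize * ((r + s) * (Yn * (r + s)))) * (e * P\<^sup>2)"
      using main b1 b2 by (simp add: distrib_right)
    then have "W\<^sup>2 \<le> (refsize + refsize * ((r + s) * (Yn * (r + s)))) * (e * P\<^sup>2) / Im w"
      using w by (simp add: pos_le_divide_eq mult.commute)
    then show "(wnorm S (du z))\<^sup>2 \<le> c * (gap z * (growth z)\<^sup>2)"
      by (simp add: c_def W_def e_def P_def)
  qed
qed

lemma gap_tendsto: "(gap \<longlongrightarrow> 0) (at w)"
proof -
  have "((\<lambda>z. C0 z $$ (i, j) - C0 w $$ (i, j)) \<longlongrightarrow> 0) (at w)" if "i < r + s" "j < r + s" for i j
    using C_deriv(1)[OF w that] by (auto intro!: LIM_zero isContD dest: DERIV_isCont)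
  moreover have "((\<lambda>z. C1 z $$ (i, j) - C1 w $$ (i, j)) \<longlongrightarrow> 0) (at w)" if "i < r + s" "j < r" for i j
    using C_deriv(2)[OF w that] by (auto intro!: LIM_zero isContD dest: DERIV_isCont)
  moreover have "((\<lambda>z. z - w) \<longlongrightarrow> 0) (at w)" by (rule LIM_zero) simp
  ultimately have "((\<lambda>z. cmod (z - w) + (\<Sum>i<r + s. \<Sum>j<r + s. cmod (C0 z $$ (i, j) - C0 w $$ (i, j)))
     + (\<Sum>i<r + s. \<Sum>j<r. cmod (C1 z $$ (i, j) - C1 w $$ (i, j)))) \<longlongrightarrow> 0) (at w)"
    by (intro tendsto_add_zero tendsto_null_sum tendsto_norm_zero) auto
  then show ?thesis by (simp add: gap_def[abs_def])
qed

lemma eventually_upper: "\<forall>\<^sub>F z in at w. Im z > 0"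
  using eventually_at_in_open'[OF open_halfspace_Im_gt, of w 0] w by simp

lemma du_tendsto:
  shows "((\<lambda>z. wnorm S (du z)) \<longlongrightarrow> 0) (at w)" "((\<lambda>z. bnorm (du z)) \<longlongrightarrow> 0) (at w)"
proof -
  obtain c1 where c1: "0 \<le> c1"
    "\<And>z. Im z > 0 \<Longrightarrow> bnorm (du z) \<le> c1 * rate z"
    using bnorm_du_bound by blast
  obtain c2 where c2: "0 \<le> c2"
    "\<And>z. Im z > 0 \<Longrightarrow> (wnorm S (du z))\<^sup>2 \<le> c2 * (gap z * (growth z)\<^sup>2)"
    using wnorm_du_bound by blast
  have nn: "0 \<le> wnorm S (du z) \<and> 0 \<le> bnorm (du z) \<and> 0 \<le> gap z" if "Im z > 0" for z
    using du_L2[OF that] gap_bounds(2) by simp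
  have b1: "bnorm (du z) \<le> max c1 c2 * rate z" if z: "Im z > 0" for z
  proof -
    have "0 \<le> rate z" using rate_ge(1)[OF z] nn[OF z] by linarith
    then show ?thesis using c1(2)[OF z] mult_right_mono[of c1 "max c1 c2" "rate z"] by simp
  qed
  have b2: "(wnorm S (du z))\<^sup>2 \<le> max c1 c2 * gap z * (growth z)\<^sup>2" if z: "Im z > 0" for z
    using c2(2)[OF z] nn[OF z] unfolding mult.assoc
    by (elim order_trans) (intro mult_right_mono mult_nonneg_nonneg; simp)
  have c: "0 \<le> max c1 c2" using c1(1) by simp
  have ev: "\<forall>\<^sub>F z in at w. 0 \<le> wnorm S (du z) \<and> 0 \<le> bnorm (du z) \<and> 0 \<le> gap z"
    "\<forall>\<^sub>F z in at w. (wnorm S (du z))\<^sup>2 \<le> max c1 c2 * gap z * (1 + wnorm S (du z) + bnorm (du z))\<^sup>2"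
    "\<forall>\<^sub>F z in at w. bnorm (du z) \<le> max c1 c2 * (wnorm S (du z) + gap z * (1 + wnorm S (du z) + bnorm (du z)))"
    using nn b1 b2 unfolding rate_def growth_def by (auto intro: eventually_mono[OF eventually_upper])
  show "((\<lambda>z. wnorm S (du z)) \<longlongrightarrow> 0) (at w)" "((\<lambda>z. bnorm (du z)) \<longlongrightarrow> 0) (at w)"
    using coupled_smallness[OF gap_tendsto c ev] by auto
qed

lemma ip_sol_tendsto:
  assumes f: "f \<in> L2fun S"
  shows "((\<lambda>z. ip S (u z) f) \<longlongrightarrow> ip S (u w) f) (at w)"
proof (rule LIM_zero_cancel, rule Lim_null_comparison)
  show "\<forall>\<^sub>F z in at w. norm (ip S (u z) f - ip S (u w) f) \<le> wnorm S (du z) * wnorm S f"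
    using eventually_upper
  proof eventually_elim
    case (elim z)
    then show ?case
      using ip_Cauchy_Schwarz[OF du_L2[OF elim] f] ip_du_left(1)[OF elim f] by simp
  qed
  show "((\<lambda>z. wnorm S (du z) * wnorm S f) \<longlongrightarrow> 0) (at w)"
    by (rule tendsto_mult_left_zero[OF du_tendsto(1)])
qed

lemma Gb_sol_tendsto:
  shows "i < r + s \<Longrightarrow> ((\<lambda>z. G0b (u z) $ i) \<longlongrightarrow> G0b (u w) $ i) (at w)"
    and "i < r \<Longrightarrow> ((\<lambda>z. G1b (u z) $ i) \<longlongrightarrow> G1b (u w) $ i) (at w)"
proof -
  have lim: "(f \<longlongrightarrow> f w) (at w)" if "\<And>z. Im z > 0 \<Longrightarrow> cmod (f z - f w) \<le> bnorm (du z)" for f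
    by (rule LIM_zero_cancel, rule Lim_null_comparison[OF _ du_tendsto(2)])
      (rule eventually_mono[OF eventually_upper], use that in simp)
  have diff: "cmod (a $ i - b $ i) \<le> abs_sum (a + (- 1) \<cdot>\<^sub>v b)" if "b \<in> carrier_vec n" "i < n" for a b i n
    using index_le_abs_sum[of i "a + (- 1) \<cdot>\<^sub>v b"] that by simp
  show "((\<lambda>z. G0b (u z) $ i) \<longlongrightarrow> G0b (u w) $ i) (at w)" if "i < r + s"
    by (rule lim) (use diff[OF sol_Gb_carrier(1)[OF w0 h] that] in \<open>simp add: bnorm_def du_Gb add_increasing2\<close>)
  show "((\<lambda>z. G1b (u z) $ i) \<longlongrightarrow> G1b (u w) $ i) (at w)" if "i < r"
    by (rule lim) (use diff[OF sol_Gb_carrier(2)[OF w0 h] that] in \<open>simp add: bnorm_def du_Gb add_increasing\<close>)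
qed

text \<open>
  The difference quotient of \<open>(m(z) h, k)\<close> is given by \<open>M_difference_identity\<close> and \<open>defect_index\<close> as a
  finite expression in continuous functions of \<open>z\<close> and in difference quotients of the entries of \<open>C\<close>.
\<close>

lemma M_form_differentiable:
  assumes k: "k \<in> carrier_vec (dim0 S)"
  shows "\<exists>d. ((\<lambda>z. (M z *\<^sub>v h) \<bullet>c k) has_field_derivative d) (at w)"
proof -
  have w': "Im (cnj w) \<noteq> 0" using w by simp
  note L = sol_L2[OF w' k]
  obtain x where x: "x \<in> carrier_vec (r + s)"
    "\<And>z. Im z > 0 \<Longrightarrow> (M z *\<^sub>v h) \<bullet>c k - (M w *\<^sub>v h) \<bullet>c k =
       (z - w) * ip S (u z) (sol (cnj w) k) + defect z \<bullet>c x"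
    using M_difference_identity[OF k] by blast
  have "\<forall>i\<in>{..<r + s}. \<forall>j\<in>{..<r + s}. \<exists>d. ((\<lambda>z. C0 z $$ (i, j)) has_field_derivative d) (at w)"
    using C_deriv(1)[OF w] by simp
  then obtain d0 where d0: "\<And>i j. i < r + s \<Longrightarrow> j < r + s \<Longrightarrow> ((\<lambda>z. C0 z $$ (i, j)) has_field_derivative d0 i j) (at w)"
    by (metis lessThan_iff)
  have "\<forall>i\<in>{..<r + s}. \<forall>j\<in>{..<r}. \<exists>d. ((\<lambda>z. C1 z $$ (i, j)) has_field_derivative d) (at w)"
    using C_deriv(2)[OF w] by simp
  then obtain d1 where d1: "\<And>i j. i < r + s \<Longrightarrow> j < r \<Longrightarrow> ((\<lambda>z. C1 z $$ (i, j)) has_field_derivative d1 i j) (at w)"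
    by (metis lessThan_iff)
  (* The difference quotient, with only the entries of C divided by z - w. *)
  define Q where "Q z = ip S (u z) (sol (cnj w) k) - (\<Sum>i<r + s.
      ((\<Sum>j<r + s. (C0 z $$ (i, j) - C0 w $$ (i, j)) / (z - w) * G0b (u z) $ j) +
       (\<Sum>j<r. (C1 z $$ (i, j) - C1 w $$ (i, j)) / (z - w) * G1b (u z) $ j)) * cnj (x $ i))" for z
  have "(Q \<longlongrightarrow> ip S (u w) (sol (cnj w) k) - (\<Sum>i<r + s.
      ((\<Sum>j<r + s. d0 i j * G0b (u w) $ j) + (\<Sum>j<r. d1 i j * G1b (u w) $ j)) * cnj (x $ i))) (at w)"
    unfolding Q_def
    by (intro tendsto_diff ip_sol_tendsto[OF L] tendsto_sum tendsto_mult tendsto_add tendsto_const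
        Gb_sol_tendsto d0[unfolded has_field_derivative_iff] d1[unfolded has_field_derivative_iff]) auto
  moreover have "\<forall>\<^sub>F z in at w. Q z = ((M z *\<^sub>v h) \<bullet>c k - (M w *\<^sub>v h) \<bullet>c k) / (z - w)"
    using eventually_upper eventually_neq_at_within[of w w UNIV]
  proof eventually_elim
    case (elim z)
    then have z: "Im z > 0" and ne: "z - w \<noteq> 0" by auto
    then have z0: "Im z \<noteq> 0" by simp
    define e where "e i = (\<Sum>j<r + s. (C0 z $$ (i, j) - C0 w $$ (i, j)) * G0b (u z) $ j) +
       (\<Sum>j<r. (C1 z $$ (i, j) - C1 w $$ (i, j)) * G1b (u z) $ j)" for i
    have "defect z \<bullet>c x = (\<Sum>i<r + s. - e i * cnj (x $ i))"
      unfolding cdot_eq_sum[OF x(1)] by (intro sum.cong refl) (simp add: defect_index[OF z] e_def)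
    moreover have "Q z = ip S (u z) (sol (cnj w) k) + (\<Sum>i<r + s. - e i * cnj (x $ i)) / (z - w)"
    proof -
      have "(\<Sum>j<r + s. (C0 z $$ (i, j) - C0 w $$ (i, j)) / (z - w) * G0b (u z) $ j) +
          (\<Sum>j<r. (C1 z $$ (i, j) - C1 w $$ (i, j)) / (z - w) * G1b (u z) $ j) = e i / (z - w)" for i
        by (simp add: e_def sum_divide_distrib add_divide_distrib)
      then show ?thesis by (simp add: Q_def sum_negf sum_divide_distrib)
    qed
    ultimately show ?case unfolding x(2)[OF z] using ne by (simp add: add_divide_distrib)
  qed
  ultimately have "((\<lambda>z. ((M z *\<^sub>v h) \<bullet>c k - (M w *\<^sub>v h) \<bullet>c k) / (z - w)) \<longlongrightarrow> ip S (u w) (sol (cnj w) k) - (\<Sum>i<r + s.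
      ((\<Sum>j<r + s. d0 i j * G0b (u w) $ j) + (\<Sum>j<r. d1 i j * G1b (u w) $ j)) * cnj (x $ i))) (at w)"
    by (rule Lim_transform_eventually)
  then show ?thesis unfolding has_field_derivative_iff by blast
qed

end

end

section \<open>The Nevanlinna property\<close>

context boundary_problem
begin

lemma M_entry_differentiable_upper:
  assumes w: "Im w > 0" and ij: "i < dim0 S" "j < dim0 S"
  shows "(\<lambda>\<zeta>. M \<zeta> $$ (i, j)) field_differentiable (at w)"
proof -
  obtain d where "((\<lambda>\<zeta>. (M \<zeta> *\<^sub>v unit_vec (dim0 S) j) \<bullet>c unit_vec (dim0 S) i) has_field_derivative d) (at w)"
    using M_form_differentiable[OF w unit_vec_carrier unit_vec_carrier] by blast
  moreover have ev: "\<forall>\<^sub>F \<zeta> in nhds w. (M \<zeta> *\<^sub>v unit_vec (dim0 S) j) \<bullet>c unit_vec (dim0 S) i = M \<zeta> $$ (i, j)"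
  proof -
    have "\<forall>\<^sub>F \<zeta> in nhds w. \<zeta> \<in> {z. Im z > 0}"
      by (rule eventually_nhds_in_open[OF open_halfspace_Im_gt]) (use w in simp)
    then show ?thesis
    proof (rule eventually_mono)
      fix \<zeta> assume "\<zeta> \<in> {z. Im z > 0}"
      then have "Im \<zeta> \<noteq> 0" by simp
      from mat_index_eq_cdot[OF M_carrier[OF this] ij]
      show "(M \<zeta> *\<^sub>v unit_vec (dim0 S) j) \<bullet>c unit_vec (dim0 S) i = M \<zeta> $$ (i, j)" ..
    qed
  qed
  ultimately have "((\<lambda>\<zeta>. M \<zeta> $$ (i, j)) has_field_derivative d) (at w)"
    using DERIV_cong_ev[OF refl ev refl, THEN iffD1] by blast
  then show ?thesis unfolding field_differentiable_def by blast
qed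

theorem M_holomorphic: "holomorphic_op (dim0 S) (dim0 S) M {z. Im z \<noteq> 0}"
  unfolding holomorphic_op_def
proof (intro conjI allI impI ballI)
  fix z assume "z \<in> {z. Im z \<noteq> 0}"
  then show "M z \<in> carrier_mat (dim0 S) (dim0 S)" using M_carrier by simp
next
  fix i j assume ij: "i < dim0 S" "j < dim0 S"
  show "(\<lambda>z. M z $$ (i, j)) holomorphic_on {z. Im z \<noteq> 0}"
    unfolding holomorphic_on_def
  proof
    fix z assume "z \<in> {z. Im z \<noteq> 0}"
    then have z: "Im z \<noteq> 0" by simp
    have "(\<lambda>z. M z $$ (i, j)) field_differentiable (at z)"
    proof (cases "Im z > 0")
      case False
      then have z': "Im (cnj z) > 0" using z by simp
      have "(cnj \<circ> (\<lambda>z. M z $$ (j, i)) \<circ> cnj) field_differentiable (at z)"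
        using M_entry_differentiable_upper[OF z' ij(2,1)] by (simp add: field_differentiable_cnj_cnj)
      then obtain d where d: "((cnj \<circ> (\<lambda>z. M z $$ (j, i)) \<circ> cnj) has_field_derivative d) (at z)"
        unfolding field_differentiable_def by blast
      have "\<forall>\<^sub>F \<zeta> in nhds z. \<zeta> \<in> {z. Im z < 0}"
        by (rule eventually_nhds_in_open[OF open_halfspace_Im_lt]) (use z' in simp)
      then have ev: "\<forall>\<^sub>F \<zeta> in nhds z. (cnj \<circ> (\<lambda>z. M z $$ (j, i)) \<circ> cnj) \<zeta> = M \<zeta> $$ (i, j)"
      proof (rule eventually_mono)
        fix \<zeta> assume "\<zeta> \<in> {z. Im z < 0}"
        then have n: "Im (cnj \<zeta>) \<noteq> 0" by simp
        show "(cnj \<circ> (\<lambda>z. M z $$ (j, i)) \<circ> cnj) \<zeta> = M \<zeta> $$ (i, j)"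
          using M_adjoint[OF n] mat_adjoint_index[OF M_carrier[OF n] ij] by simp
      qed
      have "((\<lambda>\<zeta>. M \<zeta> $$ (i, j)) has_field_derivative d) (at z)"
        by (rule DERIV_cong_ev[OF refl ev refl, THEN iffD1, OF d])
      then show ?thesis unfolding field_differentiable_def by blast
    qed (rule M_entry_differentiable_upper[OF _ ij])
    then show "(\<lambda>z. M z $$ (i, j)) field_differentiable (at z within {z. Im z \<noteq> 0})"
      by (rule field_differentiable_at_within)
  qed
qed

end

theorem proposition5p7:
  fixes S :: symsys and U Ut :: "complex mat" and r s :: nat
    and G0b Ghb G1b :: "(real \<Rightarrow> complex vec) \<Rightarrow> complex vec"
    and C0 C1 D0 D1 :: "complex \<Rightarrow> complex mat"
    and v :: "complex \<Rightarrow> real \<Rightarrow> complex mat"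
  assumes "symmetric_system S" and "definite_system S"
    and "boundary_op_a S U Ut"
    and "n_minus S \<le> n_plus S"
    and "boundary_map_b S r s G0b Ghb G1b"
    and "boundary_parameter r s C0 C1 D0 D1"
    and "\<And>\<zeta>. Im \<zeta> \<noteq> 0 \<Longrightarrow> is_v_tau S Ut r s G0b Ghb G1b C0 C1 D0 D1 \<zeta> (v \<zeta>)"
  shows "nevanlinna_op (dim0 S) (m_function S Ut v) \<and>
    (\<forall>\<zeta>. Im \<zeta> > 0 \<longrightarrow>
       op_ge (dim0 S) (complex_of_real (inverse (Im \<zeta>)) \<cdot>\<^sub>m Im_op (m_function S Ut v \<zeta>))
         (weyl_integral S (v \<zeta>))) \<and>
    (n_plus S = n_minus S \<longrightarrow> (\<forall>\<zeta>. Im \<zeta> \<noteq> 0 \<longrightarrow>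
       op_ge (dim0 S) (complex_of_real (inverse (Im \<zeta>)) \<cdot>\<^sub>m Im_op (m_function S Ut v \<zeta>))
         (weyl_integral S (v \<zeta>))))"
proof -
  interpret boundary_problem S U Ut r s G0b Ghb G1b C0 C1 D0 D1 v
    using assms by unfold_locales
  show ?thesis
    unfolding nevanlinna_op_def using M_holomorphic Im_M_nonneg M_adjoint Weyl_inequality by auto
qed

end
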